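(* Let $\ \widehat{}\ $ denote the Pontryagin duality functor. (a) For $\ \widehat{}:\mathbf{TAG}\to\mathbf{TdCAG}$, the pair $(\mathbf h_{\mathfrak{sub}},\mathbf h_{\mathfrak{sub}_o^\star})$ satisfies $SBT_{\;\widehat{}\;}$. In particular, the pair $(\mathrm{ent},h_{top})$ satisfies $BT_{\;\widehat{}\;}$, i.e. $h_{top}(\widehat\phi)=\mathrm{ent}(\phi)$ for every endomorphism $\phi$ of a torsion abelian group. (b) For $\ \widehat{}:\mathbf{TdCAG}\to\mathbf{TAG}$, the pair $(\mathbf h_{\mathfrak{sub}_o^\star},\mathbf h_{\mathfrak{sub}})$ satisfies $SBT_{\;\widehat{}\;}$. In particular, the pair $(h_{top},\mathrm{ent})$ satisfies $BT_{\;\widehat{}\;}$ (with constant $C=1$), i.e. $\mathrm{ent}(\widehat\psi)=h_{top}(\psi)$ for every continuous endomorphism $\psi$ of a totally disconnected compact abelian group.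
   Context: $\mathbf{TAG}$ is the category of torsion abelian groups and homomorphisms; $\mathbf{TdCAG}$ is the category of totally disconnected compact (Hausdorff) abelian groups and continuous homomorphisms. A normed semigroup $(S,v)$ is a semigroup $S$ with a function $v:S\to\mathbb R_{\ge0}$. $\mathfrak S^*$ is the category of normed semigroups and all semigroup homomorphisms; $\mathfrak S$ has the same objects and only contractive homomorphisms ($v'(\phi(x))\le v(x)$). For an endomorphism $\phi$ of $(S,v)$, $T_n(\phi,x)=x\cdot\phi(x)\cdots\phi^{n-1}(x)$ and $h_{\mathfrak S}(\phi)=\sup_{x\in S}\limsup_{n\to\infty}\frac{v(T_n(\phi,x))}{n}$. For a functor $F$ with values in $\mathfrak S$, $\mathbf h_F(\phi)=h_{\mathfrak S}(F(\phi))$. For functors $\varepsilon:\mathfrak X_1\to\mathfrak X_2$, $F_i:\mathfrak X_i\to\mathfrak S$ such that $F_1$ and $F_2\varepsilon$ have the same variance, the pair $(\mathbf h_{F_1},\mathbf h_{F_2})$ satisfies $SBT_\varepsilon$ if there is a natural transformation $\eta:F_1\to F_2\varepsilon$ (in $\mathfrak S^*$) such that each $\eta_X$ is a norm-preserving semigroup isomorphism. A pair of entropies $(h_1,h_2)$ on $\mathfrak X_1,\mathfrak X_2$ satisfies $BT_\varepsilon$ if $h_2(\varepsilon(\phi))=h_1(\phi)$ for every endomorphism $\phi$ in $\mathfrak X_1$. Functor $\mathfrak{sub}$ (covariant, on abelian groups): $\mathfrak{sub}(G)=\mathcal F(G)$ is the semilattice of all finite subgroups of $G$ under $+$ with norm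 $v(F)=\log|F|$, and $\mathfrak{sub}(\phi):F\mapsto\phi(F)$. Functor $\mathfrak{sub}_o^\star$ (contravariant, on totally disconnected compact groups): $\mathfrak{sub}_o^\star(K)=\mathcal V_K(1)$ is the semilattice of all open normal subgroups $V$ of $K$ (they have finite index) under $\cap$ with norm $v(V)=\log[K:V]$, and $\mathfrak{sub}_o^\star(\phi):V\mapsto\phi^{-1}(V)$. $\mathrm{ent}(\phi)=\sup\{\lim_{n}\frac{1}{n}\log|F+\phi(F)+\dots+\phi^{n-1}(F)|: F\in\mathcal F(G)\}$ for an endomorphism $\phi$ of an abelian group $G$. For a continuous selfmap $\phi$ of a compact space $X$, $h_{top}(\phi)=\sup_{\mathcal U}\lim_n\frac1n\log N(\mathcal U\vee\phi^{-1}(\mathcal U)\vee\dots\vee\phi^{-n+1}(\mathcal U))$, where $\mathcal U$ runs over all open covers of $X$, $N(\mathcal U)$ is the minimal cardinality of a finite subcover of $\mathcal U$, and $\mathcal U_1\vee\dots\vee\mathcal U_m=\{\bigcap_i U_i:U_i\in\mathcal U_i\}$. *)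

theory Defs
  imports "HOL-Analysis.Analysis" "HOL-Algebra.Coset"
begin

section \<open>Categories and functors\<close>

text \<open>
  A morphism carries no record of its domain and codomain, so composition, and the action of a
  functor on morphisms, receive the objects as arguments:
  \<open>cmp C X Y Z g f\<close> is \<open>g\<close> after \<open>f\<close> for \<open>f : X \<rightarrow> Y\<close>, \<open>g : Y \<rightarrow> Z\<close>, and
  \<open>farr F X Y f\<close> is the image of \<open>f : X \<rightarrow> Y\<close>.
  In the concrete categories below a morphism is a function that is extensional on the carrier of
  its domain, so that equal morphisms are equal functions.
\<close>

record ('o, 'm) category =
  obj   :: "'o set"
  mor   :: "'o \<Rightarrow> 'o \<Rightarrow> 'm set"
  ident :: "'o \<Rightarrow> 'm"
  cmp   :: "'o \<Rightarrow> 'o \<Rightarrow> 'o \<Rightarrow> 'm \<Rightarrow> 'm \<Rightarrow> 'm"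

definition is_category :: "('o, 'm) category \<Rightarrow> bool" where
  "is_category C \<longleftrightarrow>
     (\<forall>X\<in>obj C. ident C X \<in> mor C X X) \<and>
     (\<forall>X\<in>obj C. \<forall>Y\<in>obj C. \<forall>Z\<in>obj C. \<forall>f\<in>mor C X Y. \<forall>g\<in>mor C Y Z. cmp C X Y Z g f \<in> mor C X Z) \<and>
     (\<forall>X\<in>obj C. \<forall>Y\<in>obj C. \<forall>f\<in>mor C X Y.
        cmp C X X Y f (ident C X) = f \<and> cmp C X Y Y (ident C Y) f = f) \<and>
     (\<forall>W\<in>obj C. \<forall>X\<in>obj C. \<forall>Y\<in>obj C. \<forall>Z\<in>obj C. \<forall>f\<in>mor C W X. \<forall>g\<in>mor C X Y. \<forall>h\<in>mor C Y Z.
        cmp C W Y Z h (cmp C W X Y g f) = cmp C W X Z (cmp C X Y Z h g) f)"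

definition op_cat :: "('o, 'm) category \<Rightarrow> ('o, 'm) category" where
  "op_cat C = \<lparr> obj = obj C, mor = (\<lambda>X Y. mor C Y X), ident = ident C,
               cmp = (\<lambda>X Y Z g f. cmp C Z Y X f g) \<rparr>"

record ('o, 'm, 'p, 'n) functor_data =
  fobj :: "'o \<Rightarrow> 'p"
  farr :: "'o \<Rightarrow> 'o \<Rightarrow> 'm \<Rightarrow> 'n"

text \<open>
  All functors are covariant; a contravariant functor from \<open>C\<close> to \<open>D\<close> is a functor from
  \<open>op_cat C\<close> to \<open>D\<close>, or equivalently one from \<open>C\<close> to \<open>op_cat D\<close>. Its action on
  \<open>f : X \<rightarrow> Y\<close> in \<open>C\<close> is \<open>farr F Y X f\<close> in the first form and \<open>farr F X Y f\<close> in the second.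
\<close>

definition is_functor ::
    "('o, 'm) category \<Rightarrow> ('p, 'n) category \<Rightarrow> ('o, 'm, 'p, 'n) functor_data \<Rightarrow> bool" where
  "is_functor C D F \<longleftrightarrow>
     (\<forall>X\<in>obj C. fobj F X \<in> obj D) \<and>
     (\<forall>X\<in>obj C. \<forall>Y\<in>obj C. \<forall>f\<in>mor C X Y. farr F X Y f \<in> mor D (fobj F X) (fobj F Y)) \<and>
     (\<forall>X\<in>obj C. farr F X X (ident C X) = ident D (fobj F X)) \<and>
     (\<forall>X\<in>obj C. \<forall>Y\<in>obj C. \<forall>Z\<in>obj C. \<forall>f\<in>mor C X Y. \<forall>g\<in>mor C Y Z.
        farr F X Z (cmp C X Y Z g f) =
        cmp D (fobj F X) (fobj F Y) (fobj F Z) (farr F Y Z g) (farr F X Y f))"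

definition functor_comp ::
    "('p, 'n, 'q, 'k) functor_data \<Rightarrow> ('o, 'm, 'p, 'n) functor_data \<Rightarrow> ('o, 'm, 'q, 'k) functor_data"
  where
  "functor_comp F E = \<lparr> fobj = (\<lambda>X. fobj F (fobj E X)),
     farr = (\<lambda>X Y f. farr F (fobj E X) (fobj E Y) (farr E X Y f)) \<rparr>"


section \<open>Normed semigroups and semigroup entropy\<close>

record 'a normed_semigroup = "'a partial_object" +
  sgmult :: "'a \<Rightarrow> 'a \<Rightarrow> 'a"
  sgnorm :: "'a \<Rightarrow> real"

definition is_normed_semigroup :: "'a normed_semigroup \<Rightarrow> bool" where
  "is_normed_semigroup S \<longleftrightarrow>
     (\<forall>x\<in>carrier S. \<forall>y\<in>carrier S. sgmult S x y \<in> carrier S) \<and>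
     (\<forall>x\<in>carrier S. \<forall>y\<in>carrier S. \<forall>z\<in>carrier S.
        sgmult S (sgmult S x y) z = sgmult S x (sgmult S y z)) \<and>
     (\<forall>x\<in>carrier S. 0 \<le> sgnorm S x)"

text \<open>
  The morphisms of \<open>\<SS>\<^sup>*\<close>. The two semigroups may live on different types, which a
  natural transformation between two functors into normed semigroups requires.
\<close>

definition semigroup_hom :: "'a normed_semigroup \<Rightarrow> 'b normed_semigroup \<Rightarrow> ('a \<Rightarrow> 'b) set" where
  "semigroup_hom S T =
     {f \<in> carrier S \<rightarrow>\<^sub>E carrier T.
        \<forall>x\<in>carrier S. \<forall>y\<in>carrier S. f (sgmult S x y) = sgmult T (f x) (f y)}"

definition normed_semigroup_iso :: "'a normed_semigroup \<Rightarrow> 'b normed_semigroup \<Rightarrow> ('a \<Rightarrow> 'b) set" where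
  "normed_semigroup_iso S T =
     {f \<in> semigroup_hom S T. bij_betw f (carrier S) (carrier T) \<and>
        (\<forall>x\<in>carrier S. sgnorm T (f x) = sgnorm S x)}"

text \<open>The category \<open>\<SS>\<close> of normed semigroups and contractive homomorphisms.\<close>

definition NSem :: "('a normed_semigroup, 'a \<Rightarrow> 'a) category" where
  "NSem = \<lparr> obj = {S. is_normed_semigroup S},
     mor = (\<lambda>S T. {f \<in> semigroup_hom S T. \<forall>x\<in>carrier S. sgnorm T (f x) \<le> sgnorm S x}),
     ident = (\<lambda>S. \<lambda>x\<in>carrier S. x),
     cmp = (\<lambda>S T U g f. compose (carrier S) g f) \<rparr>"

text \<open>\<open>x \<cdot> \<phi> x \<cdots> \<phi>\<^sup>n\<^sup>-\<^sup>1 x\<close> for \<open>n \<ge> 1\<close>; the value at \<open>n = 0\<close> is immaterial.\<close>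

primrec semigroup_traj :: "'a normed_semigroup \<Rightarrow> ('a \<Rightarrow> 'a) \<Rightarrow> 'a \<Rightarrow> nat \<Rightarrow> 'a" where
  "semigroup_traj S \<phi> x 0 = x"
| "semigroup_traj S \<phi> x (Suc n) =
     (if n = 0 then x else sgmult S (semigroup_traj S \<phi> x n) ((\<phi> ^^ n) x))"

definition semigroup_entropy :: "'a normed_semigroup \<Rightarrow> ('a \<Rightarrow> 'a) \<Rightarrow> ennreal" where
  "semigroup_entropy S \<phi> =
     (SUP x\<in>carrier S. limsup (\<lambda>n. ennreal (sgnorm S (semigroup_traj S \<phi> x n) / real n)))"

definition functor_entropy ::
    "('o, 'm, 'a normed_semigroup, 'a \<Rightarrow> 'a) functor_data \<Rightarrow> 'o \<Rightarrow> 'm \<Rightarrow> ennreal" where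
  "functor_entropy F X \<phi> = semigroup_entropy (fobj F X) (farr F X X \<phi>)"


section \<open>Bridge theorems\<close>

definition BT ::
    "('o, 'm) category \<Rightarrow> ('o, 'm, 'p, 'n) functor_data \<Rightarrow>
     ('o \<Rightarrow> 'm \<Rightarrow> ennreal) \<Rightarrow> ('p \<Rightarrow> 'n \<Rightarrow> ennreal) \<Rightarrow> bool" where
  "BT C E h1 h2 \<longleftrightarrow>
     (\<forall>X\<in>obj C. \<forall>\<phi>\<in>mor C X X. h2 (fobj E X) (farr E X X \<phi>) = h1 X \<phi>)"

definition natural_transformation ::
    "('o, 'm) category \<Rightarrow> ('o, 'm, 'a normed_semigroup, 'a \<Rightarrow> 'a) functor_data \<Rightarrow>
     ('o, 'm, 'b normed_semigroup, 'b \<Rightarrow> 'b) functor_data \<Rightarrow> ('o \<Rightarrow> 'a \<Rightarrow> 'b) \<Rightarrow> bool" where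
  "natural_transformation C F G \<eta> \<longleftrightarrow>
     (\<forall>X\<in>obj C. \<eta> X \<in> semigroup_hom (fobj F X) (fobj G X)) \<and>
     (\<forall>X\<in>obj C. \<forall>Y\<in>obj C. \<forall>f\<in>mor C X Y.
        compose (carrier (fobj F X)) (farr G X Y f) (\<eta> X) =
        compose (carrier (fobj F X)) (\<eta> Y) (farr F X Y f))"

text \<open>
  The strong bridge theorem for the pair of functor entropies of \<open>F1\<close> and \<open>F2\<close>. That \<open>F1\<close> and
  \<open>F2 \<circ> E\<close> have the same variance is expressed by both being functors out of \<open>C\<close>, where \<open>C\<close>
  and \<open>D\<close> may be opposite categories.
\<close>

definition SBT ::
    "('o, 'm) category \<Rightarrow> ('p, 'n) category \<Rightarrow> ('o, 'm, 'p, 'n) functor_data \<Rightarrow>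
     ('o, 'm, 'a normed_semigroup, 'a \<Rightarrow> 'a) functor_data \<Rightarrow>
     ('p, 'n, 'b normed_semigroup, 'b \<Rightarrow> 'b) functor_data \<Rightarrow> bool" where
  "SBT C D E F1 F2 \<longleftrightarrow>
     is_functor C D E \<and> is_functor C NSem F1 \<and> is_functor D NSem F2 \<and>
     (\<exists>\<eta>. natural_transformation C F1 (functor_comp F2 E) \<eta> \<and>
          (\<forall>X\<in>obj C. \<eta> X \<in> normed_semigroup_iso (fobj F1 X) (fobj F2 (fobj E X))))"


section \<open>Torsion abelian groups and totally disconnected compact abelian groups\<close>

definition TAG :: "('a monoid, 'a \<Rightarrow> 'a) category" where
  "TAG = \<lparr> obj = {G. comm_group G \<and>
                   (\<forall>x\<in>carrier G. \<exists>n::nat. n > 0 \<and> x [^]\<^bsub>G\<^esub> n = \<one>\<^bsub>G\<^esub>)},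
     mor = (\<lambda>G H. hom G H \<inter> extensional (carrier G)),
     ident = (\<lambda>G. \<lambda>x\<in>carrier G. x),
     cmp = (\<lambda>G H K g f. compose (carrier G) g f) \<rparr>"

record 'a top_group = "'a monoid" +
  topo :: "'a topology"

definition is_top_group :: "'a top_group \<Rightarrow> bool" where
  "is_top_group K \<longleftrightarrow> group K \<and> topspace (topo K) = carrier K \<and>
     continuous_map (prod_topology (topo K) (topo K)) (topo K) (\<lambda>(x, y). x \<otimes>\<^bsub>K\<^esub> y) \<and>
     continuous_map (topo K) (topo K) (\<lambda>x. inv\<^bsub>K\<^esub> x)"

definition totally_disconnected_space :: "'a topology \<Rightarrow> bool" where
  "totally_disconnected_space X \<longleftrightarrow>
     (\<forall>x\<in>topspace X. connected_component_of_set X x = {x})"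

definition TdCAG :: "('a top_group, 'a \<Rightarrow> 'a) category" where
  "TdCAG = \<lparr> obj = {K. is_top_group K \<and> comm_group K \<and> compact_space (topo K) \<and>
                     Hausdorff_space (topo K) \<and> totally_disconnected_space (topo K)},
     mor = (\<lambda>K L. {f \<in> hom K L \<inter> extensional (carrier K). continuous_map (topo K) (topo L) f}),
     ident = (\<lambda>K. \<lambda>x\<in>carrier K. x),
     cmp = (\<lambda>K L M g f. compose (carrier K) g f) \<rparr>"


section \<open>Pontryagin duality\<close>

definition circle_group :: "complex top_group" where
  "circle_group = \<lparr> carrier = sphere 0 1, mult = (*), one = 1, topo = top_of_set (sphere 0 1) \<rparr>"

definition characters :: "'a top_group \<Rightarrow> ('a \<Rightarrow> complex) set" where
  "characters K = {\<xi> \<in> hom K circle_group \<inter> extensional (carrier K).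
     continuous_map (topo K) (topo circle_group) \<xi>}"

definition compact_open_topology :: "'a top_group \<Rightarrow> ('a \<Rightarrow> complex) topology" where
  "compact_open_topology K = topology_generated_by
     {{\<xi> \<in> characters K. \<xi> ` C \<subseteq> U} | C U. compactin (topo K) C \<and> openin (topo circle_group) U}"

definition dual :: "'a top_group \<Rightarrow> ('a \<Rightarrow> complex) top_group" where
  "dual K = \<lparr> carrier = characters K,
     mult = (\<lambda>\<xi> \<psi>. \<lambda>x\<in>carrier K. \<xi> x * \<psi> x), one = (\<lambda>x\<in>carrier K. 1),
     topo = compact_open_topology K \<rparr>"

text \<open>For \<open>f : K \<rightarrow> L\<close>, the map \<open>dual_map K L f : dual L \<rightarrow> dual K\<close> is precomposition with \<open>f\<close>.\<close>

definition dual_map ::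
    "'a top_group \<Rightarrow> 'a top_group \<Rightarrow> ('a \<Rightarrow> 'a) \<Rightarrow> ('a \<Rightarrow> complex) \<Rightarrow> ('a \<Rightarrow> complex)" where
  "dual_map K L f = (\<lambda>\<xi>\<in>characters L. compose (carrier K) \<xi> f)"

definition discrete_group :: "'a monoid \<Rightarrow> 'a top_group" where
  "discrete_group G = \<lparr> carrier = carrier G, mult = monoid.mult G, one = monoid.one G,
     topo = discrete_topology (carrier G) \<rparr>"

text \<open>Pontryagin duality as a functor from \<open>TAG\<close> to \<open>op_cat TdCAG\<close>.\<close>

definition dual_TAG :: "('a monoid, 'a \<Rightarrow> 'a, ('a \<Rightarrow> complex) top_group,
    ('a \<Rightarrow> complex) \<Rightarrow> ('a \<Rightarrow> complex)) functor_data" where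
  "dual_TAG = \<lparr> fobj = (\<lambda>G. dual (discrete_group G)),
     farr = (\<lambda>G H f. dual_map (discrete_group G) (discrete_group H) f) \<rparr>"

text \<open>
  Pontryagin duality as a functor from \<open>op_cat TdCAG\<close> to \<open>TAG\<close>. The dual of a compact group is
  discrete, and objects of \<open>TAG\<close> carry no topology, so the topology of the dual is dropped.
\<close>

definition dual_TdCAG :: "('a top_group, 'a \<Rightarrow> 'a, ('a \<Rightarrow> complex) monoid,
    ('a \<Rightarrow> complex) \<Rightarrow> ('a \<Rightarrow> complex)) functor_data" where
  "dual_TdCAG = \<lparr> fobj = (\<lambda>K. monoid.truncate (dual K)),
     farr = (\<lambda>L K f. dual_map K L f) \<rparr>"


section \<open>The functors of finite subgroups and of open normal subgroups\<close>

definition sub_semigroup :: "'a monoid \<Rightarrow> 'a set normed_semigroup" where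
  "sub_semigroup G = \<lparr> carrier = {F. subgroup F G \<and> finite F},
     sgmult = (\<lambda>F F'. F <#>\<^bsub>G\<^esub> F'), sgnorm = (\<lambda>F. ln (real (card F))) \<rparr>"

definition sub_functor ::
    "('a monoid, 'a \<Rightarrow> 'a, 'a set normed_semigroup, 'a set \<Rightarrow> 'a set) functor_data" where
  "sub_functor = \<lparr> fobj = sub_semigroup,
     farr = (\<lambda>G H f. \<lambda>F\<in>carrier (sub_semigroup G). f ` F) \<rparr>"

definition sub_o_semigroup :: "'a top_group \<Rightarrow> 'a set normed_semigroup" where
  "sub_o_semigroup K = \<lparr> carrier = {V. V \<lhd> K \<and> openin (topo K) V},
     sgmult = (\<inter>), sgnorm = (\<lambda>V. ln (real (card (rcosets\<^bsub>K\<^esub> V)))) \<rparr>"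

text \<open>A functor on \<open>op_cat TdCAG\<close>: for \<open>f : K \<rightarrow> L\<close> the map goes from \<open>L\<close> to \<open>K\<close>.\<close>

definition sub_o_functor ::
    "('a top_group, 'a \<Rightarrow> 'a, 'a set normed_semigroup, 'a set \<Rightarrow> 'a set) functor_data" where
  "sub_o_functor = \<lparr> fobj = sub_o_semigroup,
     farr = (\<lambda>L K f. \<lambda>V\<in>carrier (sub_o_semigroup L). f -` V \<inter> carrier K) \<rparr>"


section \<open>Algebraic entropy and topological entropy\<close>

primrec group_traj :: "'a monoid \<Rightarrow> ('a \<Rightarrow> 'a) \<Rightarrow> 'a set \<Rightarrow> nat \<Rightarrow> 'a set" where
  "group_traj G \<phi> F 0 = {\<one>\<^bsub>G\<^esub>}"
| "group_traj G \<phi> F (Suc n) = group_traj G \<phi> F n <#>\<^bsub>G\<^esub> ((\<phi> ^^ n) ` F)"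

definition ent :: "'a monoid \<Rightarrow> ('a \<Rightarrow> 'a) \<Rightarrow> ennreal" where
  "ent G \<phi> = (SUP F\<in>{F. subgroup F G \<and> finite F}.
     lim (\<lambda>n. ennreal (ln (real (card (group_traj G \<phi> F n))) / real n)))"

definition open_covers :: "'a topology \<Rightarrow> 'a set set set" where
  "open_covers X = {\<U>. (\<forall>U\<in>\<U>. openin X U) \<and> \<Union>\<U> = topspace X}"

definition min_subcover :: "'a topology \<Rightarrow> 'a set set \<Rightarrow> nat" where
  "min_subcover X \<U> = (LEAST k. \<exists>\<V>. finite \<V> \<and> \<V> \<subseteq> \<U> \<and> \<Union>\<V> = topspace X \<and> card \<V> = k)"

definition preimage_cover :: "'a topology \<Rightarrow> ('a \<Rightarrow> 'a) \<Rightarrow> 'a set set \<Rightarrow> 'a set set" where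
  "preimage_cover X f \<U> = (\<lambda>U. f -` U \<inter> topspace X) ` \<U>"

definition cover_join :: "'a topology \<Rightarrow> nat \<Rightarrow> (nat \<Rightarrow> 'a set set) \<Rightarrow> 'a set set" where
  "cover_join X n \<W> = {topspace X \<inter> (\<Inter>i<n. U i) | U. \<forall>i<n. U i \<in> \<W> i}"

definition h_top :: "'a topology \<Rightarrow> ('a \<Rightarrow> 'a) \<Rightarrow> ennreal" where
  "h_top X \<phi> = (SUP \<U>\<in>open_covers X.
     lim (\<lambda>n. ennreal (ln (real (min_subcover X
       (cover_join X n (\<lambda>i. preimage_cover X (\<phi> ^^ i) \<U>)))) / real n)))"


section \<open>Sanity checks\<close>

lemma is_category_op_cat: "is_category C \<Longrightarrow> is_category (op_cat C)"
  unfolding is_category_def op_cat_def by simp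

lemma is_category_NSem: "is_category NSem"
  unfolding is_category_def NSem_def is_normed_semigroup_def semigroup_hom_def
  by (auto simp: compose_def PiE_iff extensional_def fun_eq_iff) (meson order_trans)+

lemma is_category_TAG: "is_category TAG"
  unfolding is_category_def TAG_def
  by (auto simp: compose_def hom_def Pi_iff extensional_def fun_eq_iff
      comm_group_def comm_monoid_def monoid.m_closed)

lemma is_category_TdCAG: "is_category TdCAG"
proof -
  have *: "continuous_map (topo K) (topo M) (compose (carrier K) g f)"
    if "is_top_group K" "continuous_map (topo K) (topo L) f" "continuous_map (topo L) (topo M) g"
    for K L M :: "'a top_group" and f g
    using continuous_map_compose[OF that(2,3)] that(1)
    by (elim continuous_map_eq) (auto simp: compose_def is_top_group_def)
  have **: "continuous_map (topo K) (topo K) (\<lambda>x\<in>carrier K. x)" if "is_top_group K"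
    for K :: "'a top_group"
    using continuous_map_id by (rule continuous_map_eq) (use that in \<open>auto simp: is_top_group_def\<close>)
  show ?thesis
    unfolding is_category_def TdCAG_def
    using * ** by (auto simp: hom_def Pi_iff compose_def extensional_def fun_eq_iff
        comm_group_def comm_monoid_def monoid.m_closed)
qed

lemma SBT_imp_BT:
  assumes "SBT C D E F1 F2"
  shows "BT C E (functor_entropy F1) (functor_entropy F2)"
proof -
  obtain \<eta> where nat: "natural_transformation C F1 (functor_comp F2 E) \<eta>"
    and iso: "\<And>X. X \<in> obj C \<Longrightarrow> \<eta> X \<in> normed_semigroup_iso (fobj F1 X) (fobj F2 (fobj E X))"
    and F1: "is_functor C NSem F1"
    using assms unfolding SBT_def by blast
  show ?thesis
    unfolding BT_def functor_entropy_def
  proof (intro ballI)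
    fix X \<phi> assume X: "X \<in> obj C" and \<phi>: "\<phi> \<in> mor C X X"
    define S T f g e where "S = fobj F1 X" and "T = fobj F2 (fobj E X)"
      and "f = farr F1 X X \<phi>" and "g = farr F2 (fobj E X) (fobj E X) (farr E X X \<phi>)"
      and "e = \<eta> X"
    note defs = this
    have S: "is_normed_semigroup S" and f: "f \<in> semigroup_hom S S"
      using F1 X \<phi> by (auto simp: is_functor_def NSem_def defs)
    have e: "e \<in> semigroup_hom S T" and bij: "e ` carrier S = carrier T"
      and nrm: "\<And>x. x \<in> carrier S \<Longrightarrow> sgnorm T (e x) = sgnorm S x"
      using iso[OF X] by (auto simp: normed_semigroup_iso_def bij_betw_def defs)
    have "compose (carrier S) g e = compose (carrier S) e f"
      using nat X \<phi> by (auto simp: natural_transformation_def functor_comp_def defs)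
    then have comm: "g (e x) = e (f x)" if "x \<in> carrier S" for x
      using that by (metis compose_eq)
    have fS: "f x \<in> carrier S" if "x \<in> carrier S" for x
      using f that by (auto simp: semigroup_hom_def)
    have fn: "(f ^^ n) x \<in> carrier S \<and> (g ^^ n) (e x) = e ((f ^^ n) x)" if "x \<in> carrier S" for n x
      by (induction n) (auto simp: that fS comm)
    have tr: "semigroup_traj S f x n \<in> carrier S \<and>
        semigroup_traj T g (e x) n = e (semigroup_traj S f x n)" if "x \<in> carrier S" for n x
      using S e fn[OF that]
      by (induction n) (auto simp: that is_normed_semigroup_def semigroup_hom_def)
    have "semigroup_entropy T g = semigroup_entropy S f"
      unfolding semigroup_entropy_def bij[symmetric] image_image
      by (intro SUP_cong refl) (simp add: tr nrm)
    then show "semigroup_entropy (fobj F2 (fobj E X)) (farr F2 (fobj E X) (fobj E X) (farr E X X \<phi>))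
        = semigroup_entropy (fobj F1 X) (farr F1 X X \<phi>)"
      by (simp add: defs)
  qed
qed

end

theory Submission
  imports Defs "HOL-Algebra.Multiplicative_Group"
begin

text \<open>
  Both parts are one statement about a bimultiplicative pairing \<open>p : A \<times> B \<rightarrow> \<complex>\<close> between a discrete group
  \<open>A\<close> and a totally disconnected compact group \<open>B\<close>, namely evaluation of characters with either
  \<open>(A, B) = (G, dual G)\<close> or \<open>(A, B) = (dual K, K)\<close>. The annihilator \<open>F \<mapsto> F\<^sup>\<bottom>\<close> maps finite subgroups
  of \<open>A\<close> to open subgroups of \<open>B\<close>. Orthogonality of characters gives \<open>[V : F\<^sup>\<bottom>] * card (F \<inter> V\<^sup>\<bottom>) = card F\<close>
  for every subgroup \<open>V\<close> of \<open>B\<close> containing \<open>F\<^sup>\<bottom>\<close>; with \<open>V = B\<close> this is preservation of norms, and it makes \<open>\<bottom>\<close> a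
  bijection as soon as \<open>B\<close> separates the points of \<open>A\<close> and the \<open>F\<^sup>\<bottom>\<close> are cofinal among the open subgroups.
  The transformation is \<open>\<bottom>\<close> for (a) and its inverse for (b). Separation of points is an extension
  property of characters, proved by Zorn's lemma.

  For the entropies, let \<open>T\<^sub>n\<close> be the trajectory of \<open>F\<close>. The \<open>n\<close>-th iterated cover of the cover of \<open>B\<close> by
  cosets of \<open>F\<^sup>\<bottom>\<close> is the cover by cosets of \<open>T\<^sub>n\<^sup>\<bottom>\<close>, hence has exactly \<open>card T\<^sub>n\<close> nonempty members.
  By van Dantzig's theorem and compactness every open cover is refined by such a coset cover.
\<close>

section \<open>Pairings of abelian groups\<close>

text \<open>The compact side reduces to finite counting because the circle has no small subgroups: a
  continuous character of a totally disconnected compact group is trivial on an open subgroup and so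
  factors through a finite quotient. Characters extend because every nonzero complex number has
  roots of all orders, and being torsion modulo a subgroup forces the chosen values to be roots of
  unity. The equalities between \<open>ent\<close> and \<open>h_top\<close> are proved on open
  covers rather than read off the semigroup isomorphisms, since neither entropy is a semigroup
  entropy by definition. The obstacle is that both use \<open>lim\<close>, a definite description:
  an inequality between terms passes to \<open>lim\<close> only once both sequences are known to
  converge. For covering numbers this is Fekete's lemma; the numbers
  \<open>card (group_traj A \<phi> F n)\<close> inherit convergence from being covering numbers
  themselves.\<close>

lemma (in group) finite_subgroup_pow_card:
  assumes "subgroup F G" "finite F" "a \<in> F"
  shows "a [^] card F = \<one>"
proof -
  have "group (G\<lparr>carrier := F\<rparr>)" using assms(1) by (rule subgroup_imp_group)
  then have "a [^]\<^bsub>G\<lparr>carrier := F\<rparr>\<^esub> order (G\<lparr>carrier := F\<rparr>) = \<one>"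
    using group.pow_order_eq_1[of "G\<lparr>carrier := F\<rparr>" a] assms by simp
  then show ?thesis
    using nat_pow_consistent[of a "card F" F] by (simp add: order_def)
qed

lemma (in group) subgroup_set_mult_left:
  assumes "subgroup F G" "a \<in> F"
  shows "(\<lambda>x. a \<otimes> x) ` F = F"
proof -
  interpret F: subgroup F G by fact
  show ?thesis
  proof
    show "(\<lambda>x. a \<otimes> x) ` F \<subseteq> F" using assms by auto
    show "F \<subseteq> (\<lambda>x. a \<otimes> x) ` F"
    proof
      fix x assume x: "x \<in> F"
      then have "x = a \<otimes> (inv a \<otimes> x)" using assms by (simp add: m_assoc[symmetric] F.mem_carrier)
      then show "x \<in> (\<lambda>x. a \<otimes> x) ` F" using x assms by blast
    qed
  qed
qed

lemma (in group) rcoset_eq_iff: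
  assumes V: "subgroup V G" and xy: "x \<in> carrier G" "y \<in> carrier G"
  shows "V #> x = V #> y \<longleftrightarrow> x \<otimes> inv y \<in> V"
proof -
  have "V #> x = V #> y \<longleftrightarrow> x \<in> V #> y"
    using xy rcos_self[OF _ V] repr_independence[OF _ _ V] by metis
  then show ?thesis using subgroup.rcos_module[OF V group_axioms] xy by simp
qed

text \<open>Serves to compare indices: cosets are counted as values of a coset map, and two maps
  with the same fibres have equally many values.\<close>

lemma card_image_eq_if_same_fibres:
  assumes "\<And>x y. x \<in> X \<Longrightarrow> y \<in> X \<Longrightarrow> f x = f y \<longleftrightarrow> g x = g y"
  shows "card (f ` X) = card (g ` X)"
proof -
  have "bij_betw (\<lambda>c. g (inv_into X f c)) (f ` X) (g ` X)"
    by (rule bij_betw_byWitness[where f' = "\<lambda>c. f (inv_into X g c)"])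
      (use assms in \<open>auto simp: f_inv_into_f inv_into_into\<close>, (metis f_inv_into_f image_eqI inv_into_into)+)
  then show ?thesis by (rule bij_betw_same_card)
qed

text \<open>The values are nonzero complex numbers instead of points of a circle group, so that they
  can be summed. The two record schemes allow either side to be a plain monoid or to carry a
  topology.\<close>

locale pairing = A: comm_group A + B: comm_group B
  for A :: "('a, 'x) monoid_scheme" (structure) and B :: "('b, 'y) monoid_scheme" (structure) +
  fixes p :: "'a \<Rightarrow> 'b \<Rightarrow> complex"
  assumes mult_left: "\<lbrakk>a \<in> carrier A; a' \<in> carrier A; b \<in> carrier B\<rbrakk> \<Longrightarrow> p (a \<otimes>\<^bsub>A\<^esub> a') b = p a b * p a' b"
    and mult_right: "\<lbrakk>a \<in> carrier A; b \<in> carrier B; b' \<in> carrier B\<rbrakk> \<Longrightarrow> p a (b \<otimes>\<^bsub>B\<^esub> b') = p a b * p a b'"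
    and nonzero: "\<lbrakk>a \<in> carrier A; b \<in> carrier B\<rbrakk> \<Longrightarrow> p a b \<noteq> 0"
begin

definition annih :: "'a set \<Rightarrow> 'b set" where
  "annih F = {b \<in> carrier B. \<forall>a\<in>F. p a b = 1}"

definition coannih :: "'b set \<Rightarrow> 'a set" where
  "coannih V = {a \<in> carrier A. \<forall>b\<in>V. p a b = 1}"

text \<open>The character of \<open>F\<close> induced by \<open>b\<close>. It stands for the coset
  of \<open>b\<close> modulo \<open>annih F\<close>, see \<open>mem_annih_quotient_iff\<close>, in a
  form that has values to sum over.\<close>

definition res :: "'a set \<Rightarrow> 'b \<Rightarrow> 'a \<Rightarrow> complex" where
  "res F b = (\<lambda>a\<in>F. p a b)"

lemma one_left [simp]: "b \<in> carrier B \<Longrightarrow> p \<one>\<^bsub>A\<^esub> b = 1"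
  using mult_left[of "\<one>\<^bsub>A\<^esub>" "\<one>\<^bsub>A\<^esub>" b] nonzero[of "\<one>\<^bsub>A\<^esub>" b] by simp

lemma one_right [simp]: "a \<in> carrier A \<Longrightarrow> p a \<one>\<^bsub>B\<^esub> = 1"
  using mult_right[of a "\<one>\<^bsub>B\<^esub>" "\<one>\<^bsub>B\<^esub>"] nonzero[of a "\<one>\<^bsub>B\<^esub>"] by simp

lemma inv_left: "\<lbrakk>a \<in> carrier A; b \<in> carrier B\<rbrakk> \<Longrightarrow> p (inv\<^bsub>A\<^esub> a) b = inverse (p a b)"
  using mult_left[of a "inv\<^bsub>A\<^esub> a" b] nonzero[of a b] by (simp add: field_simps)

lemma inv_right: "\<lbrakk>a \<in> carrier A; b \<in> carrier B\<rbrakk> \<Longrightarrow> p a (inv\<^bsub>B\<^esub> b) = inverse (p a b)"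
  using mult_right[of a b "inv\<^bsub>B\<^esub> b"] nonzero[of a b] by (simp add: field_simps)

lemma pow_left: "\<lbrakk>a \<in> carrier A; b \<in> carrier B\<rbrakk> \<Longrightarrow> p (a [^]\<^bsub>A\<^esub> (n::nat)) b = p a b ^ n"
  by (induction n) (auto simp: mult_left)

lemma subgroup_annih:
  assumes "F \<subseteq> carrier A"
  shows "subgroup (annih F) B"
  using assms by unfold_locales (auto simp: annih_def mult_right inv_right subset_iff)

lemma subgroup_coannih:
  assumes "V \<subseteq> carrier B"
  shows "subgroup (coannih V) A"
  using assms by unfold_locales (auto simp: coannih_def mult_left inv_left subset_iff)

lemma res_eq_iff:
  assumes "F \<subseteq> carrier A" "b \<in> carrier B" "b' \<in> carrier B"
  shows "res F b = res F b' \<longleftrightarrow> (\<forall>a\<in>F. p a b = p a b')"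
  by (auto simp: res_def fun_eq_iff)

lemma mem_annih_quotient_iff:
  assumes "F \<subseteq> carrier A" "b \<in> carrier B" "b' \<in> carrier B"
  shows "b \<otimes>\<^bsub>B\<^esub> inv\<^bsub>B\<^esub> b' \<in> annih F \<longleftrightarrow> res F b = res F b'"
proof -
  have "p a b * inverse (p a b') = 1 \<longleftrightarrow> p a b = p a b'" if "a \<in> F" for a
    using nonzero[of a b'] assms that by (auto simp: field_simps)
  then show ?thesis
    using assms by (auto simp: res_eq_iff annih_def mult_right inv_right subset_iff)
qed

text \<open>By Lagrange, every value on \<open>F\<close> is a root of unity of order dividing
  \<open>card F\<close>, so only finitely many functions on \<open>F\<close> can occur.\<close>

lemma finite_res:
  assumes "subgroup F A" "finite F" "V \<subseteq> carrier B"
  shows "finite (res F ` V)"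
proof (rule finite_subset)
  have "card F \<ge> 1"
    using assms(1,2) subgroup.one_closed by (metis One_nat_def Suc_leI card_gt_0_iff empty_iff)
  then show "finite (F \<rightarrow>\<^sub>E {z::complex. z ^ card F = 1})"
    using assms(2) finite_roots_unity[of "card F"] by (intro finite_PiE) auto
  have "p a b ^ card F = 1" if "a \<in> F" "b \<in> V" for a b
    using that assms A.finite_subgroup_pow_card[OF assms(1,2) that(1)] pow_left[of a b "card F"]
      subgroup.mem_carrier[OF assms(1)] by auto
  then show "res F ` V \<subseteq> F \<rightarrow>\<^sub>E {z::complex. z ^ card F = 1}"
    by (auto simp: res_def)
qed

text \<open>Double counting: sum \<open>p a b\<close> over \<open>a \<in> F\<close> and over the classes of \<open>b \<in> V\<close> modulo the
  annihilator of \<open>F\<close>; by orthogonality only \<open>a \<in> coannih V\<close>, respectively only the trivial class,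
  contributes.\<close>

lemma card_res:
  assumes F: "subgroup F A" "finite F" and V: "subgroup V B"
  shows "card (res F ` V) * card (F \<inter> coannih V) = card F"
proof -
  interpret F: subgroup F A by fact
  interpret V: subgroup V B by fact
  define S where "S = res F ` V"
  have finS: "finite S" unfolding S_def using assms V.subset by (intro finite_res)
  have 1: "(\<Sum>s\<in>S. s a) = (if a \<in> coannih V then of_nat (card S) else 0)" if a: "a \<in> F" for a
  proof (cases "a \<in> coannih V")
    case True
    have "s a = 1" if "s \<in> S" for s
      using that True a by (auto simp: S_def res_def coannih_def)
    then have "(\<Sum>s\<in>S. s a) = (\<Sum>s\<in>S. 1)" by (intro sum.cong refl)
    then show ?thesis using True by simp
  next
    case False
    then obtain b where b: "b \<in> V" "p a b \<noteq> 1" using a by (auto simp: coannih_def F.mem_carrier)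
    \<comment> \<open>Translation by \<open>b\<close>, transported to restricted characters: it
      permutes \<open>S\<close> and multiplies the sum at \<open>a\<close> by \<open>p a b\<close>,
      which differs from 1, so the sum vanishes.\<close>
    define m where "m = (\<lambda>s. \<lambda>x\<in>F. p x b * s x)"
    have m: "m (res F c) = res F (b \<otimes>\<^bsub>B\<^esub> c)" if "c \<in> V" for c
      using that b by (auto simp: m_def res_def fun_eq_iff mult_right F.mem_carrier V.mem_carrier)
    have "m ` S = res F ` ((\<lambda>c. b \<otimes>\<^bsub>B\<^esub> c) ` V)"
      unfolding S_def image_image by (intro image_cong refl m)
    also have "\<dots> = S" using B.subgroup_set_mult_left[OF V b(1)] by (simp add: S_def)
    finally have mS: "m ` S = S" .
    have "inj_on m S" using mS finS by (simp add: eq_card_imp_inj_on)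
    then have "(\<Sum>s\<in>S. s a) = (\<Sum>s\<in>S. m s a)"
      using sum.reindex[of m S "\<lambda>s. s a"] mS by simp
    also have "\<dots> = p a b * (\<Sum>s\<in>S. s a)"
      using a by (simp add: m_def sum_distrib_left)
    finally have "(\<Sum>s\<in>S. s a) = 0" using b(2) by (metis mult_cancel_right1)
    then show ?thesis using False by simp
  qed
  have 2: "(\<Sum>a\<in>F. s a) = (if s = res F \<one>\<^bsub>B\<^esub> then of_nat (card F) else 0)" if s: "s \<in> S" for s
  proof -
    obtain b where b: "b \<in> V" "s = res F b" using s by (auto simp: S_def)
    show ?thesis
    proof (cases "s = res F \<one>\<^bsub>B\<^esub>")
      case True
      then show ?thesis by (simp add: res_def F.mem_carrier)
    next
      case False
      \<comment> \<open>The same argument with the roles exchanged: translation by \<open>c\<close>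
        permutes \<open>F\<close>.\<close>
      then obtain c where c: "c \<in> F" "p c b \<noteq> 1"
        using b by (auto simp: res_def fun_eq_iff F.mem_carrier split: if_splits)
      have "(\<Sum>a\<in>F. s a) = (\<Sum>a\<in>(\<lambda>a. c \<otimes>\<^bsub>A\<^esub> a) ` F. s a)"
        using A.subgroup_set_mult_left[OF F(1) c(1)] by simp
      also have "\<dots> = (\<Sum>a\<in>F. s (c \<otimes>\<^bsub>A\<^esub> a))"
        using c(1) by (subst sum.reindex) (auto simp: inj_on_def F.mem_carrier)
      also have "\<dots> = p c b * (\<Sum>a\<in>F. s a)"
        using b c by (auto simp: res_def sum_distrib_left mult_left F.mem_carrier V.mem_carrier intro!: sum.cong)
      finally have "(\<Sum>a\<in>F. s a) = 0" using c(2) by (metis mult_cancel_right1)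
      then show ?thesis using False by simp
    qed
  qed
  have "(of_nat (card S * card (F \<inter> coannih V)) :: complex) = (\<Sum>a\<in>F. \<Sum>s\<in>S. s a)"
    using F(2) by (simp add: 1 sum.If_cases Int_def)
  also have "\<dots> = (\<Sum>s\<in>S. \<Sum>a\<in>F. s a)" by (rule sum.swap)
  also have "\<dots> = (\<Sum>s\<in>S. if s = res F \<one>\<^bsub>B\<^esub> then of_nat (card F) else 0)" using 2 by simp
  also have "\<dots> = of_nat (card F)"
    using finS by (simp add: S_def)
  finally show ?thesis unfolding S_def of_nat_eq_iff .
qed

lemma card_rcosets_annih:
  assumes "F \<subseteq> carrier A"
  shows "card (rcosets\<^bsub>B\<^esub> annih F) = card (res F ` carrier B)"
proof -
  have "annih F #>\<^bsub>B\<^esub> b = annih F #>\<^bsub>B\<^esub> b' \<longleftrightarrow> res F b = res F b'"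
    if "b \<in> carrier B" "b' \<in> carrier B" for b b'
    using that assms by (simp add: B.rcoset_eq_iff subgroup_annih mem_annih_quotient_iff)
  then have "card ((\<lambda>b. annih F #>\<^bsub>B\<^esub> b) ` carrier B) = card (res F ` carrier B)"
    by (intro card_image_eq_if_same_fibres)
  then show ?thesis by (simp add: RCOSETS_def UNION_singleton_eq_range)
qed

text \<open>\<open>V\<close> and its double annihilator \<open>V'\<close> have the same annihilator
  in \<open>F\<close>, so \<open>card_res\<close> gives them equally many restrictions to
  \<open>F\<close>, and as \<open>V\<close> lies in \<open>V'\<close> the restrictions coincide. An
  element of \<open>V'\<close> therefore differs from one of \<open>V\<close> by an element of
  \<open>annih F\<close>, which \<open>V\<close> contains.\<close>

lemma annih_coannih:
  assumes F: "subgroup F A" "finite F" and V: "subgroup V B" "annih F \<subseteq> V"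
  shows "annih (F \<inter> coannih V) = V"
proof -
  define F' V' where "F' = F \<inter> coannih V" and "V' = annih F'"
  interpret V: subgroup V B by fact
  have V': "subgroup V' B"
    unfolding V'_def F'_def using subgroup.subset[OF F(1)] by (intro subgroup_annih) auto
  have VV': "V \<subseteq> V'"
    by (auto simp: V'_def F'_def annih_def coannih_def V.mem_carrier)
  have "F \<inter> coannih V' = F'"
    using VV' by (auto simp: V'_def F'_def annih_def coannih_def)
  then have "card (res F ` V') * card F' = card (res F ` V) * card F'"
    using card_res[OF F V'] card_res[OF F V(1)] by (simp add: F'_def)
  moreover have "\<one>\<^bsub>A\<^esub> \<in> F'"
    using subgroup.one_closed[OF F(1)] subgroup.one_closed[OF subgroup_coannih[OF V.subset]]
    by (simp add: F'_def)
  then have "card F' > 0" using F(2) by (auto simp: F'_def card_gt_0_iff)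
  ultimately have "card (res F ` V') = card (res F ` V)" by simp
  then have eq: "res F ` V = res F ` V'"
    using VV' finite_res[OF F subgroup.subset[OF V']] by (intro card_subset_eq) auto
  have "V' \<subseteq> V"
  proof
    fix b' assume b': "b' \<in> V'"
    then obtain b where b: "b \<in> V" "res F b' = res F b" using eq by (metis imageE imageI)
    then have "b' \<otimes>\<^bsub>B\<^esub> inv\<^bsub>B\<^esub> b \<in> V"
      using mem_annih_quotient_iff[OF subgroup.subset[OF F(1)], of b' b] b' V(2)
        subgroup.mem_carrier[OF V'] V.mem_carrier by blast
    then have "b' \<otimes>\<^bsub>B\<^esub> inv\<^bsub>B\<^esub> b \<otimes>\<^bsub>B\<^esub> b \<in> V" using b(1) by blast
    then show "b' \<in> V"
      using b(1) b' subgroup.mem_carrier[OF V'] by (simp add: B.m_assoc V.mem_carrier)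
  qed
  then show ?thesis using VV' by (simp add: V'_def F'_def)
qed

lemma annih_set_mult:
  assumes "subgroup F A" "subgroup F' A"
  shows "annih (F <#>\<^bsub>A\<^esub> F') = annih F \<inter> annih F'"
proof -
  interpret F: subgroup F A by fact
  interpret F': subgroup F' A by fact
  show ?thesis
  proof (intro subset_antisym subsetI)
    fix b assume b: "b \<in> annih (F <#>\<^bsub>A\<^esub> F')"
    have "a \<in> F <#>\<^bsub>A\<^esub> F'" if "a \<in> F" for a
    proof -
      have "a \<otimes>\<^bsub>A\<^esub> \<one>\<^bsub>A\<^esub> \<in> F <#>\<^bsub>A\<^esub> F'"
        unfolding set_mult_def using that F'.one_closed by blast
      then show ?thesis using that by (simp add: F.mem_carrier)
    qed
    moreover have "a \<in> F <#>\<^bsub>A\<^esub> F'" if "a \<in> F'" for a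
    proof -
      have "\<one>\<^bsub>A\<^esub> \<otimes>\<^bsub>A\<^esub> a \<in> F <#>\<^bsub>A\<^esub> F'"
        unfolding set_mult_def using that F.one_closed by blast
      then show ?thesis using that by (simp add: F'.mem_carrier)
    qed
    ultimately show "b \<in> annih F \<inter> annih F'" using b by (auto simp: annih_def)
  next
    fix b assume "b \<in> annih F \<inter> annih F'"
    then show "b \<in> annih (F <#>\<^bsub>A\<^esub> F')"
      by (auto simp: annih_def set_mult_def mult_left)
  qed
qed

end

section \<open>Topological entropy of covers\<close>

text \<open>Fekete's lemma; the limit is the infimum of the quotients. Choose \<open>m\<close> with
  a quotient close to the infimum and divide \<open>n\<close> by \<open>m\<close>: the remainder
  contributes a bounded amount, negligible after division by \<open>n\<close>.\<close>

lemma subadditive_imp_convergent: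
  fixes u :: "nat \<Rightarrow> real"
  assumes nonneg: "\<And>n. 0 \<le> u n" and sub: "\<And>m n. u (m + n) \<le> u m + u n"
  obtains l where "(\<lambda>n. u n / real n) \<longlonglongrightarrow> l"
proof -
  \<comment> \<open>The index 0 is excluded because \<open>u 0 / 0\<close> evaluates to 0 and would
    make the infimum 0.\<close>
  define l where "l = (INF n\<in>{1..}. u n / real n)"
  have bdd: "bdd_below ((\<lambda>n. u n / real n) ` {1..})"
    by (rule bdd_belowI2[of _ 0]) (simp add: nonneg)
  have lower: "l \<le> u n / real n" if "n \<ge> 1" for n
    unfolding l_def using that bdd by (intro cINF_lower) auto
  have mul: "u (q * m + r) \<le> real q * u m + u r" for q m r
  proof (induction q)
    case (Suc q)
    then show ?case using sub[of m "q * m + r"] by (simp add: algebra_simps)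
  qed simp
  have "(\<lambda>n. u n / real n) \<longlonglongrightarrow> l"
  proof (rule LIMSEQ_I)
    fix e :: real assume e: "e > 0"
    have "\<exists>m\<in>{1..}. u m / real m < l + e / 2"
      using cInf_lessD[of "(\<lambda>n. u n / real n) ` {1..}" "l + e / 2"] e by (auto simp: l_def)
    then obtain m where m: "m \<ge> 1" "u m / real m < l + e / 2" by auto
    define D where "D = Max (u ` {..<m})"
    have D: "u r \<le> D" if "r < m" for r using that by (simp add: D_def)
    have D0: "0 \<le> D" using D[of 0] nonneg[of 0] m(1) by linarith
    obtain N where N: "real N > 2 * D / e" "N \<ge> 1"
      using reals_Archimedean2[of "max 1 (2 * D / e)"] by (metis max_less_iff_conj of_nat_1 of_nat_less_iff less_imp_le)
    show "\<exists>N. \<forall>n\<ge>N. norm (u n / real n - l) < e"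
    proof (intro exI allI impI)
      fix n assume n: "n \<ge> N"
      then have n1: "n \<ge> 1" using N by simp
      have "u n \<le> real (n div m) * u m + u (n mod m)"
        using mul[of "n div m" m "n mod m"] by simp
      also have "\<dots> \<le> real n / real m * u m + D"
      proof (intro add_mono mult_right_mono)
        show "real (n div m) \<le> real n / real m" using of_nat_div_le_of_nat by blast
      qed (use nonneg D m(1) in auto)
      finally have "u n / real n \<le> u m / real m + D / real n"
        using n1 by (simp add: field_simps)
      moreover have "D / real n \<le> e / 2"
      proof -
        have "2 * D < e * real n"
          using N n e by (smt (verit, best) divide_less_eq mult.commute of_nat_mono)
        then show ?thesis using n1 by (simp add: field_simps)
      qed
      ultimately have "u n / real n < l + e" using m(2) by linarith
      then show "norm (u n / real n - l) < e" using lower[OF n1] e by simp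
    qed
  qed
  then show ?thesis using that by blast
qed

text \<open>Gives meaning to the \<open>lim\<close> in the entropies, which says nothing about a
  sequence until the sequence is known to converge.\<close>

lemma lim_ennreal_subadditive:
  fixes u :: "nat \<Rightarrow> real"
  assumes nonneg: "\<And>n. 0 \<le> u n" and sub: "\<And>m n. u (m + n) \<le> u m + u n"
  shows "(\<lambda>n. ennreal (u n / real n)) \<longlonglongrightarrow> lim (\<lambda>n. ennreal (u n / real n))"
proof -
  obtain l where "(\<lambda>n. u n / real n) \<longlonglongrightarrow> l"
    using subadditive_imp_convergent[of u] assms by blast
  then have "(\<lambda>n. ennreal (u n / real n)) \<longlonglongrightarrow> ennreal l" by (rule tendsto_ennrealI)
  then show ?thesis by (simp add: limI)
qed

text \<open>The partition into fibres of \<open>q\<close> refines the cover. It is given by a map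
  because the number of its classes is then the cardinality of an image, which is what
  \<open>card_res\<close> computes.\<close>

definition fibre_refines :: "'a topology \<Rightarrow> ('a \<Rightarrow> 'c) \<Rightarrow> 'a set set \<Rightarrow> bool" where
  "fibre_refines X q \<W> \<longleftrightarrow> (\<forall>x\<in>topspace X. \<exists>W\<in>\<W>. \<forall>y\<in>topspace X. q y = q x \<longrightarrow> y \<in> W)"

lemma min_subcover_le:
  assumes "finite \<V>" "\<V> \<subseteq> \<U>" "\<Union>\<V> = topspace X"
  shows "min_subcover X \<U> \<le> card \<V>"
  unfolding min_subcover_def using assms by (intro Least_le) blast

text \<open>A \<open>LEAST\<close> is attained only if some candidate exists; the given finite
  subcover, of whatever size, is this candidate.\<close>

lemma min_subcover_attained:
  assumes "finite \<V>" "\<V> \<subseteq> \<U>" "\<Union>\<V> = topspace X"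
  obtains \<V>' where "finite \<V>'" "\<V>' \<subseteq> \<U>" "\<Union>\<V>' = topspace X" "card \<V>' = min_subcover X \<U>"
proof -
  have "\<exists>k \<V>. finite \<V> \<and> \<V> \<subseteq> \<U> \<and> \<Union>\<V> = topspace X \<and> card \<V> = k" using assms by blast
  from LeastI_ex[OF this] show ?thesis using that unfolding min_subcover_def by blast
qed

lemma fibre_refines_subcover:
  assumes "fibre_refines X q \<W>" "finite (q ` topspace X)" "\<Union>\<W> \<subseteq> topspace X"
  obtains \<V> where "finite \<V>" "\<V> \<subseteq> \<W>" "\<Union>\<V> = topspace X" "card \<V> \<le> card (q ` topspace X)"
proof -
  obtain W where W: "\<And>x. x \<in> topspace X \<Longrightarrow> W x \<in> \<W>"
      "\<And>x y. \<lbrakk>x \<in> topspace X; y \<in> topspace X; q y = q x\<rbrakk> \<Longrightarrow> y \<in> W x"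
    using assms(1) unfolding fibre_refines_def by metis
  \<comment> \<open>One member for each value \<open>c\<close> of \<open>q\<close>, chosen at a
    point of the fibre over \<open>c\<close>.\<close>
  define W' where "W' c = W (inv_into (topspace X) q c)" for c
  show ?thesis
  proof
    show "finite (W' ` q ` topspace X)" using assms(2) by blast
    show "card (W' ` q ` topspace X) \<le> card (q ` topspace X)" using assms(2) by (rule card_image_le)
    show sub: "W' ` q ` topspace X \<subseteq> \<W>"
      using W(1) inv_into_into unfolding W'_def by (metis image_subsetI)
    have "x \<in> W' (q x)" if "x \<in> topspace X" for x
      using that W(2) unfolding W'_def by (metis f_inv_into_f image_eqI inv_into_into)
    then show "\<Union>(W' ` q ` topspace X) = topspace X" using sub assms(3) by blast
  qed
qed

lemma min_subcover_le_card_fibres: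
  assumes "fibre_refines X q \<W>" "finite (q ` topspace X)" "\<Union>\<W> \<subseteq> topspace X"
  shows "min_subcover X \<W> \<le> card (q ` topspace X)"
proof -
  obtain \<V> where "finite \<V>" "\<V> \<subseteq> \<W>" "\<Union>\<V> = topspace X" "card \<V> \<le> card (q ` topspace X)"
    using fibre_refines_subcover[OF assms] .
  then show ?thesis using min_subcover_le order_trans by metis
qed

text \<open>A member on which \<open>q\<close> is constant accounts for at most one value of
  \<open>q\<close>, so a subcover has at least as many members as \<open>q\<close> has
  values.\<close>

lemma min_subcover_eq_card_fibres:
  assumes "fibre_refines X q \<W>" "finite (q ` topspace X)" "\<Union>\<W> \<subseteq> topspace X"
    and const: "\<And>W x y. \<lbrakk>W \<in> \<W>; x \<in> W; y \<in> W\<rbrakk> \<Longrightarrow> q x = q y"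
  shows "min_subcover X \<W> = card (q ` topspace X)"
proof (rule antisym)
  show "min_subcover X \<W> \<le> card (q ` topspace X)" using assms(1-3) by (rule min_subcover_le_card_fibres)
  obtain \<V>0 where "finite \<V>0" "\<V>0 \<subseteq> \<W>" "\<Union>\<V>0 = topspace X"
    using fibre_refines_subcover[OF assms(1-3)] by metis
  then obtain \<V> where \<V>: "finite \<V>" "\<V> \<subseteq> \<W>" "\<Union>\<V> = topspace X" "card \<V> = min_subcover X \<W>"
    by (rule min_subcover_attained)
  \<comment> \<open>On an empty member the choice is arbitrary; this only enlarges the image, whose
    cardinality is bounded by \<open>card \<V>\<close> anyway.\<close>
  have "q x \<in> (\<lambda>W. q (SOME y. y \<in> W)) ` \<V>" if "x \<in> topspace X" for x
  proof -
    obtain W where W: "W \<in> \<V>" "x \<in> W" using \<V>(3) \<open>x \<in> topspace X\<close> by blast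
    then have "q (SOME y. y \<in> W) = q x" using const \<V>(2) by (metis someI subsetD)
    then show ?thesis using W(1) by (metis image_eqI)
  qed
  then have "card (q ` topspace X) \<le> card ((\<lambda>W. q (SOME y. y \<in> W)) ` \<V>)"
    using \<V>(1) by (intro card_mono) auto
  also have "\<dots> \<le> card \<V>" using \<V>(1) by (rule card_image_le)
  finally show "card (q ` topspace X) \<le> min_subcover X \<W>" using \<V>(4) by simp
qed

section \<open>Iterated covers of a continuous selfmap\<close>

abbreviation iterated_cover :: "'a topology \<Rightarrow> ('a \<Rightarrow> 'a) \<Rightarrow> 'a set set \<Rightarrow> nat \<Rightarrow> 'a set set" where
  "iterated_cover X f \<U> n \<equiv> cover_join X n (\<lambda>i. preimage_cover X (f ^^ i) \<U>)"

text \<open>Itinerary form of the join: a member is the set of points whose first \<open>n\<close>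
  iterates visit prescribed sets in order. For \<open>n = 0\<close> the only member is the whole
  space.\<close>

lemma iterated_cover_eq:
  "iterated_cover X f \<U> n =
     {{x \<in> topspace X. \<forall>i<n. (f ^^ i) x \<in> U i} | U. \<forall>i<n. U i \<in> \<U>}" (is "?l = ?r")
proof
  show "?l \<subseteq> ?r"
  proof
    fix W assume "W \<in> ?l"
    then obtain W' where W: "W = topspace X \<inter> (\<Inter>i<n. W' i)"
        and W': "\<forall>i<n. W' i \<in> preimage_cover X (f ^^ i) \<U>"
      unfolding cover_join_def by blast
    then obtain U where U: "\<forall>i<n. U i \<in> \<U> \<and> W' i = (f ^^ i) -` U i \<inter> topspace X"
      unfolding preimage_cover_def image_iff by metis
    then have "W = {x \<in> topspace X. \<forall>i<n. (f ^^ i) x \<in> U i}" using W by auto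
    then show "W \<in> ?r" using U by blast
  qed
  show "?r \<subseteq> ?l"
  proof
    fix W assume "W \<in> ?r"
    then obtain U where U: "\<forall>i<n. U i \<in> \<U>" "W = {x \<in> topspace X. \<forall>i<n. (f ^^ i) x \<in> U i}"
      by blast
    have "W = topspace X \<inter> (\<Inter>i<n. (f ^^ i) -` U i \<inter> topspace X)" using U by auto
    moreover have "\<forall>i<n. (f ^^ i) -` U i \<inter> topspace X \<in> preimage_cover X (f ^^ i) \<U>"
      using U by (auto simp: preimage_cover_def)
    ultimately show "W \<in> ?l" unfolding cover_join_def by blast
  qed
qed

lemma continuous_map_funpow:
  assumes "continuous_map X X f"
  shows "continuous_map X X (f ^^ n)"
proof (induction n)
  case (Suc n)
  then show ?case using continuous_map_compose[OF Suc assms] by (simp add: comp_def)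
qed (simp add: id_def)

lemma iterated_cover_open_cover:
  assumes "continuous_map X X f" "\<U> \<in> open_covers X"
  shows "iterated_cover X f \<U> n \<in> open_covers X"
proof -
  have "openin X W" if W: "W \<in> iterated_cover X f \<U> n" for W
  proof -
    obtain U where U: "\<forall>i<n. U i \<in> \<U>" "W = {x \<in> topspace X. \<forall>i<n. (f ^^ i) x \<in> U i}"
      using W unfolding iterated_cover_eq by blast
    have "W = topspace X \<inter> (\<Inter>i\<in>{..<n}. {x \<in> topspace X. (f ^^ i) x \<in> U i})" using U by auto
    moreover have "openin X {x \<in> topspace X. (f ^^ i) x \<in> U i}" if "i < n" for i
      using continuous_map_funpow[OF assms(1), of i] U(1) assms(2) that
      by (auto simp: open_covers_def intro: openin_continuous_map_preimage)
    ultimately show ?thesis by (cases "n = 0") (auto intro!: openin_Int openin_INT)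
  qed
  moreover have "x \<in> \<Union>(iterated_cover X f \<U> n)" if x: "x \<in> topspace X" for x
  proof -
    have "(f ^^ i) x \<in> topspace X" for i
      using continuous_map_funpow[OF assms(1)] x by (auto simp: continuous_map_def)
    then have "\<forall>i. \<exists>U\<in>\<U>. (f ^^ i) x \<in> U" using assms(2) by (auto simp: open_covers_def)
    then obtain U where "\<And>i. U i \<in> \<U> \<and> (f ^^ i) x \<in> U i" by metis
    then have "x \<in> {x \<in> topspace X. \<forall>i<n. (f ^^ i) x \<in> U i}" "\<forall>i<n. U i \<in> \<U>" using x by auto
    then show ?thesis unfolding iterated_cover_eq by blast
  qed
  ultimately show ?thesis using openin_subset by (fastforce simp: open_covers_def)
qed

lemma compact_space_finite_subcover:
  assumes "compact_space X" "\<W> \<in> open_covers X"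
  obtains \<V> where "finite \<V>" "\<V> \<subseteq> \<W>" "\<Union>\<V> = topspace X"
proof -
  have \<W>: "\<And>W. W \<in> \<W> \<Longrightarrow> openin X W" "\<Union>\<W> = topspace X"
    using assms(2) by (auto simp: open_covers_def)
  then obtain \<V> where \<V>: "finite \<V>" "\<V> \<subseteq> \<W>" "topspace X \<subseteq> \<Union>\<V>"
    using assms(1) unfolding compact_space_alt by (metis order_refl)
  then have "\<Union>\<V> = topspace X" using \<W>(2) by blast
  then show ?thesis using that \<V> by blast
qed

text \<open>Itineraries concatenate: intersecting a member of a minimal subcover for
  \<open>m\<close> with the preimage under \<open>f ^^ m\<close> of a member of one for
  \<open>n\<close> gives a member of the join of length \<open>m + n\<close>, and these
  intersections cover. Logarithms turn this into the subadditivity of Fekete's lemma.\<close>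

lemma min_subcover_iterated_submult:
  assumes X: "compact_space X" and f: "continuous_map X X f" and \<U>: "\<U> \<in> open_covers X"
  shows "min_subcover X (iterated_cover X f \<U> (m + n)) \<le>
    min_subcover X (iterated_cover X f \<U> m) * min_subcover X (iterated_cover X f \<U> n)"
proof -
  have ex: "\<exists>\<V>. finite \<V> \<and> \<V> \<subseteq> iterated_cover X f \<U> k \<and> \<Union>\<V> = topspace X
      \<and> card \<V> = min_subcover X (iterated_cover X f \<U> k)" for k
      proof -
    obtain \<V>0 where "finite \<V>0" "\<V>0 \<subseteq> iterated_cover X f \<U> k" "\<Union>\<V>0 = topspace X"
      using compact_space_finite_subcover[OF X iterated_cover_open_cover[OF f \<U>]] .
    then show ?thesis by (rule min_subcover_attained) blast
  qed
  obtain \<V> where \<V>: "finite \<V>" "\<V> \<subseteq> iterated_cover X f \<U> m" "\<Union>\<V> = topspace X"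
      "card \<V> = min_subcover X (iterated_cover X f \<U> m)" using ex[of m] by blast
  obtain \<W> where \<W>: "finite \<W>" "\<W> \<subseteq> iterated_cover X f \<U> n" "\<Union>\<W> = topspace X"
      "card \<W> = min_subcover X (iterated_cover X f \<U> n)" using ex[of n] by blast
  define J where "J = (\<lambda>(V, W). {x \<in> V. (f ^^ m) x \<in> W})"
  have fm: "(f ^^ k) x \<in> topspace X" if "x \<in> topspace X" for x k
    using continuous_map_funpow[OF f] that by (auto simp: continuous_map_def)
  have "J (V, W) \<in> iterated_cover X f \<U> (m + n)" if V: "V \<in> \<V>" and W: "W \<in> \<W>" for V W
  proof -
    obtain U where U: "\<forall>i<m. U i \<in> \<U>" "V = {x \<in> topspace X. \<forall>i<m. (f ^^ i) x \<in> U i}"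
      using V \<V>(2) unfolding iterated_cover_eq by blast
    obtain U' where U': "\<forall>i<n. U' i \<in> \<U>" "W = {x \<in> topspace X. \<forall>i<n. (f ^^ i) x \<in> U' i}"
      using W \<W>(2) unfolding iterated_cover_eq by blast
    define T where "T i = (if i < m then U i else U' (i - m))" for i
    have "(\<forall>i<m. (f ^^ i) x \<in> U i) \<and> (\<forall>i<n. (f ^^ i) ((f ^^ m) x) \<in> U' i)
        \<longleftrightarrow> (\<forall>i<m + n. (f ^^ i) x \<in> T i)" for x
    proof safe
      fix i assume *: "\<forall>i<m. (f ^^ i) x \<in> U i" "\<forall>i<n. (f ^^ i) ((f ^^ m) x) \<in> U' i" "i < m + n"
      show "(f ^^ i) x \<in> T i"
      proof (cases "i < m")
        case False
        then have "(f ^^ (i - m)) ((f ^^ m) x) \<in> U' (i - m)" using * by auto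
        then show ?thesis using False by (simp add: T_def flip: funpow_add[unfolded comp_def, THEN fun_cong])
      qed (use * in \<open>auto simp: T_def\<close>)
    next
      fix i assume *: "\<forall>i<m + n. (f ^^ i) x \<in> T i" "i < m"
      then show "(f ^^ i) x \<in> U i" by (metis T_def trans_less_add1)
    next
      fix i assume *: "\<forall>i<m + n. (f ^^ i) x \<in> T i" "i < n"
      then have "(f ^^ (i + m)) x \<in> T (i + m)" by simp
      then show "(f ^^ i) ((f ^^ m) x) \<in> U' i" by (simp add: T_def funpow_add)
    qed
    then have "J (V, W) = {x \<in> topspace X. \<forall>i<m + n. (f ^^ i) x \<in> T i}"
      using fm by (auto simp: J_def U U')
    moreover have "\<forall>i<m + n. T i \<in> \<U>" using U(1) U'(1) by (auto simp: T_def)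
    ultimately show ?thesis unfolding iterated_cover_eq by blast
  qed
  then have "J ` (\<V> \<times> \<W>) \<subseteq> iterated_cover X f \<U> (m + n)" by auto
  moreover have "\<Union>(J ` (\<V> \<times> \<W>)) = topspace X"
  proof
    show "\<Union>(J ` (\<V> \<times> \<W>)) \<subseteq> topspace X" using \<V>(3) by (auto simp: J_def)
    show "topspace X \<subseteq> \<Union>(J ` (\<V> \<times> \<W>))"
    proof
      fix x assume x: "x \<in> topspace X"
      then obtain V W where "V \<in> \<V>" "x \<in> V" "W \<in> \<W>" "(f ^^ m) x \<in> W"
        using \<V>(3) \<W>(3) fm[OF x, of m] by blast
      then show "x \<in> \<Union>(J ` (\<V> \<times> \<W>))" by (auto simp: J_def)
    qed
  qed
  ultimately have "min_subcover X (iterated_cover X f \<U> (m + n)) \<le> card (J ` (\<V> \<times> \<W>))"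
    using \<V>(1) \<W>(1) by (intro min_subcover_le) auto
  also have "\<dots> \<le> card (\<V> \<times> \<W>)" using \<V>(1) \<W>(1) by (intro card_image_le) auto
  finally show ?thesis by (simp add: card_cartesian_product \<V>(4) \<W>(4))
qed

text \<open>The empty family covers only the empty space. Positivity keeps the logarithms
  nonnegative and monotone.\<close>

lemma min_subcover_pos:
  assumes "compact_space X" "\<W> \<in> open_covers X" "topspace X \<noteq> {}"
  shows "min_subcover X \<W> \<ge> 1"
proof -
  obtain \<V>0 where "finite \<V>0" "\<V>0 \<subseteq> \<W>" "\<Union>\<V>0 = topspace X"
    using compact_space_finite_subcover[OF assms(1,2)] .
  then obtain \<V> where \<V>: "finite \<V>" "\<V> \<subseteq> \<W>" "\<Union>\<V> = topspace X" "card \<V> = min_subcover X \<W>"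
    by (rule min_subcover_attained)
  then have "\<V> \<noteq> {}" using assms(3) by blast
  then show ?thesis using \<V> by (metis One_nat_def Suc_leI card_gt_0_iff)
qed

lemma cover_entropy_tendsto:
  assumes X: "compact_space X" "topspace X \<noteq> {}" and f: "continuous_map X X f"
    and \<U>: "\<U> \<in> open_covers X"
  shows "(\<lambda>n. ennreal (ln (real (min_subcover X (iterated_cover X f \<U> n))) / real n)) \<longlonglongrightarrow>
    lim (\<lambda>n. ennreal (ln (real (min_subcover X (iterated_cover X f \<U> n))) / real n))"
proof (rule lim_ennreal_subadditive)
  have pos: "min_subcover X (iterated_cover X f \<U> n) \<ge> 1" for n
    using min_subcover_pos X iterated_cover_open_cover[OF f \<U>] by blast
  show "0 \<le> ln (real (min_subcover X (iterated_cover X f \<U> n)))" for n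
    using pos[of n] by simp
  fix m n
  let ?N = "\<lambda>n. min_subcover X (iterated_cover X f \<U> n)"
  have "ln (real (?N (m + n))) \<le> ln (real (?N m * ?N n))"
    using pos[of "m + n"] pos[of m] pos[of n] min_subcover_iterated_submult[OF X(1) f \<U>, of m n]
    by (subst ln_le_cancel_iff) (auto simp del: of_nat_mult)
  also have "\<dots> = ln (real (?N m)) + ln (real (?N n))"
    using pos[of m] pos[of n] by (simp add: ln_mult)
  finally show "ln (real (?N (m + n))) \<le> ln (real (?N m)) + ln (real (?N n))" .
qed

section \<open>Extension of characters\<close>

text \<open>A partial character trivial on \<open>V\<close> is encoded as its graph, a submonoid of \<open>G \<times> \<complex>\<close> containing
  \<open>V \<times> {1}\<close>. Since \<open>G\<close> is torsion modulo \<open>V\<close>, the graph is closed under inverses and takes values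
  in the circle, and the last clause makes it single-valued.\<close>

definition character_graph :: "('a, 'b) monoid_scheme \<Rightarrow> 'a set \<Rightarrow> ('a \<times> complex) set \<Rightarrow> bool" where
  "character_graph G V R \<longleftrightarrow> R \<subseteq> carrier G \<times> UNIV \<and> V \<times> {1} \<subseteq> R \<and>
     (\<forall>u w u' w'. (u, w) \<in> R \<longrightarrow> (u', w') \<in> R \<longrightarrow> (u \<otimes>\<^bsub>G\<^esub> u', w * w') \<in> R) \<and>
     (\<forall>z. (\<one>\<^bsub>G\<^esub>, z) \<in> R \<longrightarrow> z = 1)"

text \<open>Covers both uses of the extension property: \<open>V\<close> trivial in a torsion group,
  and \<open>V\<close> an open subgroup of a compact group, which has finite index.\<close>

locale torsion_modulo = comm_group G + V: subgroup V G for G (structure) and V +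
  assumes torsion: "x \<in> carrier G \<Longrightarrow> \<exists>n>0::nat. x [^] n \<in> V"
begin

context
  fixes R assumes R: "character_graph G V R"
begin

lemma graph_carrier: "(u, w) \<in> R \<Longrightarrow> u \<in> carrier G"
  and graph_mult: "(u, w) \<in> R \<Longrightarrow> (u', w') \<in> R \<Longrightarrow> (u \<otimes> u', w * w') \<in> R"
  and graph_one: "(\<one>, z) \<in> R \<Longrightarrow> z = 1"
  and graph_V: "v \<in> V \<Longrightarrow> (v, 1) \<in> R"
  using R by (auto simp: character_graph_def)

lemma graph_pow: "(u, w) \<in> R \<Longrightarrow> (u [^] (n::nat), w ^ n) \<in> R"
proof (induction n)
  case 0
  then show ?case using graph_V[OF V.one_closed] by simp
next
  case (Suc n)
  then show ?case using graph_mult[of "u [^] n" "w ^ n" u w] by (simp add: mult.commute)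
qed

text \<open>If \<open>u [^] Suc k\<close> is in \<open>V\<close>, then the inverse of
  \<open>u\<close> is \<open>u [^] k\<close> times an element of \<open>V\<close>. Hence it already
  lies in the domain, with value \<open>w ^ k\<close>.\<close>

lemma graph_inv:
  assumes "(u, w) \<in> R"
  obtains w' where "(inv u, w') \<in> R" "w * w' = 1"
proof -
  have u: "u \<in> carrier G" using assms by (rule graph_carrier)
  obtain n :: nat where n: "n > 0" "u [^] n \<in> V" using torsion[OF u] by blast
  then obtain k where k: "n = Suc k" by (cases n) auto
  have "u [^] k \<otimes> inv (u [^] n) \<otimes> u = \<one>"
  proof -
    have "u [^] k \<otimes> inv (u [^] n) \<otimes> u = (u [^] k \<otimes> u) \<otimes> inv (u [^] n)"
      using u by (simp add: m_ac)
    also have "u [^] k \<otimes> u = u [^] n" by (simp add: k)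
    finally show ?thesis using u by simp
  qed
  then have inv: "u [^] k \<otimes> inv (u [^] n) = inv u"
    using u by (intro inv_equality[symmetric]) auto
  have "(u [^] k \<otimes> inv (u [^] n), w ^ k * 1) \<in> R"
    using n by (intro graph_mult graph_pow graph_V assms V.m_inv_closed)
  then have 1: "(inv u, w ^ k) \<in> R" by (simp add: inv)
  then have "(u \<otimes> inv u, w * w ^ k) \<in> R" using assms graph_mult by blast
  then have "w * w ^ k = 1" using u graph_one by simp
  with 1 show thesis by (rule that)
qed

lemma graph_unique:
  assumes "(u, w) \<in> R" "(u, w') \<in> R"
  shows "w = w'"
proof -
  obtain v where v: "(inv u, v) \<in> R" "w * v = 1" using assms(1) by (rule graph_inv)
  have "(u \<otimes> inv u, w' * v) \<in> R" using assms(2) v(1) by (rule graph_mult)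
  then have "w' * v = 1" using graph_carrier[OF assms(1)] graph_one by simp
  then have "w = w' * (w * v)" by (simp add: mult.left_commute)
  then show ?thesis using v(2) by simp
qed

text \<open>\<open>w\<close> is a root of unity, since some power of \<open>u\<close> lies in
  \<open>V\<close>, where the only value is 1.\<close>

lemma graph_norm:
  assumes "(u, w) \<in> R"
  shows "cmod w = 1"
proof -
  obtain n :: nat where n: "n > 0" "u [^] n \<in> V" using torsion graph_carrier[OF assms] by blast
  then have "w ^ n = 1" using graph_unique graph_pow[OF assms] graph_V by blast
  then have "cmod w ^ n = 1" by (metis norm_one norm_power)
  then show ?thesis using n(1) power_eq_1_iff[of "cmod w" n] by simp
qed

text \<open>Let \<open>k\<close> be the least positive exponent with \<open>y [^] k\<close> in the
  domain and \<open>a\<close> the value there; any \<open>c\<close> with \<open>c ^ k = a\<close>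
  may serve as value at \<open>y\<close>. As \<open>y\<close> is outside the domain,
  \<open>k\<close> is at least 2, so \<open>c\<close> can be chosen different from 1 even for
  \<open>a = 1\<close>. This choice is what separates points.\<close>

lemma graph_extend:
  assumes y: "y \<in> carrier G" "y \<notin> Domain R"
  obtains R' c where "character_graph G V R'" "R \<subseteq> R'" "(y, c) \<in> R'" "c \<noteq> 1"
proof -
  define k where "k = (LEAST n::nat. n > 0 \<and> y [^] n \<in> Domain R)"
  have ex: "\<exists>n::nat. n > 0 \<and> y [^] n \<in> Domain R"
    using torsion[OF y(1)] graph_V by blast
  have k: "k > 0" "y [^] k \<in> Domain R"
    using LeastI_ex[OF ex] by (auto simp: k_def)
  have k_least: "n = 0" if "n < k" "y [^] n \<in> Domain R" for n :: nat
    using not_less_Least[of n "\<lambda>n. n > 0 \<and> y [^] n \<in> Domain R"] that by (auto simp: k_def)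
  have "k \<noteq> 1" using k y by auto
  obtain a where a: "(y [^] k, a) \<in> R" using k(2) by blast
  obtain c where c: "c ^ k = a" "c \<noteq> 1"
  proof (cases "a = 1")
    case True
    have "\<not> {z::complex. z ^ k = 1} \<subseteq> {1}"
    proof
      assume "{z::complex. z ^ k = 1} \<subseteq> {1}"
      then have "card {z::complex. z ^ k = 1} \<le> card {1::complex}" by (intro card_mono) auto
      then show False using card_roots_unity_eq[OF k(1)] \<open>k \<noteq> 1\<close> k(1) by simp
    qed
    then show thesis using that True by blast
  next
    case False
    obtain c where "a = c ^ k" using exists_complex_root[of k a] k(1) by auto
    moreover from this have "c \<noteq> 1" using False by (metis power_one)
    ultimately show thesis using that by blast
  qed
  define R' where "R' = {(u \<otimes> y [^] (j::nat), w * c ^ j) | u w j. (u, w) \<in> R}"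
  have R'I: "(u \<otimes> y [^] j, w * c ^ j) \<in> R'" if "(u, w) \<in> R" for u w and j :: nat
    using that by (auto simp: R'_def)
  have sub: "R \<subseteq> R'"
  proof
    fix r assume "r \<in> R"
    then obtain u w where "r = (u, w)" "(u, w) \<in> R" by (cases r) auto
    then show "r \<in> R'" using R'I[of u w 0] graph_carrier by simp
  qed
  have "character_graph G V R'"
    unfolding character_graph_def
  proof (intro conjI allI impI)
    show "R' \<subseteq> carrier G \<times> UNIV" using y graph_carrier by (auto simp: R'_def)
    show "V \<times> {1} \<subseteq> R'" using sub graph_V by blast
    fix u w u' w' assume "(u, w) \<in> R'" "(u', w') \<in> R'"
    then obtain v z v' z' and i j :: nat where
      *: "(v, z) \<in> R" "(v', z') \<in> R" "u = v \<otimes> y [^] i" "w = z * c ^ i" "u' = v' \<otimes> y [^] j" "w' = z' * c ^ j"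
      by (auto simp: R'_def)
    have "((v \<otimes> v') \<otimes> y [^] (i + j), (z * z') * c ^ (i + j)) \<in> R'"
      using * by (intro R'I graph_mult)
    moreover have "(v \<otimes> v') \<otimes> y [^] (i + j) = u \<otimes> u'"
      using * graph_carrier y by (simp add: nat_pow_mult[symmetric] m_ac)
    moreover have "(z * z') * c ^ (i + j) = w * w'" using * by (simp add: power_add mult_ac)
    ultimately show "(u \<otimes> u', w * w') \<in> R'" by simp
  next
    fix z assume "(\<one>, z) \<in> R'"
    then obtain u w and j :: nat where *: "(u, w) \<in> R" "\<one> = u \<otimes> y [^] j" "z = w * c ^ j"
      by (auto simp: R'_def)
    \<comment> \<open>The relation makes \<open>y [^] r\<close> the inverse of an element of the
      domain, so \<open>r = 0\<close> by minimality of \<open>k\<close>. What remains is a relation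
      inside \<open>R\<close>, where \<open>c ^ j\<close> becomes \<open>a ^ q\<close>.\<close>
    define q r where "q = j div k" and "r = j mod k"
    have j: "j = k * q + r" by (simp add: q_def r_def)
    have uc: "u \<in> carrier G" using * graph_carrier by blast
    define v where "v = u \<otimes> (y [^] k) [^] q"
    have v: "(v, w * a ^ q) \<in> R" unfolding v_def using * a by (intro graph_mult graph_pow)
    have vy: "y [^] r \<otimes> v = \<one>"
    proof -
      have "y [^] j = (y [^] k) [^] q \<otimes> y [^] r" using y by (simp add: j nat_pow_mult nat_pow_pow)
      then show ?thesis using *(2) uc y by (simp add: v_def m_ac)
    qed
    then have "inv v = y [^] r" using graph_carrier[OF v] y by (intro inv_equality) auto
    then have "y [^] r \<in> Domain R" using v by (metis graph_inv Domain.intros)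
    then have r0: "r = 0" using k_least k(1) by (auto simp: r_def)
    then have "v = \<one>" using vy graph_carrier[OF v] by simp
    then have "w * a ^ q = 1" using v graph_one by blast
    then show "z = 1" using * j r0 c by (simp add: power_mult)
  qed
  moreover have "(y, c) \<in> R'" using R'I[of \<one> 1 1] graph_V[OF V.one_closed] y by simp
  ultimately show thesis using that sub c(2) by blast
qed

end

lemma ex_separating_character:
  assumes x: "x \<in> carrier G" "x \<notin> V"
  obtains \<xi> where "\<xi> \<in> hom G circle_group" "\<xi> \<in> extensional (carrier G)"
    "\<And>v. v \<in> V \<Longrightarrow> \<xi> v = 1" "\<xi> x \<noteq> 1"
proof -
  have R0: "character_graph G V (V \<times> {1})"
    by (auto simp: character_graph_def V.mem_carrier)
  have "x \<notin> Domain (V \<times> {1::complex})" using x(2) by blast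
  \<comment> \<open>\<open>x\<close> is adjoined before Zorn's lemma is applied, so that every graph
    considered afterwards keeps the value \<open>c\<close> at \<open>x\<close>.\<close>
  then obtain R1 c where R1: "character_graph G V R1" "(x, c) \<in> R1" "c \<noteq> 1"
    using graph_extend[OF R0 x(1)] by metis
  define \<A> where "\<A> = {R. character_graph G V R \<and> R1 \<subseteq> R}"
  have "\<exists>M\<in>\<A>. \<forall>X\<in>\<A>. M \<subseteq> X \<longrightarrow> X = M"
  proof (rule subset_Zorn_nonempty)
    show "\<A> \<noteq> {}" using R1 by (auto simp: \<A>_def)
    fix \<C> assume \<C>: "\<C> \<noteq> {}" "subset.chain \<A> \<C>"
    then have sub: "\<And>X. X \<in> \<C> \<Longrightarrow> character_graph G V X \<and> R1 \<subseteq> X"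
      and chain: "\<And>X Y. X \<in> \<C> \<Longrightarrow> Y \<in> \<C> \<Longrightarrow> X \<subseteq> Y \<or> Y \<subseteq> X"
      by (auto simp: subset_chain_def \<A>_def)
    have "character_graph G V (\<Union>\<C>)"
      unfolding character_graph_def
    proof (intro conjI allI impI)
      show "\<Union>\<C> \<subseteq> carrier G \<times> UNIV" "V \<times> {1} \<subseteq> \<Union>\<C>"
        using sub \<C>(1) unfolding character_graph_def by blast+
      show "z = 1" if "(\<one>, z) \<in> \<Union>\<C>" for z
        using sub that unfolding character_graph_def by blast
      fix u w u' w' assume "(u, w) \<in> \<Union>\<C>" "(u', w') \<in> \<Union>\<C>"
      then obtain X where "X \<in> \<C>" "(u, w) \<in> X" "(u', w') \<in> X" using chain by blast
      then have "(u \<otimes> u', w * w') \<in> X" using sub unfolding character_graph_def by blast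
      then show "(u \<otimes> u', w * w') \<in> \<Union>\<C>" using \<open>X \<in> \<C>\<close> by blast
    qed
    then show "\<Union>\<C> \<in> \<A>" using sub \<C>(1) by (auto simp: \<A>_def)
  qed
  then obtain R where R\<A>: "R \<in> \<A>" and max\<A>: "\<And>X. X \<in> \<A> \<Longrightarrow> R \<subseteq> X \<Longrightarrow> X = R" by blast
  have R: "character_graph G V R" "R1 \<subseteq> R" using R\<A> by (auto simp: \<A>_def)
  have max: "X = R" if "character_graph G V X" "R \<subseteq> X" for X
    using max\<A>[of X] that R(2) by (auto simp: \<A>_def)
  have dom: "\<exists>w. (y, w) \<in> R" if y: "y \<in> carrier G" for y
  proof (rule ccontr)
    assume "\<nexists>w. (y, w) \<in> R"
    then have "y \<notin> Domain R" by blast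
    with y obtain R' c where "character_graph G V R'" "R \<subseteq> R'" "(y, c) \<in> R'"
      using graph_extend[OF R(1)] by metis
    then show False using max \<open>y \<notin> Domain R\<close> by blast
  qed
  define \<xi> where "\<xi> = (\<lambda>y\<in>carrier G. THE w. (y, w) \<in> R)"
  have \<xi>: "\<xi> y = w" if "(y, w) \<in> R" for y w
    using that graph_unique[OF R(1)] graph_carrier[OF R(1)] by (auto simp: \<xi>_def intro!: the_equality)
  have in_R: "(y, \<xi> y) \<in> R" if "y \<in> carrier G" for y
    using dom[OF that] \<xi> by metis
  show thesis
  proof (rule that)
    show "\<xi> \<in> hom G circle_group"
    proof (rule homI)
      show "\<xi> y \<in> carrier circle_group" if "y \<in> carrier G" for y
        using graph_norm[OF R(1) in_R[OF that]] by (simp add: circle_group_def)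
      show "\<xi> (y \<otimes> z) = \<xi> y \<otimes>\<^bsub>circle_group\<^esub> \<xi> z" if "y \<in> carrier G" "z \<in> carrier G" for y z
        using \<xi>[OF graph_mult[OF R(1) in_R[OF that(1)] in_R[OF that(2)]]] by (simp add: circle_group_def)
    qed
    show "\<xi> \<in> extensional (carrier G)" by (simp add: \<xi>_def)
    show "\<xi> v = 1" if "v \<in> V" for v using graph_V[OF R(1) that] by (rule \<xi>)
    show "\<xi> x \<noteq> 1" using \<xi>[of x c] R1 R(2) by auto
  qed
qed

end

section \<open>Totally disconnected compact abelian groups\<close>

text \<open>On the circle, squaring turns \<open>1 - Re z\<close> into
  \<open>2 * (1 - Re z) * (1 + Re z)\<close>, which at least doubles it while the real part is
  positive. As it stays below 1 for all powers, it must be 0.\<close>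

lemma circle_eq_1_if_Re_powers_pos:
  fixes z :: complex
  assumes "cmod z = 1" and pos: "\<And>n. Re (z ^ n) > 0"
  shows "z = 1"
proof -
  define c where "c n = Re (z ^ (2 ^ n))" for n :: nat
  have c01: "0 < c n" "c n \<le> 1" for n
    using pos[of "2 ^ n"] complex_Re_le_cmod[of "z ^ (2 ^ n)"] assms(1)
    unfolding c_def norm_power by simp_all
  have step: "1 - c (Suc n) \<ge> 2 * (1 - c n)" for n
  proof -
    have "(cmod (z ^ (2 ^ n)))\<^sup>2 = 1" using assms(1) by (simp add: norm_power)
    then have "(Im (z ^ (2 ^ n)))\<^sup>2 = 1 - (c n)\<^sup>2" by (simp add: cmod_power2 c_def)
    moreover have "z ^ (2 ^ Suc n) = z ^ (2 ^ n) * z ^ (2 ^ n)"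
      by (simp add: power_add[symmetric] mult_2)
    then have "c (Suc n) = (c n)\<^sup>2 - (Im (z ^ (2 ^ n)))\<^sup>2"
      by (simp add: c_def power2_eq_square)
    ultimately have "1 - c (Suc n) = 2 * (1 - c n) * (1 + c n)" by (simp add: power2_eq_square algebra_simps)
    also have "\<dots> \<ge> 2 * (1 - c n) * 1" using c01[of n] by (intro mult_left_mono) auto
    finally show ?thesis by simp
  qed
  have "1 - c n \<ge> 2 ^ n * (1 - c 0)" for n
  proof (induction n)
    case (Suc n)
    then show ?case using step[of n] by simp
  qed simp
  then have bound: "2 ^ n * (1 - c 0) < 1" for n using c01[of n] by (smt (verit))
  have "c 0 = 1"
  proof (rule ccontr)
    assume "c 0 \<noteq> 1"
    then have "1 - c 0 > 0" using c01[of 0] by simp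
    then obtain n where "1 / (1 - c 0) < 2 ^ n" using real_arch_pow[of 2 "1 / (1 - c 0)"] by auto
    then show False using bound[of n] \<open>1 - c 0 > 0\<close> by (simp add: field_simps)
  qed
  then have "Re z = 1" by (simp add: c_def)
  moreover have "(Re z)\<^sup>2 + (Im z)\<^sup>2 = 1" using assms(1) cmod_power2[of z] by simp
  ultimately show ?thesis by (simp add: complex_eq_iff)
qed

locale td_compact_group =
  fixes K :: "'a top_group" (structure)
  assumes TdCAG: "K \<in> obj TdCAG"
begin

sublocale comm_group K
  using TdCAG by (simp add: TdCAG_def)

lemma topspace_eq [simp]: "topspace (topo K) = carrier K"
  and compact: "compact_space (topo K)"
  and Hausdorff: "Hausdorff_space (topo K)"
  and totally_disconnected: "totally_disconnected_space (topo K)"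
  and continuous_mult: "continuous_map (prod_topology (topo K) (topo K)) (topo K) (\<lambda>(x, y). x \<otimes> y)"
  and continuous_inv: "continuous_map (topo K) (topo K) (\<lambda>x. inv x)"
  using TdCAG by (auto simp: TdCAG_def is_top_group_def)

lemma continuous_translation:
  assumes "a \<in> carrier K"
  shows "continuous_map (topo K) (topo K) (\<lambda>x. x \<otimes> a)"
proof -
  have "continuous_map (topo K) (prod_topology (topo K) (topo K)) (\<lambda>x. (x, a))"
    using assms by (intro continuous_map_pairedI) auto
  from continuous_map_compose[OF this continuous_mult] show ?thesis by (simp add: comp_def)
qed

lemma openin_translate:
  assumes "a \<in> carrier K" "openin (topo K) U"
  shows "openin (topo K) {x \<in> carrier K. x \<otimes> a \<in> U}"
  using openin_continuous_map_preimage[OF continuous_translation[OF assms(1)] assms(2)] by simp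

text \<open>\<open>S\<close> is a union of translates of \<open>V\<close>. This is the common source
  of openness for cosets, fibres of characters and preimages under homomorphisms trivial on
  \<open>V\<close>.\<close>

lemma openin_invariant:
  assumes V: "subgroup V K" "openin (topo K) V" and S: "S \<subseteq> carrier K"
    and inv: "\<And>v x. v \<in> V \<Longrightarrow> x \<in> S \<Longrightarrow> v \<otimes> x \<in> S"
  shows "openin (topo K) S"
proof (subst openin_subopen, intro ballI exI conjI)
  fix x assume x: "x \<in> S"
  then have xc: "x \<in> carrier K" using S by blast
  show "openin (topo K) {y \<in> carrier K. y \<otimes> inv x \<in> V}" using xc V by (intro openin_translate) auto
  show "x \<in> {y \<in> carrier K. y \<otimes> inv x \<in> V}" using xc subgroup.one_closed[OF V(1)] by simp
  show "{y \<in> carrier K. y \<otimes> inv x \<in> V} \<subseteq> S"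
  proof
    fix y assume "y \<in> {y \<in> carrier K. y \<otimes> inv x \<in> V}"
    then have y: "y \<in> carrier K" "y \<otimes> inv x \<in> V" by auto
    then have "(y \<otimes> inv x) \<otimes> x \<in> S" using inv x by blast
    then show "y \<in> S" using y xc by (simp add: m_assoc)
  qed
qed

text \<open>Van Dantzig's theorem: the witness is the stabilizer of a clopen neighbourhood of \<open>\<one>\<close>.\<close>

lemma ex_open_subgroup:
  assumes W: "openin (topo K) W" "\<one> \<in> W"
  obtains V where "subgroup V K" "openin (topo K) V" "V \<subseteq> W"
proof -
  have "connected_component_of_set (topo K) \<one> = {\<one>}"
    using totally_disconnected by (simp add: totally_disconnected_space_def)
  then have "{\<one>} \<in> connected_components_of (topo K)"
    using connected_component_in_connected_components_of[of "topo K" \<one>] by simp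
  moreover have "compactin (topo K) {\<one>}" by simp
  moreover have "{\<one>} \<subseteq> W" using W(2) by blast
  \<comment> \<open>In a compact Hausdorff space a component has arbitrarily small clopen
    neighbourhoods, and here the component of the unit is a point.\<close>
  ultimately obtain U U' where "openin (topo K) U" "openin (topo K) U'" "disjnt U U'"
      "U \<union> U' = topspace (topo K)" "{\<one>} \<subseteq> U" "U \<subseteq> W"
    by (rule wilder_locally_compact_component_thm[OF compact_imp_locally_compact_space[OF compact]
        Hausdorff _ _ W(1)])
  then have U: "openin (topo K) U" "openin (topo K) U'" "disjnt U U'"
      "U \<union> U' = carrier K" "\<one> \<in> U" "U \<subseteq> W"
    by simp_all
  have "U' = carrier K - U" using U(3,4) by (auto simp: disjnt_def)
  then have Ucl: "closedin (topo K) U"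
    using U openin_subset[OF U(1)] by (simp add: closedin_def)
  have Usub: "U \<subseteq> carrier K" using openin_subset[OF U(1)] by simp
  \<comment> \<open>\<open>M\<close> is a submonoid, contained in \<open>U\<close> because
    \<open>U\<close> contains the unit; the elements of \<open>M\<close> with inverse in
    \<open>M\<close> form the subgroup \<open>V\<close>.\<close>
  define M where "M = {x \<in> carrier K. \<forall>u\<in>U. x \<otimes> u \<in> U}"
  define V where "V = {x \<in> M. inv x \<in> M}"
  \<comment> \<open>The pairs that witness failure of membership in \<open>M\<close>.
    \<open>P\<close> is closed, and projection along a compact factor is a closed map, so
    \<open>M\<close> is open.\<close>
  define P where "P = {z \<in> topspace (prod_topology (topo K) (topo K)). snd z \<in> U}
    \<inter> {z \<in> topspace (prod_topology (topo K) (topo K)). (\<lambda>(x, y). x \<otimes> y) z \<in> U'}"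
  have U'cl: "closedin (topo K) U'"
    using U openin_subset[OF U(1)] \<open>U' = carrier K - U\<close> by (auto simp: closedin_def double_diff)
  have "closedin (prod_topology (topo K) (topo K)) P"
    unfolding P_def
    by (intro closedin_Int closedin_continuous_map_preimage[OF continuous_map_snd Ucl]
        closedin_continuous_map_preimage[OF continuous_mult U'cl])
  then have "closedin (topo K) (fst ` P)"
    using closed_map_fst[OF compact, of "topo K"] by (simp add: closed_map_def)
  moreover have "carrier K - fst ` P = M"
  proof (intro subset_antisym subsetI)
    fix x assume x: "x \<in> carrier K - fst ` P"
    have "x \<otimes> u \<in> U" if "u \<in> U" for u
    proof (rule ccontr)
      assume "x \<otimes> u \<notin> U"
      then have "(x, u) \<in> P" using x that Usub by (auto simp: P_def \<open>U' = carrier K - U\<close>)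
      then show False using x by force
    qed
    then show "x \<in> M" using x by (simp add: M_def)
  next
    fix x assume "x \<in> M"
    then show "x \<in> carrier K - fst ` P" by (auto simp: M_def P_def \<open>U' = carrier K - U\<close>)
  qed
  ultimately have Mop: "openin (topo K) M" by (metis openin_closedin_eq topspace_eq closedin_def)
  have "V = M \<inter> {x \<in> carrier K. inv x \<in> M}" by (auto simp: V_def M_def)
  then have Vop: "openin (topo K) V"
    using openin_continuous_map_preimage[OF continuous_inv Mop] Mop by auto
  have Mmult: "x \<otimes> y \<in> M" if "x \<in> M" "y \<in> M" for x y
    using that Usub by (auto simp: M_def m_assoc subset_iff)
  have Vsg: "subgroup V K"
  proof
    show "V \<subseteq> carrier K" by (auto simp: V_def M_def)
    show "\<one> \<in> V" using Usub by (auto simp: V_def M_def)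
    show "inv x \<in> V" if "x \<in> V" for x using that by (auto simp: V_def M_def)
    show "x \<otimes> y \<in> V" if xy: "x \<in> V" "y \<in> V" for x y
    proof -
      have "x \<in> carrier K" "y \<in> carrier K" using xy by (auto simp: V_def M_def)
      then have "inv (x \<otimes> y) = inv x \<otimes> inv y" by (simp add: inv_mult)
      then show ?thesis using xy Mmult by (auto simp: V_def)
    qed
  qed
  have "V \<subseteq> W"
  proof
    fix x assume "x \<in> V"
    then have "x \<otimes> \<one> \<in> U" "x \<in> carrier K" using U(5) by (auto simp: V_def M_def)
    then show "x \<in> W" using U(6) by auto
  qed
  with Vsg Vop show thesis by (rule that)
qed

lemma openin_rcoset:
  assumes V: "subgroup V K" "openin (topo K) V" and a: "a \<in> carrier K"
  shows "openin (topo K) (V #> a)"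
proof (rule openin_invariant[OF V])
  show "V #> a \<subseteq> carrier K" using a subgroup.subset[OF V(1)] by (simp add: r_coset_subset_G)
  show "v \<otimes> x \<in> V #> a" if "v \<in> V" "x \<in> V #> a" for v x
  proof -
    obtain w where w: "w \<in> V" "x = w \<otimes> a" using \<open>x \<in> V #> a\<close> by (auto simp: r_coset_def)
    then have "v \<otimes> x = (v \<otimes> w) \<otimes> a"
      using that a subgroup.mem_carrier[OF V(1)] by (simp add: m_assoc)
    moreover have "v \<otimes> w \<in> V" using w that subgroup.m_closed[OF V(1)] by blast
    ultimately show ?thesis by (auto simp: r_coset_def)
  qed
qed

text \<open>The cosets form an open cover by disjoint nonempty sets, so a finite subcover must
  contain all of them.\<close>

lemma finite_rcosets:
  assumes V: "subgroup V K" "openin (topo K) V"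
  shows "finite (rcosets V)"
proof -
  have op: "\<And>C. C \<in> rcosets V \<Longrightarrow> openin (topo K) C"
    using openin_rcoset[OF V] by (auto simp: RCOSETS_def)
  moreover have un: "\<Union>(rcosets V) = carrier K" using V(1) by (rule rcosets_part_G)
  ultimately have "rcosets V \<in> open_covers (topo K)" by (simp add: open_covers_def)
  then obtain \<V> where \<V>: "finite \<V>" "\<V> \<subseteq> rcosets V" "\<Union>\<V> = carrier K"
    using compact_space_finite_subcover[OF compact] by (metis topspace_eq)
  have "rcosets V \<subseteq> \<V>"
  proof
    fix C assume C: "C \<in> rcosets V"
    then obtain a where a: "a \<in> carrier K" "C = V #> a" by (auto simp: RCOSETS_def)
    then have "a \<in> C" using rcos_self V(1) by blast
    then obtain D where D: "D \<in> \<V>" "a \<in> D" using \<V>(3) a(1) by blast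
    then have "C = D"
      using rcos_disjoint[OF V(1)] C \<V>(2) \<open>a \<in> C\<close>
      by (metis (no_types, lifting) disjnt_iff pairwise_def subsetD)
    then show "C \<in> \<V>" using D by simp
  qed
  then show ?thesis using \<V>(1) finite_subset by blast
qed

text \<open>Pigeonhole: two powers of \<open>x\<close> share one of the finitely many cosets. This
  supplies the hypothesis of \<open>torsion_modulo\<close>.\<close>

lemma pow_mem_open_subgroup:
  assumes V: "subgroup V K" "openin (topo K) V" and x: "x \<in> carrier K"
  obtains n :: nat where "n > 0" "x [^] n \<in> V"
proof -
  have "(\<lambda>n::nat. V #> (x [^] n)) ` UNIV \<subseteq> rcosets V" using x by (auto simp: RCOSETS_def)
  then have "finite (range (\<lambda>n::nat. V #> (x [^] n)))" using finite_rcosets[OF V] finite_subset by blast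
  then have "\<not> inj (\<lambda>n::nat. V #> (x [^] n))" using finite_imageD infinite_UNIV_nat by blast
  then obtain i j :: nat where ij: "i < j" "V #> (x [^] i) = V #> (x [^] j)"
    unfolding inj_def by (metis nat_neq_iff)
  then have "x [^] j \<in> V #> (x [^] i)" using rcos_self[of "x [^] j" V] x V(1) by simp
  then have "x [^] j \<otimes> inv (x [^] i) \<in> V"
    using subgroup.rcos_module_imp[OF V(1) group_axioms, of "x [^] i" "x [^] j"] x by simp
  moreover have "x [^] j \<otimes> inv (x [^] i) = x [^] (j - i)"
  proof -
    have "x [^] j = x [^] (j - i) \<otimes> x [^] i" using ij(1) x by (simp add: nat_pow_mult)
    then show ?thesis using x by (simp add: m_assoc)
  qed
  ultimately show thesis using that[of "j - i"] ij(1) by simp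
qed

text \<open>The reason is that the circle has no small subgroups.\<close>

lemma character_trivial_on_open_subgroup:
  assumes \<xi>: "\<xi> \<in> characters K"
  obtains V where "subgroup V K" "openin (topo K) V" "\<And>v. v \<in> V \<Longrightarrow> \<xi> v = 1"
proof -
  have hom: "\<xi> \<in> hom K circle_group" and cont: "continuous_map (topo K) (top_of_set (sphere 0 1)) \<xi>"
    using \<xi> by (auto simp: characters_def circle_group_def)
  have mult: "\<xi> (x \<otimes> y) = \<xi> x * \<xi> y" if "x \<in> carrier K" "y \<in> carrier K" for x y
    using hom_mult[OF hom that] by (simp add: circle_group_def)
  have norm: "cmod (\<xi> x) = 1" if "x \<in> carrier K" for x
    using hom that by (auto simp: hom_def circle_group_def)
  have one: "\<xi> \<one> = 1" using mult[of \<one> \<one>] norm[of \<one>] by auto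
  have "open {z. Re z > 0}" by (rule open_halfspace_Re_gt)
  then have "openin (top_of_set (sphere 0 1)) (sphere 0 1 \<inter> {z. Re z > 0})" by (rule openin_open_Int)
  from openin_continuous_map_preimage[OF cont this]
  have op: "openin (topo K) {x \<in> carrier K. \<xi> x \<in> sphere 0 1 \<inter> {z. Re z > 0}}" by simp
  obtain V where V: "subgroup V K" "openin (topo K) V"
      "V \<subseteq> {x \<in> carrier K. \<xi> x \<in> sphere 0 1 \<inter> {z. Re z > 0}}"
    using ex_open_subgroup[OF op] one by auto
  have "\<xi> v = 1" if "v \<in> V" for v
  proof (rule circle_eq_1_if_Re_powers_pos)
    interpret V: subgroup V K by (rule V(1))
    show "cmod (\<xi> v) = 1" using that norm by (simp add: V.mem_carrier)
    fix n
    have pw: "v [^] n \<in> V \<and> \<xi> (v [^] n) = \<xi> v ^ n" for n :: nat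
      by (induction n) (auto simp: that one mult V.mem_carrier)
    then show "Re (\<xi> v ^ n) > 0" using V(3) by (metis (mono_tags, lifting) IntD2 mem_Collect_eq subsetD)
  qed
  with V(1,2) show thesis by (rule that)
qed

lemma openin_character_fibre:
  assumes \<xi>: "\<xi> \<in> characters K"
  shows "openin (topo K) {x \<in> carrier K. \<xi> x = c}"
proof -
  obtain V where V: "subgroup V K" "openin (topo K) V" "\<And>v. v \<in> V \<Longrightarrow> \<xi> v = 1"
    using character_trivial_on_open_subgroup[OF \<xi>] by metis
  have "\<xi> (x \<otimes> y) = \<xi> x * \<xi> y" if "x \<in> carrier K" "y \<in> carrier K" for x y
    using \<xi> hom_mult[of \<xi> K circle_group x y] that by (auto simp: characters_def circle_group_def)
  then show ?thesis
    using V subgroup.mem_carrier[OF V(1)] by (intro openin_invariant[OF V(1,2)]) auto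
qed

text \<open>Preimages of arbitrary sets are invariant under \<open>V\<close>, hence open. This makes
  the separating characters, which are constructed algebraically, continuous.\<close>

lemma hom_trivial_on_open_subgroup_continuous:
  assumes V: "subgroup V K" "openin (topo K) V" "\<And>v. v \<in> V \<Longrightarrow> \<xi> v = 1"
    and hom: "\<xi> \<in> hom K circle_group" and ext: "\<xi> \<in> extensional (carrier K)"
  shows "\<xi> \<in> characters K"
proof -
  have mult: "\<xi> (x \<otimes> y) = \<xi> x * \<xi> y" if "x \<in> carrier K" "y \<in> carrier K" for x y
    using hom_mult[OF hom that] by (simp add: circle_group_def)
  have "continuous_map (topo K) (top_of_set (sphere 0 1)) \<xi>"
    unfolding continuous_map_def
  proof (intro conjI allI impI)
    show "\<xi> \<in> topspace (topo K) \<rightarrow> topspace (top_of_set (sphere 0 1))"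
      using hom by (auto simp: hom_def circle_group_def)
    show "openin (topo K) {x \<in> topspace (topo K). \<xi> x \<in> U}" for U
      using V subgroup.mem_carrier[OF V(1)] mult by (intro openin_invariant[OF V(1,2)]) auto
  qed
  then show ?thesis using hom ext by (simp add: characters_def circle_group_def)
qed

text \<open>A Lebesgue number argument with open subgroups as radii: finitely many cosets
  \<open>V x #> x\<close> cover, and \<open>V0\<close> is the intersection of their subgroups. A
  point \<open>y\<close> of \<open>V x #> x\<close> has \<open>V x #> y = V x #> x\<close>, which
  plays the part of the triangle inequality.\<close>

lemma open_cover_refined_by_open_subgroup:
  assumes \<U>: "\<U> \<in> open_covers (topo K)"
  obtains V where "subgroup V K" "openin (topo K) V"
    "\<And>x. x \<in> carrier K \<Longrightarrow> \<exists>U\<in>\<U>. V #> x \<subseteq> U"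
proof -
  have "\<exists>V U. subgroup V K \<and> openin (topo K) V \<and> U \<in> \<U> \<and> V #> x \<subseteq> U" if x: "x \<in> carrier K" for x
  proof -
    obtain U where U: "U \<in> \<U>" "x \<in> U" "openin (topo K) U" using \<U> x by (auto simp: open_covers_def)
    have "openin (topo K) {y \<in> carrier K. y \<otimes> x \<in> U}" using x U by (intro openin_translate)
    moreover have "\<one> \<in> {y \<in> carrier K. y \<otimes> x \<in> U}" using x U by simp
    ultimately obtain V where V: "subgroup V K" "openin (topo K) V" "V \<subseteq> {y \<in> carrier K. y \<otimes> x \<in> U}"
      by (rule ex_open_subgroup)
    then have "V #> x \<subseteq> U" by (auto simp: r_coset_def)
    then show ?thesis using V U by blast
  qed
  then obtain V U where VU: "\<And>x. x \<in> carrier K \<Longrightarrow>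
      subgroup (V x) K \<and> openin (topo K) (V x) \<and> U x \<in> \<U> \<and> V x #> x \<subseteq> U x" by metis
  define \<W> where "\<W> = (\<lambda>x. V x #> x) ` carrier K"
  have sub: "V x #> x \<subseteq> carrier K" if "x \<in> carrier K" for x
    using VU[OF that] that by (intro r_coset_subset_G subgroup.subset) auto
  have "\<W> \<in> open_covers (topo K)"
    using VU openin_rcoset rcos_self sub by (fastforce simp: open_covers_def \<W>_def)
  then obtain \<V> where \<V>: "finite \<V>" "\<V> \<subseteq> \<W>" "\<Union>\<V> = topspace (topo K)"
    using compact_space_finite_subcover[OF compact] by metis
  then obtain C where C: "finite C" "C \<subseteq> carrier K" "\<V> = (\<lambda>x. V x #> x) ` C"
    using finite_subset_image[OF \<V>(1) \<V>(2)[unfolded \<W>_def]] by blast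
  \<comment> \<open>An empty intersection would be \<open>UNIV\<close>, which need not be a
    subgroup.\<close>
  have "C \<noteq> {}" using C(3) \<V>(3) one_closed by auto
  define V0 where "V0 = (\<Inter>x\<in>C. V x)"
  have "subgroup V0 K" unfolding V0_def
    using VU C \<open>C \<noteq> {}\<close> by (intro subgroups_Inter) auto
  moreover have "openin (topo K) V0" unfolding V0_def
    using VU C \<open>C \<noteq> {}\<close> by (intro openin_INT2) auto
  moreover have "\<exists>U\<in>\<U>. V0 #> y \<subseteq> U" if y: "y \<in> carrier K" for y
  proof -
    obtain x where x: "x \<in> C" "y \<in> V x #> x" using \<V>(3) C(3) y by auto
    then have xc: "x \<in> carrier K" using C by blast
    have "V x #> y = V x #> x" using x xc VU[OF xc] repr_independence[of y "V x" x] by auto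
    moreover have "V0 #> y \<subseteq> V x #> y" using x by (auto simp: V0_def r_coset_def)
    ultimately show ?thesis using VU[OF xc] by (intro bexI[of _ "U x"]) auto
  qed
  ultimately show thesis by (rule that)
qed

end

section \<open>Dual pairings and entropy\<close>

lemma normed_semigroup_iso_inverse:
  assumes S: "is_normed_semigroup S" and f: "f \<in> normed_semigroup_iso S T"
  shows "(\<lambda>y\<in>carrier T. inv_into (carrier S) f y) \<in> normed_semigroup_iso T S"
proof -
  define g where "g = (\<lambda>y\<in>carrier T. inv_into (carrier S) f y)"
  have bij: "bij_betw f (carrier S) (carrier T)"
    and hom: "\<And>x y. x \<in> carrier S \<Longrightarrow> y \<in> carrier S \<Longrightarrow> f (sgmult S x y) = sgmult T (f x) (f y)"
    and norm: "\<And>x. x \<in> carrier S \<Longrightarrow> sgnorm T (f x) = sgnorm S x"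
    using f by (auto simp: normed_semigroup_iso_def semigroup_hom_def)
  have gS: "g y \<in> carrier S" and fg: "f (g y) = y" if "y \<in> carrier T" for y
    using that bij by (auto simp: g_def bij_betw_def inv_into_into f_inv_into_f)
  have gf: "g (f x) = x" if "x \<in> carrier S" for x
    using that bij by (auto simp: g_def bij_betw_def)
  have "bij_betw g (carrier T) (carrier S)"
    using bij_betw_inv_into[OF bij] by (rule bij_betw_cong[THEN iffD1, rotated]) (simp add: g_def)
  moreover have "g (sgmult T x y) = sgmult S (g x) (g y)" if "x \<in> carrier T" "y \<in> carrier T" for x y
  proof -
    have "sgmult S (g x) (g y) \<in> carrier S" using S gS that by (simp add: is_normed_semigroup_def)
    moreover have "f (sgmult S (g x) (g y)) = sgmult T x y" using that by (simp add: hom gS fg)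
    ultimately show ?thesis using gf by metis
  qed
  moreover have "sgnorm S (g y) = sgnorm T y" if "y \<in> carrier T" for y
    using norm[OF gS[OF that]] fg[OF that] by simp
  moreover have "g \<in> carrier T \<rightarrow>\<^sub>E carrier S" using gS by (auto simp: g_def)
  ultimately show ?thesis
    unfolding g_def[symmetric] normed_semigroup_iso_def semigroup_hom_def by blast
qed

text \<open>The difficulty is distributed differently in the two instances. For a torsion group,
  \<open>separating\<close> rests on extension of characters and \<open>annih_small\<close> on the
  shape of basic open sets of the dual. For a compact group, \<open>separating\<close> is equality
  of functions and \<open>annih_small\<close> rests on extension. \<open>openin_fibre\<close> says
  that elements of \<open>A\<close> act on \<open>B\<close> as locally constant functions.\<close>

locale duality = pairing A B p + B: td_compact_group B
  for A :: "'a monoid" (structure) and B :: "'b top_group" (structure) and p +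
  assumes separating: "\<lbrakk>a \<in> carrier A; \<And>b. b \<in> carrier B \<Longrightarrow> p a b = 1\<rbrakk> \<Longrightarrow> a = \<one>\<^bsub>A\<^esub>"
    and openin_fibre: "a \<in> carrier A \<Longrightarrow> openin (topo B) {b \<in> carrier B. p a b = c}"
    and annih_small: "\<lbrakk>subgroup V B; openin (topo B) V\<rbrakk> \<Longrightarrow>
      \<exists>F. subgroup F A \<and> finite F \<and> annih F \<subseteq> V"
begin

lemma openin_res_fibre:
  assumes "subgroup F A" "finite F" "x \<in> carrier B"
  shows "openin (topo B) {y \<in> carrier B. res F y = res F x}"
proof -
  have F: "F \<subseteq> carrier A" "F \<noteq> {}"
    using subgroup.subset[OF assms(1)] subgroup.one_closed[OF assms(1)] by auto
  have "{y \<in> carrier B. res F y = res F x} = (\<Inter>a\<in>F. {y \<in> carrier B. p a y = p a x})"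
    using F assms(3) by (auto simp: res_eq_iff)
  moreover have "openin (topo B) (\<Inter>a\<in>F. {y \<in> carrier B. p a y = p a x})"
    using assms(2) F by (intro openin_INT2 openin_fibre) auto
  ultimately show ?thesis by simp
qed

lemma openin_annih:
  assumes "subgroup F A" "finite F"
  shows "openin (topo B) (annih F)"
proof -
  have "annih F = {y \<in> carrier B. res F y = res F \<one>\<^bsub>B\<^esub>}"
    using subgroup.subset[OF assms(1)] by (auto simp: res_eq_iff annih_def subset_iff)
  then show ?thesis using openin_res_fibre[OF assms B.one_closed] by simp
qed

lemma card_res_carrier:
  assumes "subgroup F A" "finite F"
  shows "card (res F ` carrier B) = card F"
proof -
  have "F \<inter> coannih (carrier B) = {\<one>\<^bsub>A\<^esub>}"
    using subgroup.one_closed[OF assms(1)] separating by (auto simp: coannih_def)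
  then show ?thesis using card_res[OF assms B.subgroup_self] by simp
qed

lemma card_rcosets_annih_eq:
  assumes "subgroup F A" "finite F"
  shows "card (rcosets\<^bsub>B\<^esub> annih F) = card F"
  using card_rcosets_annih[OF subgroup.subset[OF assms(1)]] card_res_carrier[OF assms] by simp

lemma finite_set_mult: "finite F \<Longrightarrow> finite F' \<Longrightarrow> finite (F <#>\<^bsub>A\<^esub> F')"
  by (simp add: set_mult_def)

text \<open>The product of \<open>F\<close> and \<open>F'\<close> has the same annihilator as each
  of them, hence the same cardinality, and it contains both.\<close>

lemma annih_inj:
  assumes F: "subgroup F A" "finite F" and F': "subgroup F' A" "finite F'"
    and eq: "annih F = annih F'"
  shows "F = F'"
proof -
  define H where "H = F <#>\<^bsub>A\<^esub> F'"
  have H: "subgroup H A" "finite H"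
    using A.mult_subgroups[OF F(1) F'(1)] finite_set_mult[OF F(2) F'(2)] by (simp_all add: H_def)
  have "F \<subseteq> H" "F' \<subseteq> H"
  proof -
    have "a \<otimes>\<^bsub>A\<^esub> \<one>\<^bsub>A\<^esub> \<in> H" if "a \<in> F" for a
      using that subgroup.one_closed[OF F'(1)] unfolding H_def set_mult_def by blast
    then show "F \<subseteq> H" using subgroup.mem_carrier[OF F(1)] by auto
    have "\<one>\<^bsub>A\<^esub> \<otimes>\<^bsub>A\<^esub> a \<in> H" if "a \<in> F'" for a
      using that subgroup.one_closed[OF F(1)] unfolding H_def set_mult_def by blast
    then show "F' \<subseteq> H" using subgroup.mem_carrier[OF F'(1)] by auto
  qed
  moreover have "annih H = annih F" using annih_set_mult[OF F(1) F'(1)] eq by (simp add: H_def)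
  then have "card H = card F" "card H = card F'"
    using card_rcosets_annih_eq[OF H] card_rcosets_annih_eq[OF F] card_rcosets_annih_eq[OF F'] eq by simp_all
  ultimately show ?thesis using card_subset_eq[OF H(2)] by metis
qed

lemma annih_surj:
  assumes "subgroup V B" "openin (topo B) V"
  obtains F where "subgroup F A" "finite F" "annih F = V"
proof -
  obtain F where F: "subgroup F A" "finite F" "annih F \<subseteq> V" using annih_small[OF assms] by blast
  have "subgroup (F \<inter> coannih V) A"
    using A.subgroups_Inter_pair[OF F(1) subgroup_coannih[OF subgroup.subset[OF assms(1)]]] .
  then show thesis using that F(2) annih_coannih[OF F(1,2) assms(1) F(3)] by blast
qed

lemma annih_iso:
  "(\<lambda>F\<in>carrier (sub_semigroup A). annih F) \<in> normed_semigroup_iso (sub_semigroup A) (sub_o_semigroup B)"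
proof -
  have S: "carrier (sub_semigroup A) = {F. subgroup F A \<and> finite F}"
    and T: "carrier (sub_o_semigroup B) = {V. subgroup V B \<and> openin (topo B) V}"
    by (auto simp: sub_semigroup_def sub_o_semigroup_def B.normal_iff_subgroup)
  have mem: "annih F \<in> carrier (sub_o_semigroup B)" if "F \<in> carrier (sub_semigroup A)" for F
    using that openin_annih subgroup_annih subgroup.subset unfolding S T by blast
  have "inj_on annih (carrier (sub_semigroup A))"
    using annih_inj by (auto simp: inj_on_def S)
  moreover have "annih ` carrier (sub_semigroup A) = carrier (sub_o_semigroup B)"
  proof
    show "annih ` carrier (sub_semigroup A) \<subseteq> carrier (sub_o_semigroup B)" using mem by blast
    show "carrier (sub_o_semigroup B) \<subseteq> annih ` carrier (sub_semigroup A)"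
    proof
      fix V assume "V \<in> carrier (sub_o_semigroup B)"
      then obtain F where "subgroup F A" "finite F" "annih F = V"
        using annih_surj[of V] unfolding T by blast
      then show "V \<in> annih ` carrier (sub_semigroup A)" unfolding S by blast
    qed
  qed
  ultimately have "bij_betw annih (carrier (sub_semigroup A)) (carrier (sub_o_semigroup B))"
    by (simp add: bij_betw_def)
  then have "bij_betw (\<lambda>F\<in>carrier (sub_semigroup A). annih F)
      (carrier (sub_semigroup A)) (carrier (sub_o_semigroup B))"
    by (simp add: bij_betw_restrict_eq)
  moreover have "(\<lambda>F\<in>carrier (sub_semigroup A). annih F) (sgmult (sub_semigroup A) F F') =
      sgmult (sub_o_semigroup B) (annih F) (annih F')"
    if "F \<in> carrier (sub_semigroup A)" "F' \<in> carrier (sub_semigroup A)" for F F'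
  proof -
    have "F <#>\<^bsub>A\<^esub> F' \<in> carrier (sub_semigroup A)"
      using that A.mult_subgroups finite_set_mult unfolding S by blast
    then show ?thesis
      using that annih_set_mult unfolding S by (simp add: sub_semigroup_def sub_o_semigroup_def)
  qed
  moreover have "sgnorm (sub_o_semigroup B) (annih F) = sgnorm (sub_semigroup A) F"
    if "F \<in> carrier (sub_semigroup A)" for F
    using that card_rcosets_annih_eq unfolding S by (simp add: sub_semigroup_def sub_o_semigroup_def)
  ultimately show ?thesis
    using mem by (auto simp: normed_semigroup_iso_def semigroup_hom_def)
qed

end

text \<open>The relation \<open>adjoint\<close> treats both parts alike: in (a)
  \<open>\<psi>\<close> is the dual of \<open>\<phi>\<close>, in (b) \<open>\<phi>\<close> is the
  dual of \<open>\<psi>\<close>.\<close>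

locale dual_endomorphisms = duality A B p for A (structure) and B (structure) and p +
  fixes \<phi> \<psi>
  assumes hom: "\<phi> \<in> hom A A" and continuous: "continuous_map (topo B) (topo B) \<psi>"
    and adjoint: "\<lbrakk>a \<in> carrier A; b \<in> carrier B\<rbrakk> \<Longrightarrow> p (\<phi> a) b = p a (\<psi> b)"
begin

lemma funpow_hom: "\<phi> ^^ n \<in> hom A A"
proof (induction n)
  case (Suc n)
  then show ?case using hom by (auto simp: hom_def Pi_iff)
qed (auto simp: hom_def)

lemma funpow_closed [simp]: "b \<in> carrier B \<Longrightarrow> (\<psi> ^^ n) b \<in> carrier B"
  using continuous_map_funpow[OF continuous, of n] by (auto simp: continuous_map_def)

lemma adjoint_funpow: "\<lbrakk>a \<in> carrier A; b \<in> carrier B\<rbrakk> \<Longrightarrow> p ((\<phi> ^^ n) a) b = p a ((\<psi> ^^ n) b)"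
proof (induction n arbitrary: b)
  case (Suc n)
  have "(\<phi> ^^ n) a \<in> carrier A" using funpow_hom[of n] Suc.prems by (auto simp: hom_def)
  moreover have "\<psi> b \<in> carrier B" using funpow_closed[of b 1] Suc.prems by simp
  ultimately have "p (\<phi> ((\<phi> ^^ n) a)) b = p a ((\<psi> ^^ n) (\<psi> b))" using Suc by (simp add: adjoint)
  then show ?case by (simp add: funpow_swap1)
qed simp

context
  fixes F assumes F: "subgroup F A" "finite F"
begin

lemma image_funpow: "subgroup ((\<phi> ^^ n) ` F) A" "finite ((\<phi> ^^ n) ` F)"
proof -
  interpret h: group_hom A A "\<phi> ^^ n"
    using funpow_hom by unfold_locales
  show "subgroup ((\<phi> ^^ n) ` F) A" using F(1) by (rule h.subgroup_img_is_subgroup)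
  show "finite ((\<phi> ^^ n) ` F)" using F(2) by simp
qed

lemma group_traj: "subgroup (group_traj A \<phi> F n) A" "finite (group_traj A \<phi> F n)"
proof (induction n)
  case 0
  case 1
  show ?case by (simp add: A.triv_subgroup)
  case 2
  show ?case by simp
next
  case (Suc n)
  case 1
  show ?case using A.mult_subgroups[OF Suc(1) image_funpow(1)] by simp
  case 2
  show ?case using finite_set_mult[OF Suc(2) image_funpow(2)] by simp
qed

text \<open>By adjointness, \<open>b\<close> restricted to the image of \<open>F\<close> under
  \<open>\<phi> ^^ i\<close> corresponds to \<open>(\<psi> ^^ i) b\<close> restricted to
  \<open>F\<close>, and the annihilator of a product of subgroups is the intersection of the
  annihilators. So the coset of \<open>b\<close> modulo the annihilator of the trajectory records
  exactly the first \<open>n\<close> steps of the itinerary of \<open>b\<close> through the cosets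
  of \<open>annih F\<close>.\<close>

lemma res_group_traj_eq_iff:
  assumes b: "b \<in> carrier B" "b' \<in> carrier B"
  shows "res (group_traj A \<phi> F n) b = res (group_traj A \<phi> F n) b' \<longleftrightarrow>
    (\<forall>i<n. res F ((\<psi> ^^ i) b) = res F ((\<psi> ^^ i) b'))"
proof (induction n)
  case 0
  then show ?case using b by (simp add: res_eq_iff)
next
  case (Suc n)
  let ?T = "group_traj A \<phi> F n" and ?I = "(\<phi> ^^ n) ` F"
  have sub: "?T \<subseteq> carrier A" "?I \<subseteq> carrier A" "?T <#>\<^bsub>A\<^esub> ?I \<subseteq> carrier A"
    using group_traj(1)[of n] image_funpow(1)[of n] A.mult_subgroups[OF group_traj(1) image_funpow(1)]
      subgroup.subset by blast+
  have "res (?T <#>\<^bsub>A\<^esub> ?I) b = res (?T <#>\<^bsub>A\<^esub> ?I) b' \<longleftrightarrow> res ?T b = res ?T b' \<and> res ?I b = res ?I b'"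
    using mem_annih_quotient_iff[OF sub(1) b] mem_annih_quotient_iff[OF sub(2) b]
      mem_annih_quotient_iff[OF sub(3) b] annih_set_mult[OF group_traj(1) image_funpow(1), of n n] by blast
  moreover have "res ?I b = res ?I b' \<longleftrightarrow> res F ((\<psi> ^^ n) b) = res F ((\<psi> ^^ n) b')"
    using b sub(2) subgroup.mem_carrier[OF F(1)] subgroup.subset[OF F(1)]
    by (auto simp: res_eq_iff adjoint_funpow)
  ultimately show ?case using Suc by (auto simp: less_Suc_eq)
qed

text \<open>The cover of \<open>B\<close> by the cosets of \<open>annih F\<close>.\<close>

definition fibre_cover :: "'b set set" where
  "fibre_cover = (\<lambda>x. {y \<in> carrier B. res F y = res F x}) ` carrier B"

lemma fibre_cover_open_cover: "fibre_cover \<in> open_covers (topo B)"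
  using openin_res_fibre[OF F] by (auto simp: open_covers_def fibre_cover_def)

text \<open>Used twice: for \<open>fibre_cover\<close> itself, and for an arbitrary open cover that
  is refined by it.\<close>

lemma fibre_refines_iterated_cover:
  assumes "\<And>x. x \<in> carrier B \<Longrightarrow> \<exists>U\<in>\<U>. {y \<in> carrier B. res F y = res F x} \<subseteq> U"
  shows "fibre_refines (topo B) (res (group_traj A \<phi> F n)) (iterated_cover (topo B) \<psi> \<U> n)"
  unfolding fibre_refines_def
proof
  fix x assume "x \<in> topspace (topo B)"
  then have x: "x \<in> carrier B" by simp
  then have "\<forall>i. \<exists>U\<in>\<U>. {y \<in> carrier B. res F y = res F ((\<psi> ^^ i) x)} \<subseteq> U" using assms by simp
  then obtain U where U: "\<And>i. U i \<in> \<U>" "\<And>i. {y \<in> carrier B. res F y = res F ((\<psi> ^^ i) x)} \<subseteq> U i" by metis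
  have "{x \<in> topspace (topo B). \<forall>i<n. (\<psi> ^^ i) x \<in> U i} \<in> iterated_cover (topo B) \<psi> \<U> n"
    unfolding iterated_cover_eq using U(1) by blast
  moreover have "y \<in> {x \<in> topspace (topo B). \<forall>i<n. (\<psi> ^^ i) x \<in> U i}"
    if y: "y \<in> topspace (topo B)" "res (group_traj A \<phi> F n) y = res (group_traj A \<phi> F n) x" for y
  proof -
    have yc: "y \<in> carrier B" using y(1) by simp
    have "\<forall>i<n. res F ((\<psi> ^^ i) y) = res F ((\<psi> ^^ i) x)"
      using y(2) res_group_traj_eq_iff[OF yc x] by blast
    then have "(\<psi> ^^ i) y \<in> U i" if "i < n" for i
      using that funpow_closed[OF yc] by (intro subsetD[OF U(2)]) auto
    then show ?thesis using y(1) by blast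
  qed
  ultimately show "\<exists>W\<in>iterated_cover (topo B) \<psi> \<U> n. \<forall>y\<in>topspace (topo B).
      res (group_traj A \<phi> F n) y = res (group_traj A \<phi> F n) x \<longrightarrow> y \<in> W" by blast
qed

lemma card_res_group_traj:
  "card (res (group_traj A \<phi> F n) ` topspace (topo B)) = card (group_traj A \<phi> F n)"
  "finite (res (group_traj A \<phi> F n) ` topspace (topo B))"
  using card_res_carrier[OF group_traj] finite_res[OF group_traj, of "carrier B"] by simp_all

lemma Union_iterated_cover: "\<Union>(iterated_cover (topo B) \<psi> \<U> n) \<subseteq> topspace (topo B)"
  unfolding iterated_cover_eq by blast

lemma min_subcover_fibre_cover:
  "min_subcover (topo B) (iterated_cover (topo B) \<psi> fibre_cover n) = card (group_traj A \<phi> F n)"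
proof -
  have const: "res (group_traj A \<phi> F n) x = res (group_traj A \<phi> F n) y"
    if W: "W \<in> iterated_cover (topo B) \<psi> fibre_cover n" "x \<in> W" "y \<in> W" for W x y
  proof -
    obtain U where U: "\<forall>i<n. U i \<in> fibre_cover" "W = {x \<in> topspace (topo B). \<forall>i<n. (\<psi> ^^ i) x \<in> U i}"
      using W(1) unfolding iterated_cover_eq by blast
    have "res F ((\<psi> ^^ i) x) = res F ((\<psi> ^^ i) y)" if "i < n" for i
      using U W(2,3) that unfolding fibre_cover_def by fastforce
    then show ?thesis using res_group_traj_eq_iff[of x y n] U(2) W(2,3) by auto
  qed
  have "\<exists>U\<in>fibre_cover. {y \<in> carrier B. res F y = res F x} \<subseteq> U" if "x \<in> carrier B" for x
    using that unfolding fibre_cover_def by blast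
  then have "fibre_refines (topo B) (res (group_traj A \<phi> F n)) (iterated_cover (topo B) \<psi> fibre_cover n)"
    by (rule fibre_refines_iterated_cover)
  from min_subcover_eq_card_fibres[OF this card_res_group_traj(2) Union_iterated_cover const]
  show ?thesis by (simp only: card_res_group_traj(1))
qed

end

lemma ex_refining_subgroup:
  assumes "\<U> \<in> open_covers (topo B)"
  obtains F where "subgroup F A" "finite F"
    "\<And>x. x \<in> carrier B \<Longrightarrow> \<exists>U\<in>\<U>. {y \<in> carrier B. res F y = res F x} \<subseteq> U"
proof -
  obtain V where V: "subgroup V B" "openin (topo B) V"
      and VU: "\<And>x. x \<in> carrier B \<Longrightarrow> \<exists>U\<in>\<U>. V #>\<^bsub>B\<^esub> x \<subseteq> U"
    using B.open_cover_refined_by_open_subgroup[OF assms] by metis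
  obtain F where F: "subgroup F A" "finite F" "annih F \<subseteq> V" using annih_small[OF V] by blast
  have "{y \<in> carrier B. res F y = res F x} \<subseteq> V #>\<^bsub>B\<^esub> x" if x: "x \<in> carrier B" for x
  proof
    fix y assume y: "y \<in> {y \<in> carrier B. res F y = res F x}"
    then have "y \<otimes>\<^bsub>B\<^esub> inv\<^bsub>B\<^esub> x \<in> V"
      using mem_annih_quotient_iff[OF subgroup.subset[OF F(1)], of y x] x F(3) by blast
    then show "y \<in> V #>\<^bsub>B\<^esub> x"
      using subgroup.rcos_module_rev[OF V(1) B.group_axioms x] y by blast
  qed
  then show thesis using that[OF F(1,2)] VU by (meson order_trans)
qed

theorem h_top_eq_ent: "h_top (topo B) \<psi> = ent A \<phi>"
proof (rule antisym)
  have ne: "topspace (topo B) \<noteq> {}" using B.one_closed by auto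
  show "ent A \<phi> \<le> h_top (topo B) \<psi>"
    unfolding ent_def
  proof (rule SUP_least)
    fix F assume "F \<in> {F. subgroup F A \<and> finite F}"
    then have F: "subgroup F A" "finite F" by auto
    show "lim (\<lambda>n. ennreal (ln (real (card (group_traj A \<phi> F n))) / real n)) \<le> h_top (topo B) \<psi>"
      \<comment> \<open>The sequences agree term by term, including \<open>n = 0\<close>, so this
        \<open>lim\<close> is literally a member of the supremum.\<close>
      unfolding h_top_def min_subcover_fibre_cover[OF F, symmetric]
      by (rule SUP_upper) (rule fibre_cover_open_cover[OF F])
  qed
  show "h_top (topo B) \<psi> \<le> ent A \<phi>"
    unfolding h_top_def
  proof (rule SUP_least)
    fix \<U> assume \<U>: "\<U> \<in> open_covers (topo B)"
    obtain F where F: "subgroup F A" "finite F"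
        "\<And>x. x \<in> carrier B \<Longrightarrow> \<exists>U\<in>\<U>. {y \<in> carrier B. res F y = res F x} \<subseteq> U"
      using ex_refining_subgroup[OF \<U>] by blast
    \<comment> \<open>For a general cover there is only an inequality of terms, so convergence of
      both sequences is established before the limits are compared.\<close>
    define u where "u n = ennreal (ln (real (min_subcover (topo B) (iterated_cover (topo B) \<psi> \<U> n))) / real n)" for n
    define v where "v n = ennreal (ln (real (card (group_traj A \<phi> F n))) / real n)" for n
    have "u \<longlonglongrightarrow> lim u"
      unfolding u_def by (rule cover_entropy_tendsto[OF B.compact ne continuous \<U>])
    moreover have "v \<longlonglongrightarrow> lim v"
      unfolding v_def min_subcover_fibre_cover[OF F(1,2), symmetric]
      by (rule cover_entropy_tendsto[OF B.compact ne continuous fibre_cover_open_cover[OF F(1,2)]])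
    moreover have "u n \<le> v n" for n
    proof -
      have "min_subcover (topo B) (iterated_cover (topo B) \<psi> \<U> n) \<le> card (group_traj A \<phi> F n)"
        using min_subcover_le_card_fibres[OF fibre_refines_iterated_cover[OF F] card_res_group_traj(2)[OF F(1,2)]
            Union_iterated_cover[OF F(1,2)], of n] card_res_group_traj(1)[OF F(1,2), of n] by simp
      moreover have "min_subcover (topo B) (iterated_cover (topo B) \<psi> \<U> n) \<ge> 1"
        by (rule min_subcover_pos[OF B.compact iterated_cover_open_cover[OF continuous \<U>] ne])
      ultimately show ?thesis
        unfolding u_def v_def by (intro ennreal_leI divide_right_mono) auto
    qed
    ultimately have "lim u \<le> lim v" using LIMSEQ_le[of u "lim u" v "lim v"] by blast
    also have "lim v \<le> ent A \<phi>"
      unfolding v_def ent_def using F(1,2) by (intro SUP_upper) simp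
    finally show "lim (\<lambda>n. ennreal (ln (real (min_subcover (topo B) (iterated_cover (topo B) \<psi> \<U> n))) / real n))
        \<le> ent A \<phi>" by (simp add: u_def[abs_def])
  qed
qed

end

section \<open>Dual groups\<close>

text \<open>The group axioms read only carrier, multiplication and unit, so they cannot see a
  topology field being dropped or added.\<close>

lemma comm_group_truncate_iff: "comm_group (monoid.truncate G) \<longleftrightarrow> comm_group G"
  unfolding comm_group_def comm_monoid_def comm_monoid_axioms_def group_def group_axioms_def
    monoid_def Units_def monoid.truncate_def by (simp only: monoid.simps partial_object.simps)

lemma comm_group_discrete_group_iff: "comm_group (discrete_group G) \<longleftrightarrow> comm_group G"
  unfolding comm_group_def comm_monoid_def comm_monoid_axioms_def group_def group_axioms_def
    monoid_def Units_def discrete_group_def by (simp only: monoid.simps partial_object.simps)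

lemma discrete_group_simps [simp]:
  "carrier (discrete_group G) = carrier G" "mult (discrete_group G) = mult G"
  "one (discrete_group G) = one G" "topo (discrete_group G) = discrete_topology (carrier G)"
  by (simp_all add: discrete_group_def)

lemma dual_simps [simp]:
  "carrier (dual K) = characters K" "mult (dual K) \<xi> \<zeta> = (\<lambda>x\<in>carrier K. \<xi> x * \<zeta> x)"
  "one (dual K) = (\<lambda>x\<in>carrier K. 1)" "topo (dual K) = compact_open_topology K"
  by (simp_all add: dual_def)

lemma truncate_dual_simps [simp]:
  "carrier (monoid.truncate (dual K)) = characters K"
  "mult (monoid.truncate (dual K)) \<xi> \<zeta> = (\<lambda>x\<in>carrier K. \<xi> x * \<zeta> x)"
  "one (monoid.truncate (dual K)) = (\<lambda>x\<in>carrier K. 1)"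
  by (simp_all add: dual_def monoid.truncate_def)

text \<open>Continuity is stated into the plane instead of the circle, so that products and
  conjugates come from continuous operations on \<open>complex\<close>.\<close>

lemma characters_iff:
  assumes "topspace (topo K) = carrier K"
  shows "\<xi> \<in> characters K \<longleftrightarrow> \<xi> \<in> extensional (carrier K) \<and> (\<forall>x\<in>carrier K. cmod (\<xi> x) = 1) \<and>
    (\<forall>x\<in>carrier K. \<forall>y\<in>carrier K. \<xi> (x \<otimes>\<^bsub>K\<^esub> y) = \<xi> x * \<xi> y) \<and> continuous_map (topo K) euclidean \<xi>"
  using assms
  by (auto simp: characters_def hom_def circle_group_def continuous_map_in_subtopology Pi_iff)

lemma continuous_map_complex_mult:
  fixes f g :: "'a \<Rightarrow> complex"
  assumes "continuous_map X euclidean f" "continuous_map X euclidean g"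
  shows "continuous_map X euclidean (\<lambda>x. f x * g x)"
proof -
  have pair: "continuous_map X (prod_topology euclidean euclidean) (\<lambda>x. (f x, g x))"
    using assms by (rule continuous_map_pairedI)
  have "continuous_map (prod_topology euclidean euclidean) euclidean (\<lambda>z. fst z * snd z :: complex)"
    by (simp add: continuous_on_mult continuous_on_fst continuous_on_snd)
  from continuous_map_compose[OF pair this] show ?thesis by (simp add: comp_def)
qed

lemma continuous_map_cnj:
  assumes "continuous_map X euclidean f"
  shows "continuous_map X euclidean (\<lambda>x. cnj (f x))"
proof -
  have "continuous_map euclidean euclidean cnj" by (simp add: continuous_on_cnj)
  from continuous_map_compose[OF assms this] show ?thesis by (simp add: comp_def)
qed

lemma comm_group_dual:
  assumes "comm_group K" and top: "topspace (topo K) = carrier K"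
  shows "comm_group (dual K)"
proof -
  interpret comm_group K by fact
  note iff = characters_iff[OF top]
  have restrict_cont: "continuous_map (topo K) euclidean (\<lambda>x\<in>carrier K. f x)"
    if "continuous_map (topo K) euclidean f" for f :: "'a \<Rightarrow> complex"
    using that by (rule continuous_map_eq) (simp add: top)
  show ?thesis
  proof (rule comm_groupI)
    fix \<xi> \<zeta> assume "\<xi> \<in> carrier (dual K)" "\<zeta> \<in> carrier (dual K)"
    then show "\<xi> \<otimes>\<^bsub>dual K\<^esub> \<zeta> \<in> carrier (dual K)"
      using restrict_cont[OF continuous_map_complex_mult[of "topo K" \<xi> \<zeta>]] by (auto simp: iff norm_mult)
  next
    show "\<one>\<^bsub>dual K\<^esub> \<in> carrier (dual K)"
      using restrict_cont[of "\<lambda>_. 1"] by (auto simp: iff)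
  next
    fix \<xi> assume \<xi>: "\<xi> \<in> carrier (dual K)"
    then show "\<one>\<^bsub>dual K\<^esub> \<otimes>\<^bsub>dual K\<^esub> \<xi> = \<xi>" by (auto simp: iff fun_eq_iff extensional_def)
    \<comment> \<open>On the unit circle the inverse is the conjugate.\<close>
    have "(\<lambda>x\<in>carrier K. cnj (\<xi> x)) \<in> carrier (dual K)"
      using \<xi> restrict_cont[OF continuous_map_cnj[of "topo K" \<xi>]] by (auto simp: iff)
    moreover have "cnj (\<xi> x) * \<xi> x = 1" if "x \<in> carrier K" for x
      using \<xi> that complex_norm_square[of "\<xi> x"] by (simp add: iff mult.commute)
    then have "(\<lambda>x\<in>carrier K. cnj (\<xi> x)) \<otimes>\<^bsub>dual K\<^esub> \<xi> = \<one>\<^bsub>dual K\<^esub>"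
      by (auto simp: fun_eq_iff)
    ultimately show "\<exists>\<zeta>\<in>carrier (dual K). \<zeta> \<otimes>\<^bsub>dual K\<^esub> \<xi> = \<one>\<^bsub>dual K\<^esub>" by blast
  qed (auto simp: fun_eq_iff mult_ac)
qed

lemma inv_dual:
  assumes "comm_group K" and top: "topspace (topo K) = carrier K" and \<xi>: "\<xi> \<in> characters K"
    and x: "x \<in> carrier K"
  shows "(inv\<^bsub>dual K\<^esub> \<xi>) x = cnj (\<xi> x)"
proof -
  interpret D: comm_group "dual K" using assms(1,2) by (rule comm_group_dual)
  have "((inv\<^bsub>dual K\<^esub> \<xi>) \<otimes>\<^bsub>dual K\<^esub> \<xi>) x = 1" using \<xi> x by (subst D.l_inv) auto
  then have "(inv\<^bsub>dual K\<^esub> \<xi>) x * \<xi> x = 1" using x by simp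
  moreover have "\<xi> x * cnj (\<xi> x) = 1"
    using \<xi> x complex_norm_square[of "\<xi> x"] by (simp add: characters_iff[OF top])
  ultimately show ?thesis by (metis mult.assoc mult.left_neutral mult.right_neutral)
qed

lemma compose_mem_characters:
  assumes topK: "topspace (topo K) = carrier K" and topL: "topspace (topo L) = carrier L" and "group K"
    and f: "f \<in> hom K L" "continuous_map (topo K) (topo L) f" and \<xi>: "\<xi> \<in> characters L"
  shows "compose (carrier K) \<xi> f \<in> characters K"
proof -
  interpret group K by fact
  have "continuous_map (topo K) euclidean (\<lambda>x. \<xi> (f x))"
    using continuous_map_compose[OF f(2), of euclidean \<xi>] \<xi> by (simp add: characters_iff[OF topL] comp_def)
  then have "continuous_map (topo K) euclidean (compose (carrier K) \<xi> f)"
    by (rule continuous_map_eq) (simp add: topK compose_def)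
  then show ?thesis
    using f(1) \<xi> by (auto simp: characters_iff[OF topL] characters_iff[OF topK] hom_def compose_def Pi_iff)
qed

lemma dual_map_hom:
  assumes topK: "topspace (topo K) = carrier K" and topL: "topspace (topo L) = carrier L"
    and "comm_group K" "comm_group L"
    and f: "f \<in> hom K L" "continuous_map (topo K) (topo L) f"
  shows "dual_map K L f \<in> hom (dual L) (dual K)"
proof (rule homI)
  interpret K: comm_group K by fact
  interpret DL: comm_group "dual L" using assms by (intro comm_group_dual)
  show "dual_map K L f \<xi> \<in> carrier (dual K)" if "\<xi> \<in> carrier (dual L)" for \<xi>
    using compose_mem_characters[OF topK topL K.group_axioms f] that by (simp add: dual_map_def)
  fix \<xi> \<zeta> assume "\<xi> \<in> carrier (dual L)" "\<zeta> \<in> carrier (dual L)"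
  moreover from this have "\<xi> \<otimes>\<^bsub>dual L\<^esub> \<zeta> \<in> characters L" using DL.m_closed by simp
  ultimately show "dual_map K L f (\<xi> \<otimes>\<^bsub>dual L\<^esub> \<zeta>) = dual_map K L f \<xi> \<otimes>\<^bsub>dual K\<^esub> dual_map K L f \<zeta>"
    using f(1) by (auto simp: dual_map_def compose_def fun_eq_iff hom_def Pi_iff)
qed

lemma dual_map_extensional: "dual_map K L f \<in> extensional (characters L)"
  by (simp add: dual_map_def)

lemma dual_map_ident: "dual_map K K (\<lambda>x\<in>carrier K. x) = (\<lambda>\<xi>\<in>characters K. \<xi>)"
  by (auto simp: dual_map_def compose_def fun_eq_iff characters_def extensional_def)

lemma dual_map_compose:
  assumes f: "f \<in> carrier K \<rightarrow> carrier L"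
    and closed: "\<And>\<xi>. \<xi> \<in> characters M \<Longrightarrow> compose (carrier L) \<xi> g \<in> characters L"
  shows "dual_map K M (compose (carrier K) g f) = compose (characters M) (dual_map K L f) (dual_map L M g)"
  using assms by (auto simp: dual_map_def compose_def fun_eq_iff Pi_iff)

lemma dual_map_apply:
  "\<xi> \<in> characters L \<Longrightarrow> x \<in> carrier K \<Longrightarrow> dual_map K L f \<xi> x = \<xi> (f x)"
  by (simp add: dual_map_def compose_def)

section \<open>The compact-open topology on the dual of a discrete group\<close>

abbreviation circle :: "complex topology" where "circle \<equiv> top_of_set (sphere 0 1)"

lemma topspace_compact_open_topology [simp]: "topspace (compact_open_topology K) = characters K"
proof -
  \<comment> \<open>The subbasic set of the empty compact set is everything, so the generated
    topology lives on all characters.\<close>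
  have "characters K = {\<xi> \<in> characters K. \<xi> ` {} \<subseteq> {}}" by simp
  moreover have "compactin (topo K) {}" "openin (topo circle_group) {}" by simp_all
  ultimately have "characters K \<in> {{\<xi> \<in> characters K. \<xi> ` C \<subseteq> U} | C U.
      compactin (topo K) C \<and> openin (topo circle_group) U}"
    by blast
  then show ?thesis unfolding compact_open_topology_def topology_generated_by_topspace by blast
qed

lemma topology_eqI_continuous_id:
  assumes "topspace X = topspace Y" "continuous_map X Y (\<lambda>x. x)" "continuous_map Y X (\<lambda>x. x)"
  shows "X = Y"
proof -
  have "openin Y U" if "openin X U" "continuous_map Y X (\<lambda>x. x)" "topspace X = topspace Y" for X Y :: "'a topology" and U
  proof -
    have "{x \<in> topspace Y. x \<in> U} = U" using that openin_subset by blast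
    then show ?thesis using openin_continuous_map_preimage[OF that(2,1)] by simp
  qed
  then show ?thesis unfolding topology_eq using assms by metis
qed

text \<open>Compact subsets of a discrete space are finite, so this is the topology of pointwise
  convergence. Tychonoff's theorem and coordinatewise criteria become available.\<close>

lemma compact_open_topology_discrete_group:
  "compact_open_topology (discrete_group G) =
    subtopology (product_topology (\<lambda>_. circle) (carrier G)) (characters (discrete_group G))"
  (is "?CO = subtopology ?P ?C")
proof (rule topology_eqI_continuous_id)
  have C: "?C \<subseteq> topspace ?P"
    by (auto simp: characters_iff extensional_def)
  then show top: "topspace ?CO = topspace (subtopology ?P ?C)" by auto
  have CO_top: "topspace ?CO = ?C" by simp
  show "continuous_map (subtopology ?P ?C) ?CO (\<lambda>x. x)"
    unfolding compact_open_topology_def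
  proof (rule continuous_on_generated_topo)
    fix W assume "W \<in> {{\<xi> \<in> ?C. \<xi> ` C \<subseteq> U} | C U.
      compactin (topo (discrete_group G)) C \<and> openin (topo circle_group) U}"
    then obtain C U where W: "W = {\<xi> \<in> ?C. \<xi> ` C \<subseteq> U}" "C \<subseteq> carrier G" "finite C" "openin circle U"
      by (auto simp: compactin_discrete_topology circle_group_def)
    have eq: "(\<lambda>x. x) -` W \<inter> topspace (subtopology ?P ?C) =
        (\<Inter>x\<in>C. {\<xi> \<in> topspace (subtopology ?P ?C). \<xi> x \<in> U}) \<inter> topspace (subtopology ?P ?C)"
      using W(1) by auto
    have "openin (subtopology ?P ?C) {\<xi> \<in> topspace (subtopology ?P ?C). \<xi> x \<in> U}" if "x \<in> C" for x
      using W that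
      by (intro openin_continuous_map_preimage[OF continuous_map_from_subtopology
            [OF continuous_map_product_projection]]) auto
    with W(3) show "openin (subtopology ?P ?C) ((\<lambda>x. x) -` W \<inter> topspace (subtopology ?P ?C))"
      unfolding eq by (rule openin_INT)
  next
    show "(\<lambda>x. x) ` topspace (subtopology ?P ?C) \<subseteq> \<Union> {{\<xi> \<in> ?C. \<xi> ` C \<subseteq> U} | C U.
      compactin (topo (discrete_group G)) C \<and> openin (topo circle_group) U}"
      using top CO_top unfolding compact_open_topology_def topology_generated_by_topspace by simp
  qed
  have "continuous_map ?CO circle (\<lambda>\<xi>. \<xi> x)" if x: "x \<in> carrier G" for x
    unfolding continuous_map_def
  proof (intro conjI allI impI)
    show "(\<lambda>\<xi>. \<xi> x) \<in> topspace ?CO \<rightarrow> topspace circle" using x by (auto simp: characters_iff)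
    fix U assume U: "openin circle U"
    have "{\<xi> \<in> topspace ?CO. \<xi> x \<in> U} = {\<xi> \<in> ?C. \<xi> ` {x} \<subseteq> U}" by simp
    moreover have "compactin (topo (discrete_group G)) {x}" "openin (topo circle_group) U"
      using x U by (auto simp: circle_group_def)
    then have "openin ?CO {\<xi> \<in> ?C. \<xi> ` {x} \<subseteq> U}"
      unfolding compact_open_topology_def by (intro topology_generated_by_Basis) blast
    ultimately show "openin ?CO {\<xi> \<in> topspace ?CO. \<xi> x \<in> U}" by simp
  qed
  then have "continuous_map ?CO ?P (\<lambda>x. x)"
    by (auto simp: continuous_map_componentwise characters_iff)
  then show "continuous_map ?CO (subtopology ?P ?C) (\<lambda>x. x)"
    by (rule continuous_map_into_subtopology) simp
qed

section \<open>Duals of torsion groups\<close>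

locale torsion_group =
  fixes G :: "'a monoid" (structure)
  assumes TAG: "G \<in> obj TAG"
begin

sublocale comm_group G
  using TAG by (simp add: TAG_def)

lemma torsion: "x \<in> carrier G \<Longrightarrow> \<exists>n::nat. n > 0 \<and> x [^] n = \<one>"
  using TAG by (simp add: TAG_def)

abbreviation "D \<equiv> discrete_group G"
abbreviation "CO \<equiv> compact_open_topology D"
abbreviation "P \<equiv> product_topology (\<lambda>_. circle) (carrier G)"

lemma comm_group_D: "comm_group D"
  by (simp add: comm_group_discrete_group_iff comm_group_axioms)

lemma mem_characters_D:
  "\<xi> \<in> characters D \<longleftrightarrow> \<xi> \<in> extensional (carrier G) \<and> (\<forall>x\<in>carrier G. cmod (\<xi> x) = 1) \<and>
    (\<forall>x\<in>carrier G. \<forall>y\<in>carrier G. \<xi> (x \<otimes> y) = \<xi> x * \<xi> y)"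
  by (simp add: characters_iff)

lemma comm_group_dual_D: "comm_group (dual D)"
  using comm_group_D by (rule comm_group_dual) simp

lemma continuous_eval: "x \<in> carrier G \<Longrightarrow> continuous_map CO circle (\<lambda>\<xi>. \<xi> x)"
  unfolding compact_open_topology_discrete_group
  by (intro continuous_map_from_subtopology continuous_map_product_projection)

lemma continuous_map_into_CO:
  assumes "\<And>t. t \<in> topspace X \<Longrightarrow> f t \<in> characters D"
    and "\<And>x. x \<in> carrier G \<Longrightarrow> continuous_map X euclidean (\<lambda>t. f t x)"
  shows "continuous_map X CO f"
  unfolding compact_open_topology_discrete_group
proof (rule continuous_map_into_subtopology)
  have "continuous_map X circle (\<lambda>t. f t x)" if "x \<in> carrier G" for x
    using assms that by (auto simp: continuous_map_in_subtopology mem_characters_D)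
  then show "continuous_map X P f"
    using assms(1) by (auto simp: continuous_map_componentwise mem_characters_D)
qed (use assms(1) in auto)

text \<open>Multiplicativity is a family of equations between continuous functions on a power of the
  circle. Closedness lets the dual inherit compactness from that power.\<close>

lemma closedin_characters: "closedin P (characters D)"
proof -
  have proj: "continuous_map P euclidean (\<lambda>f. f x)" if "x \<in> carrier G" for x
    using continuous_map_product_projection[OF that, of "\<lambda>_. circle"]
    by (simp add: continuous_map_in_subtopology)
  have "characters D = (\<Inter>(x, y)\<in>carrier G \<times> carrier G. {f \<in> topspace P. f (x \<otimes> y) = f x * f y})"
    (is "_ = ?R")
  proof
    show "characters D \<subseteq> ?R" by (auto simp: mem_characters_D PiE_iff)
    show "?R \<subseteq> characters D"
    proof
      fix f assume f: "f \<in> ?R"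
      then have "f \<in> topspace P" using one_closed by blast
      then show "f \<in> characters D" using f by (auto simp: mem_characters_D PiE_iff)
    qed
  qed
  moreover have "closedin P (\<Inter>(x, y)\<in>carrier G \<times> carrier G. {f \<in> topspace P. f (x \<otimes> y) = f x * f y})"
  proof (rule closedin_INT)
    show "carrier G \<times> carrier G \<noteq> {}" using one_closed by blast
    fix z assume "z \<in> carrier G \<times> carrier G"
    then obtain x y where z: "z = (x, y)" "x \<in> carrier G" "y \<in> carrier G" by blast
    have "closedin P {f \<in> topspace P. f (x \<otimes> y) = f x * f y}"
      using z by (intro closedin_continuous_maps_eq[OF Hausdorff_space_euclidean] proj
          continuous_map_complex_mult m_closed)
    then show "closedin P (case z of (x, y) \<Rightarrow> {f \<in> topspace P. f (x \<otimes> y) = f x * f y})"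
      by (simp only: z prod.case)
  qed
  ultimately show ?thesis by simp
qed

text \<open>Evaluation at a torsion element thus takes finitely many values, which yields both total
  disconnectedness of the dual and openness of the fibres of evaluation.\<close>

lemma power_eq_1:
  assumes "\<xi> \<in> characters D" "x \<in> carrier G" "x [^] (n::nat) = \<one>"
  shows "\<xi> x ^ n = 1"
proof -
  have "\<xi> \<one> = 1" using assms(1) by (auto simp: mem_characters_D) (metis l_one mult_cancel_right1 norm_zero one_closed zero_neq_one)
  moreover from this have "\<xi> (x [^] k) = \<xi> x ^ k" for k :: nat
    using assms(1,2) by (induction k) (auto simp: mem_characters_D)
  ultimately show ?thesis using assms(3) by metis
qed

lemma dual_TdCAG: "dual D \<in> obj TdCAG"
proof -
  interpret dD: comm_group "dual D" by (rule comm_group_dual_D)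
  have eval: "continuous_map CO euclidean (\<lambda>\<xi>. \<xi> x)" if "x \<in> carrier G" for x
    using continuous_eval[OF that] by (simp add: continuous_map_in_subtopology)
  have "continuous_map (prod_topology CO CO) CO (\<lambda>(\<xi>, \<zeta>). \<xi> \<otimes>\<^bsub>dual D\<^esub> \<zeta>)"
  proof (rule continuous_map_into_CO)
    show "(case t of (\<xi>, \<zeta>) \<Rightarrow> \<xi> \<otimes>\<^bsub>dual D\<^esub> \<zeta>) \<in> characters D" if "t \<in> topspace (prod_topology CO CO)" for t
      using that dD.m_closed by auto
    fix x assume x: "x \<in> carrier G"
    have "continuous_map (prod_topology CO CO) euclidean (\<lambda>t. fst t x * snd t x)"
      using continuous_map_compose[OF continuous_map_fst eval[OF x]]
        continuous_map_compose[OF continuous_map_snd eval[OF x]]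
      by (intro continuous_map_complex_mult) (simp_all add: comp_def)
    then show "continuous_map (prod_topology CO CO) euclidean
        (\<lambda>t. (case t of (\<xi>, \<zeta>) \<Rightarrow> \<xi> \<otimes>\<^bsub>dual D\<^esub> \<zeta>) x)"
      using x by (simp add: case_prod_unfold)
  qed
  moreover have "continuous_map CO CO (\<lambda>\<xi>. inv\<^bsub>dual D\<^esub> \<xi>)"
  proof (rule continuous_map_into_CO)
    show "inv\<^bsub>dual D\<^esub> \<xi> \<in> characters D" if "\<xi> \<in> topspace CO" for \<xi>
      using that dD.inv_closed by simp
    fix x assume x: "x \<in> carrier G"
    show "continuous_map CO euclidean (\<lambda>\<xi>. (inv\<^bsub>dual D\<^esub> \<xi>) x)"
      using continuous_map_cnj[OF eval[OF x]]
      by (rule continuous_map_eq) (use x in \<open>simp add: inv_dual[OF comm_group_D]\<close>)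
  qed
  ultimately have "is_top_group (dual D)" by (simp add: is_top_group_def dD.group_axioms)
  moreover have "compact_space circle"
    by (simp add: compact_space_subtopology)
  then have "compact_space P" by (simp add: compact_space_product_topology)
  then have "compact_space CO"
    unfolding compact_open_topology_discrete_group
    using closedin_characters by (intro compact_space_subtopology closedin_compact_space)
  moreover have "Hausdorff_space CO"
    unfolding compact_open_topology_discrete_group
    by (intro Hausdorff_space_subtopology) (simp add: Hausdorff_space_product_topology Hausdorff_space_subtopology)
  moreover have "totally_disconnected_space CO"
    unfolding totally_disconnected_space_def
  proof
    fix \<xi> assume "\<xi> \<in> topspace CO"
    then have \<xi>: "\<xi> \<in> characters D" by simp
    let ?S = "connected_component_of_set CO \<xi>"
    have conn: "connectedin CO ?S" by (rule connectedin_connected_component_of)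
    have sub: "?S \<subseteq> characters D" using connectedin_subset_topspace[OF conn] by simp
    have \<xi>S: "\<xi> \<in> ?S" using \<xi> by (simp add: connected_component_of_refl)
    have "\<zeta> = \<xi>" if \<zeta>: "\<zeta> \<in> ?S" for \<zeta>
    proof (rule extensionalityI[of _ "carrier G"])
      show "\<zeta> \<in> extensional (carrier G)" "\<xi> \<in> extensional (carrier G)"
        using sub \<zeta> \<xi> by (auto simp: mem_characters_D)
      fix x assume x: "x \<in> carrier G"
      obtain n :: nat where n: "n > 0" "x [^] n = \<one>" using torsion[OF x] by blast
      \<comment> \<open>Evaluation maps the component onto a connected subset of a finite set of
        roots of unity, that is, onto a point.\<close>
      have "connected ((\<lambda>\<xi>. \<xi> x) ` ?S)"
        using connectedin_continuous_map_image[OF eval[OF x] conn] by simp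
      moreover have "(\<lambda>\<xi>. \<xi> x) ` ?S \<subseteq> {z. z ^ n = 1}" using power_eq_1[OF _ x n(2)] sub by blast
      moreover have "finite {z::complex. z ^ n = 1}" using finite_roots_unity[of n] n(1) by simp
      ultimately have "(\<lambda>\<xi>. \<xi> x) ` ?S = {} \<or> (\<exists>c. (\<lambda>\<xi>. \<xi> x) ` ?S = {c})"
        using connected_finite_iff_sing finite_subset by metis
      then obtain c where "(\<lambda>\<xi>. \<xi> x) ` ?S = {c}" using \<xi>S by blast
      moreover have "\<zeta> x \<in> (\<lambda>\<xi>. \<xi> x) ` ?S" by (rule rev_image_eqI[OF \<zeta> refl])
      moreover have "\<xi> x \<in> (\<lambda>\<xi>. \<xi> x) ` ?S" by (rule rev_image_eqI[OF \<xi>S refl])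
      ultimately show "\<zeta> x = \<xi> x" by (metis singletonD)
    qed
    then show "?S = {\<xi>}" using \<xi>S by blast
  qed
  ultimately show ?thesis by (simp add: TdCAG_def comm_group_dual_D)
qed

text \<open>Local finiteness of torsion abelian groups: a product of finitely many finite cyclic
  subgroups is a finite subgroup.\<close>

lemma finite_subset_finite_subgroup:
  assumes "finite C" "C \<subseteq> carrier G"
  obtains F where "subgroup F G" "finite F" "C \<subseteq> F"
  using assms
proof (induction C arbitrary: thesis rule: finite_induct)
  case empty
  show ?case by (rule empty(1)[of "{\<one>}"]) (auto simp: triv_subgroup)
next
  case (insert x C)
  obtain F where F: "subgroup F G" "finite F" "C \<subseteq> F" using insert by auto
  have x: "x \<in> carrier G" using insert by simp
  obtain n :: nat where n: "n > 0" "x [^] n = \<one>" using torsion[OF x] by blast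
  define Z where "Z = (\<lambda>k::nat. x [^] k) ` {..<n}"
  have pow_mod: "x [^] k \<in> Z" for k :: nat
  proof -
    have "x [^] k = (x [^] n) [^] (k div n) \<otimes> x [^] (k mod n)"
      using x by (simp add: nat_pow_pow nat_pow_mult)
    then have "x [^] k = x [^] (k mod n)" using x n(2) by simp
    then show ?thesis using n(1) by (auto simp: Z_def)
  qed
  have "subgroup Z G"
  proof (rule subgroupI)
    show "Z \<subseteq> carrier G" "Z \<noteq> {}" using x n by (auto simp: Z_def)
    show "a \<otimes> b \<in> Z" if ab: "a \<in> Z" "b \<in> Z" for a b
    proof -
      obtain i j :: nat where "a = x [^] i" "b = x [^] j" using ab by (auto simp: Z_def)
      then show ?thesis using pow_mod[of "i + j"] x by (simp add: nat_pow_mult)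
    qed
    show "inv a \<in> Z" if a: "a \<in> Z" for a
    proof -
      obtain i where i: "a = x [^] i" "i < n" using a by (auto simp: Z_def)
      then have "x [^] (n - i) \<otimes> a = \<one>" using x n by (simp add: nat_pow_mult)
      then have "inv a = x [^] (n - i)" using x i by (intro inv_equality) auto
      then show ?thesis using pow_mod by simp
    qed
  qed
  then have H: "subgroup (F <#> Z) G" using F(1) mult_subgroups by blast
  have one: "\<one> \<in> F" "\<one> \<in> Z" using F(1) \<open>subgroup Z G\<close> subgroup.one_closed by auto
  have xZ: "x \<in> Z" using pow_mod[of 1] x by simp
  show ?case
  proof (rule insert.prems(1)[OF H])
    show "finite (F <#> Z)" using F(2) by (simp add: set_mult_def Z_def)
    have "\<one> \<otimes> x \<in> F <#> Z" using one xZ unfolding set_mult_def by blast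
    moreover have "c \<in> F <#> Z" if "c \<in> C" for c
    proof -
      have "c \<otimes> \<one> \<in> F <#> Z" using one that F(3) unfolding set_mult_def by blast
      moreover have "c \<in> carrier G" using insert.prems(2) that by blast
      ultimately show ?thesis by simp
    qed
    ultimately show "insert x C \<subseteq> F <#> Z" using x by auto
  qed
qed

text \<open>A basic neighbourhood of the trivial character constrains only finitely many coordinates
  \<open>C\<close>; a character trivial on a finite subgroup containing \<open>C\<close> agrees with
  the trivial one there.\<close>

lemma open_subgroup_contains_annihilator:
  assumes V: "openin CO V" "\<one>\<^bsub>dual D\<^esub> \<in> V"
  obtains F where "subgroup F G" "finite F" "{\<xi> \<in> characters D. \<forall>x\<in>F. \<xi> x = 1} \<subseteq> V"
proof -
  obtain T where T: "openin P T" "V = T \<inter> characters D"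
    using V(1) unfolding compact_open_topology_discrete_group openin_subtopology by blast
  let ?e = "\<one>\<^bsub>dual D\<^esub>"
  have "?e \<in> T" using V(2) T by blast
  then obtain X where X: "?e \<in> (\<Pi>\<^sub>E i\<in>carrier G. X i)" "finite {i. X i \<noteq> topspace circle}"
      "(\<Pi>\<^sub>E i\<in>carrier G. X i) \<subseteq> T"
    using product_topology_open_contains_basis[OF T(1)] by blast
  define C where "C = {i \<in> carrier G. X i \<noteq> topspace circle}"
  have "finite C" "C \<subseteq> carrier G" using X(2) by (auto simp: C_def)
  then obtain F where F: "subgroup F G" "finite F" "C \<subseteq> F" by (rule finite_subset_finite_subgroup)
  have "\<xi> \<in> V" if \<xi>: "\<xi> \<in> characters D" "\<forall>x\<in>F. \<xi> x = 1" for \<xi>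
  proof -
    have "\<xi> i \<in> X i" if i: "i \<in> carrier G" for i
    proof (cases "i \<in> C")
      case True
      then have "\<xi> i = ?e i" using F(3) \<xi>(2) i by auto
      then show ?thesis using X(1) i by (metis PiE_mem)
    next
      case False
      then show ?thesis using i \<xi>(1) by (auto simp: C_def mem_characters_D)
    qed
    then have "\<xi> \<in> (\<Pi>\<^sub>E i\<in>carrier G. X i)" using \<xi>(1) by (auto simp: PiE_iff mem_characters_D)
    then show ?thesis using X(3) T(2) \<xi>(1) by blast
  qed
  then show thesis using that F by blast
qed

sublocale duality G "dual D" "\<lambda>x \<xi>. \<xi> x"
proof -
  interpret dD: td_compact_group "dual D" using dual_TdCAG by unfold_locales
  interpret pairing G "dual D" "\<lambda>x \<xi>. \<xi> x"
    by unfold_locales (auto simp: mem_characters_D)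
  show "duality G (dual D) (\<lambda>x \<xi>. \<xi> x)"
  proof unfold_locales
    fix a assume a: "a \<in> carrier G" "\<And>\<xi>. \<xi> \<in> carrier (dual D) \<Longrightarrow> \<xi> a = 1"
    show "a = \<one>"
    proof (rule ccontr)
      assume "a \<noteq> \<one>"
      interpret torsion_modulo G "{\<one>}"
        using torsion
        by (intro torsion_modulo.intro torsion_modulo_axioms.intro comm_group_axioms triv_subgroup) simp
      obtain \<xi> where \<xi>: "\<xi> \<in> hom G circle_group" "\<xi> \<in> extensional (carrier G)" "\<xi> a \<noteq> 1"
        using ex_separating_character[OF a(1)] \<open>a \<noteq> \<one>\<close> by blast
      then have "\<xi> \<in> characters D" by (auto simp: mem_characters_D hom_def circle_group_def)
      then show False using a(2) \<xi>(3) by simp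
    qed
  next
    fix a and c :: complex assume a: "a \<in> carrier G"
    obtain n :: nat where n: "n > 0" "a [^] n = \<one>" using torsion[OF a] by blast
    \<comment> \<open>The values at \<open>a\<close> are \<open>n\<close>-th roots of unity;
      removing those other than \<open>c\<close> leaves an open set that detects the value
      \<open>c\<close>.\<close>
    define U where "U = sphere 0 1 \<inter> - ({z. z ^ n = 1} - {c})"
    have "finite ({z::complex. z ^ n = 1} - {c})" using finite_roots_unity[of n] n(1) by simp
    then have "open (- ({z. z ^ n = 1} - {c}))" by (intro open_Compl finite_imp_closed)
    then have "openin circle U" unfolding U_def by (rule openin_open_Int)
    then have "openin CO {\<xi> \<in> topspace CO. \<xi> a \<in> U}"
      by (rule openin_continuous_map_preimage[OF continuous_eval[OF a]])
    moreover have "\<xi> a \<in> U \<longleftrightarrow> \<xi> a = c" if "\<xi> \<in> characters D" for \<xi>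
      using power_eq_1[OF that a n(2)] that a by (auto simp: U_def mem_characters_D)
    then have "{\<xi> \<in> topspace CO. \<xi> a \<in> U} = {\<xi> \<in> carrier (dual D). \<xi> a = c}" by auto
    ultimately show "openin (topo (dual D)) {\<xi> \<in> carrier (dual D). \<xi> a = c}" by simp
  next
    fix V assume V: "subgroup V (dual D)" "openin (topo (dual D)) V"
    have "openin CO V" using V(2) by simp
    then obtain F where F: "subgroup F G" "finite F" "{\<xi> \<in> characters D. \<forall>x\<in>F. \<xi> x = 1} \<subseteq> V"
      using subgroup.one_closed[OF V(1)] by (rule open_subgroup_contains_annihilator)
    then have "annih F \<subseteq> V" by (simp add: annih_def)
    then show "\<exists>F. subgroup F G \<and> finite F \<and> annih F \<subseteq> V" using F(1,2) by blast
  qed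
qed

end

section \<open>Functoriality and the bridge theorems\<close>

context td_compact_group
begin

abbreviation "character_group \<equiv> monoid.truncate (dual K)"

lemma comm_group_character_group: "comm_group character_group"
  unfolding comm_group_truncate_iff by (rule comm_group_dual[OF comm_group_axioms topspace_eq])

lemma mem_characters:
  "\<xi> \<in> characters K \<longleftrightarrow> \<xi> \<in> extensional (carrier K) \<and> (\<forall>x\<in>carrier K. cmod (\<xi> x) = 1) \<and>
    (\<forall>x\<in>carrier K. \<forall>y\<in>carrier K. \<xi> (x \<otimes> y) = \<xi> x * \<xi> y) \<and> continuous_map (topo K) euclidean \<xi>"
  by (rule characters_iff[OF topspace_eq])

lemma pairing_character_group: "pairing character_group K (\<lambda>\<xi> x. \<xi> x)"
proof -
  interpret D: comm_group character_group by (rule comm_group_character_group)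
  show ?thesis by unfold_locales (auto simp: mem_characters)
qed

text \<open>Such a character is determined by its values on the finitely many coset representatives
  \<open>R\<close>, and its value at \<open>x\<close> is a root of unity, of order dividing an
  exponent that takes \<open>x\<close> into \<open>V\<close>.\<close>

lemma finite_characters_trivial_on:
  assumes V: "subgroup V K" "openin (topo K) V"
  shows "finite {\<xi> \<in> characters K. \<forall>v\<in>V. \<xi> v = 1}" (is "finite ?F")
proof -
  interpret pairing character_group K "\<lambda>\<xi> x. \<xi> x" by (rule pairing_character_group)
  define R where "R = (\<lambda>C. SOME x. x \<in> C) ` (rcosets V)"
  have R: "R \<subseteq> carrier K"
  proof
    fix r assume "r \<in> R"
    then obtain C where C: "C \<in> rcosets V" "r = (SOME x. x \<in> C)" by (auto simp: R_def)
    then have "r \<in> C" using subgroup.rcosets_non_empty[OF V(1)] by (metis some_in_eq)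
    then show "r \<in> carrier K" using C(1) rcosets_part_G[OF V(1)] by blast
  qed
  have "\<forall>x\<in>carrier K. \<exists>n::nat. n > 0 \<and> x [^] n \<in> V"
    using pow_mem_open_subgroup[OF V] by metis
  then obtain n :: "'a \<Rightarrow> nat" where n: "\<And>x. x \<in> carrier K \<Longrightarrow> n x > 0 \<and> x [^] n x \<in> V" by metis
  have "\<xi> x ^ n x = 1" if "\<xi> \<in> ?F" "x \<in> carrier K" for \<xi> x
  proof -
    have "\<xi> \<one> = 1" using one_right[of \<xi>] that(1) by simp
    then have "\<xi> (x [^] k) = \<xi> x ^ k" for k :: nat
      using that by (induction k) (auto simp: mem_characters)
    then show ?thesis using n[OF that(2)] that(1) by (metis (mono_tags, lifting) mem_Collect_eq)
  qed
  then have "(\<lambda>\<xi>. restrict \<xi> R) ` ?F \<subseteq> (\<Pi>\<^sub>E x\<in>R. {z. z ^ n x = 1})" using R by auto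
  moreover have "finite (\<Pi>\<^sub>E x\<in>R. {z::complex. z ^ n x = 1})"
  proof (rule finite_PiE)
    show "finite R" using finite_rcosets[OF V] by (simp add: R_def)
    show "finite {z::complex. z ^ n x = 1}" if "x \<in> R" for x
      using n[of x] R that finite_roots_unity[of "n x"] by auto
  qed
  ultimately have "finite ((\<lambda>\<xi>. restrict \<xi> R) ` ?F)" by (rule finite_subset)
  moreover have "inj_on (\<lambda>\<xi>. restrict \<xi> R) ?F"
  proof (rule inj_onI)
    fix \<xi> \<zeta> assume \<xi>: "\<xi> \<in> ?F" and \<zeta>: "\<zeta> \<in> ?F" and eq: "restrict \<xi> R = restrict \<zeta> R"
    show "\<xi> = \<zeta>"
    proof (rule extensionalityI[of _ "carrier K"])
      show "\<xi> \<in> extensional (carrier K)" "\<zeta> \<in> extensional (carrier K)"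
        using \<xi> \<zeta> by (auto simp: mem_characters)
      fix x assume x: "x \<in> carrier K"
      define r where "r = (SOME y. y \<in> V #> x)"
      have "x \<in> V #> x" using rcos_self x V(1) by blast
      then have r: "r \<in> V #> x" unfolding r_def by (rule someI)
      then obtain v where v: "v \<in> V" "r = v \<otimes> x" by (auto simp: r_coset_def)
      have vc: "v \<in> carrier K" using v(1) subgroup.mem_carrier[OF V(1)] by blast
      have "r \<in> R" unfolding R_def r_def using x by (auto simp: RCOSETS_def)
      then have "\<xi> r = \<zeta> r" using eq by (metis restrict_apply')
      moreover have "\<xi> r = \<xi> x" using \<xi> v vc x by (auto simp: mem_characters)
      moreover have "\<zeta> r = \<zeta> x" using \<zeta> v vc x by (auto simp: mem_characters)
      ultimately show "\<xi> x = \<zeta> x" by simp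
    qed
  qed
  ultimately show ?thesis by (rule finite_imageD)
qed

lemma duality_character_group: "duality character_group K (\<lambda>\<xi> x. \<xi> x)"
proof -
  interpret pairing character_group K "\<lambda>\<xi> x. \<xi> x" by (rule pairing_character_group)
  show ?thesis
  proof unfold_locales
    fix \<xi> assume "\<xi> \<in> carrier character_group" "\<And>x. x \<in> carrier K \<Longrightarrow> \<xi> x = 1"
    then show "\<xi> = \<one>\<^bsub>character_group\<^esub>"
      by (auto simp: fun_eq_iff mem_characters extensional_def)
  next
    fix \<xi> and c :: complex assume "\<xi> \<in> carrier character_group"
    then show "openin (topo K) {x \<in> carrier K. \<xi> x = c}" by (simp add: openin_character_fibre)
  next
    fix V assume V: "subgroup V K" "openin (topo K) V"
    interpret torsion_modulo K V
    proof (intro torsion_modulo.intro torsion_modulo_axioms.intro comm_group_axioms V(1))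
      fix x assume x: "x \<in> carrier K"
      show "\<exists>n>0::nat. x [^] n \<in> V" by (rule pow_mem_open_subgroup[OF V x]) blast
    qed
    \<comment> \<open>The witness for \<open>annih_small\<close> is \<open>coannih V\<close>: a
      point outside \<open>V\<close> is detected by a character trivial on \<open>V\<close>, and
      such a character is continuous because \<open>V\<close> is open.\<close>
    have "annih (coannih V) \<subseteq> V"
    proof
      fix x assume x: "x \<in> annih (coannih V)"
      show "x \<in> V"
      proof (rule ccontr)
        assume "x \<notin> V"
        moreover have "x \<in> carrier K" using x by (simp add: annih_def)
        ultimately obtain \<xi> where \<xi>: "\<xi> \<in> hom K circle_group" "\<xi> \<in> extensional (carrier K)"
            "\<And>v. v \<in> V \<Longrightarrow> \<xi> v = 1" "\<xi> x \<noteq> 1"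
          using ex_separating_character by metis
        then have "\<xi> \<in> characters K" using hom_trivial_on_open_subgroup_continuous[OF V] by blast
        then show False using x \<xi>(3,4) by (auto simp: annih_def coannih_def)
      qed
    qed
    moreover have "subgroup (coannih V) character_group"
      using subgroup_coannih[OF subgroup.subset[OF V(1)]] .
    moreover have "finite (coannih V)"
      using finite_characters_trivial_on[OF V] by (simp add: coannih_def)
    ultimately show "\<exists>F. subgroup F character_group \<and> finite F \<and> annih F \<subseteq> V" by blast
  qed
qed

text \<open>Each character is trivial on some open \<open>V\<close>, hence lies in the finite group
  \<open>coannih V\<close>, and Lagrange bounds its order.\<close>

lemma character_group_TAG: "character_group \<in> obj TAG"
proof -
  interpret pairing character_group K "\<lambda>\<xi> x. \<xi> x" by (rule pairing_character_group)
  have "\<exists>n>0::nat. \<xi> [^]\<^bsub>character_group\<^esub> n = \<one>\<^bsub>character_group\<^esub>"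
    if \<xi>: "\<xi> \<in> carrier character_group" for \<xi>
  proof -
    obtain V where V: "subgroup V K" "openin (topo K) V" "\<And>v. v \<in> V \<Longrightarrow> \<xi> v = 1"
      using character_trivial_on_open_subgroup[of \<xi>] \<xi> by auto
    have fin: "finite (coannih V)"
      using finite_characters_trivial_on[OF V(1,2)] by (simp add: coannih_def)
    have sub: "subgroup (coannih V) character_group"
      using subgroup_coannih[OF subgroup.subset[OF V(1)]] .
    have mem: "\<xi> \<in> coannih V" using \<xi> V(3) by (simp add: coannih_def)
    then have "card (coannih V) > 0" using fin by (auto simp: card_gt_0_iff)
    then show ?thesis using A.finite_subgroup_pow_card[OF sub fin mem] by blast
  qed
  then show ?thesis using comm_group_character_group by (simp add: TAG_def)
qed

end

section \<open>Pontryagin duality as a functor in both directions\<close>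

lemma mor_TAG: "f \<in> mor TAG G H \<longleftrightarrow> f \<in> hom G H \<and> f \<in> extensional (carrier G)"
  by (simp add: TAG_def)

lemma mor_TdCAG: "f \<in> mor TdCAG K L \<longleftrightarrow>
    f \<in> hom K L \<and> f \<in> extensional (carrier K) \<and> continuous_map (topo K) (topo L) f"
  by (simp add: TdCAG_def)

lemma op_cat_simps [simp]:
  "obj (op_cat C) = obj C" "mor (op_cat C) X Y = mor C Y X" "ident (op_cat C) = ident C"
  "cmp (op_cat C) X Y Z g f = cmp C Z Y X f g"
  by (simp_all add: op_cat_def)

lemma hom_truncate: "hom (monoid.truncate G) (monoid.truncate H) = hom G H"
  by (simp add: hom_def monoid.truncate_def)

lemma dual_map_mor_TdCAG:
  assumes G: "G \<in> obj TAG" and H: "H \<in> obj TAG" and f: "f \<in> mor TAG G H"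
  shows "dual_map (discrete_group G) (discrete_group H) f \<in>
    mor TdCAG (dual (discrete_group H)) (dual (discrete_group G))"
proof -
  interpret G: torsion_group G by unfold_locales fact
  interpret H: torsion_group H by unfold_locales fact
  have f': "f \<in> hom (discrete_group G) (discrete_group H)"
    and cont: "continuous_map (topo (discrete_group G)) (topo (discrete_group H)) f"
    using f by (auto simp: mor_TAG hom_def)
  have hom: "dual_map (discrete_group G) (discrete_group H) f \<in>
      hom (dual (discrete_group H)) (dual (discrete_group G))"
    by (rule dual_map_hom[OF _ _ G.comm_group_D H.comm_group_D f' cont]) simp_all
  moreover have "continuous_map (compact_open_topology (discrete_group H))
      (compact_open_topology (discrete_group G)) (dual_map (discrete_group G) (discrete_group H) f)"
  proof (rule G.continuous_map_into_CO)
    show "dual_map (discrete_group G) (discrete_group H) f \<xi> \<in> characters (discrete_group G)"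
      if "\<xi> \<in> topspace (compact_open_topology (discrete_group H))" for \<xi>
      using hom_in_carrier[OF hom, of \<xi>] that by simp
    fix x assume x: "x \<in> carrier G"
    then have "f x \<in> carrier H" using f by (auto simp: mor_TAG hom_def)
    then have "continuous_map (compact_open_topology (discrete_group H)) euclidean (\<lambda>\<xi>. \<xi> (f x))"
      using H.continuous_eval by (simp add: continuous_map_in_subtopology)
    then show "continuous_map (compact_open_topology (discrete_group H)) euclidean
        (\<lambda>\<xi>. dual_map (discrete_group G) (discrete_group H) f \<xi> x)"
      by (rule continuous_map_eq) (use x in \<open>simp add: dual_map_apply\<close>)
  qed
  ultimately show ?thesis by (simp add: mor_TdCAG dual_map_extensional)
qed

lemma is_functor_dual_TAG: "is_functor TAG (op_cat TdCAG) dual_TAG"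
  unfolding is_functor_def
proof (intro conjI ballI)
  fix G :: "'a monoid" assume G: "G \<in> obj TAG"
  interpret torsion_group G by unfold_locales fact
  show "fobj dual_TAG G \<in> obj (op_cat TdCAG)" by (simp add: dual_TAG_def dual_TdCAG)
  show "farr dual_TAG G G (ident TAG G) = ident (op_cat TdCAG) (fobj dual_TAG G)"
    using dual_map_ident[of "discrete_group G"] by (simp add: dual_TAG_def TAG_def TdCAG_def)
next
  fix G H :: "'a monoid" and f assume "G \<in> obj TAG" "H \<in> obj TAG" "f \<in> mor TAG G H"
  then show "farr dual_TAG G H f \<in> mor (op_cat TdCAG) (fobj dual_TAG G) (fobj dual_TAG H)"
    using dual_map_mor_TdCAG by (simp add: dual_TAG_def)
next
  fix G H L :: "'a monoid" and f g
  assume G: "G \<in> obj TAG" "H \<in> obj TAG" "L \<in> obj TAG" and f: "f \<in> mor TAG G H" and g: "g \<in> mor TAG H L"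
  have "dual_map (discrete_group G) (discrete_group L) (compose (carrier (discrete_group G)) g f) =
      compose (characters (discrete_group L)) (dual_map (discrete_group G) (discrete_group H) f)
        (dual_map (discrete_group H) (discrete_group L) g)"
  proof (rule dual_map_compose)
    show "f \<in> carrier (discrete_group G) \<rightarrow> carrier (discrete_group H)"
      using f by (auto simp: mor_TAG hom_def)
    show "compose (carrier (discrete_group H)) \<xi> g \<in> characters (discrete_group H)"
      if "\<xi> \<in> characters (discrete_group L)" for \<xi>
      using dual_map_mor_TdCAG[OF G(2,3) g] that
      by (auto simp: mor_TdCAG dual_map_def dest!: hom_in_carrier[of _ _ _ \<xi>])
  qed
  then show "farr dual_TAG G L (cmp TAG G H L g f) =
      cmp (op_cat TdCAG) (fobj dual_TAG G) (fobj dual_TAG H) (fobj dual_TAG L)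
        (farr dual_TAG H L g) (farr dual_TAG G H f)"
    by (simp add: dual_TAG_def TAG_def TdCAG_def)
qed

lemma dual_map_mor_TAG:
  assumes K: "K \<in> obj TdCAG" and L: "L \<in> obj TdCAG" and f: "f \<in> mor TdCAG K L"
  shows "dual_map K L f \<in> mor TAG (monoid.truncate (dual L)) (monoid.truncate (dual K))"
proof -
  interpret K: td_compact_group K by unfold_locales fact
  interpret L: td_compact_group L by unfold_locales fact
  have "dual_map K L f \<in> hom (dual L) (dual K)"
    using f by (intro dual_map_hom K.comm_group_axioms L.comm_group_axioms) (auto simp: mor_TdCAG)
  then show ?thesis by (simp add: mor_TAG hom_truncate dual_map_extensional)
qed

lemma is_functor_dual_TdCAG: "is_functor (op_cat TdCAG) TAG dual_TdCAG"
  unfolding is_functor_def op_cat_simps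
proof (intro conjI ballI)
  fix K :: "'b top_group" assume K: "K \<in> obj TdCAG"
  interpret td_compact_group K by unfold_locales fact
  show "fobj dual_TdCAG K \<in> obj TAG" by (simp add: dual_TdCAG_def character_group_TAG)
  show "farr dual_TdCAG K K (ident TdCAG K) = ident TAG (fobj dual_TdCAG K)"
    using dual_map_ident[of K] by (simp add: dual_TdCAG_def TAG_def TdCAG_def)
next
  fix L K :: "'b top_group" and f assume "L \<in> obj TdCAG" "K \<in> obj TdCAG" "f \<in> mor TdCAG K L"
  then show "farr dual_TdCAG L K f \<in> mor TAG (fobj dual_TdCAG L) (fobj dual_TdCAG K)"
    using dual_map_mor_TAG by (simp add: dual_TdCAG_def)
next
  fix M L K :: "'b top_group" and g f
  assume K: "M \<in> obj TdCAG" "L \<in> obj TdCAG" "K \<in> obj TdCAG" and g: "g \<in> mor TdCAG L M" and f: "f \<in> mor TdCAG K L"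
  have "dual_map K M (compose (carrier K) g f) =
      compose (characters M) (dual_map K L f) (dual_map L M g)"
  proof (rule dual_map_compose)
    show "f \<in> carrier K \<rightarrow> carrier L" using f by (auto simp: mor_TdCAG hom_def)
    show "compose (carrier L) \<xi> g \<in> characters L" if "\<xi> \<in> characters M" for \<xi>
      using dual_map_mor_TAG[OF K(2,1) g] that
      by (auto simp: mor_TAG dual_map_def dest!: hom_in_carrier[of _ _ _ \<xi>])
  qed
  then show "farr dual_TdCAG M K (cmp TdCAG K L M g f) =
      cmp TAG (fobj dual_TdCAG M) (fobj dual_TdCAG L) (fobj dual_TdCAG K)
        (farr dual_TdCAG L K f) (farr dual_TdCAG M L g)"
    by (simp add: dual_TdCAG_def TAG_def TdCAG_def)
qed

section \<open>The functors of finite subgroups and of open subgroups\<close>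

lemma carrier_sub_semigroup [simp]: "carrier (sub_semigroup G) = {F. subgroup F G \<and> finite F}"
  by (simp add: sub_semigroup_def)

lemma carrier_sub_o_semigroup [simp]:
  "carrier (sub_o_semigroup K) = {V. V \<lhd> K \<and> openin (topo K) V}"
  by (simp add: sub_o_semigroup_def)

lemma normed_semigroup_sub:
  fixes G :: "'a monoid" (structure)
  assumes "comm_group G"
  shows "is_normed_semigroup (sub_semigroup G)"
proof -
  interpret comm_group G by fact
  have "0 \<le> ln (real (card F))" if "subgroup F G" "finite F" for F
    using that subgroup.one_closed[OF that(1)]
    by (metis One_nat_def Suc_leI card_gt_0_iff empty_iff ln_ge_zero of_nat_1 of_nat_le_iff)
  moreover have "subgroup (F <#> F') G \<and> finite (F <#> F')"
    if "subgroup F G" "finite F" "subgroup F' G" "finite F'" for F F'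
    using that mult_subgroups by (simp add: set_mult_def)
  moreover have "(F <#> F') <#> F'' = F <#> (F' <#> F'')"
    if "subgroup F G" "subgroup F' G" "subgroup F'' G" for F F' F''
    using that by (intro set_mult_assoc subgroup.subset)
  ultimately show ?thesis by (simp add: is_normed_semigroup_def sub_semigroup_def)
qed

lemma is_functor_sub: "is_functor TAG NSem sub_functor"
  unfolding is_functor_def
proof (intro conjI ballI)
  fix G :: "'a monoid" assume "G \<in> obj TAG"
  then have "comm_group G" by (simp add: TAG_def)
  then show "fobj sub_functor G \<in> obj NSem"
    by (simp add: sub_functor_def NSem_def normed_semigroup_sub)
  have "(\<lambda>x\<in>carrier G. x) ` F = F" if "subgroup F G" for F
    using subgroup.subset[OF that] by auto
  then show "farr sub_functor G G (ident TAG G) = ident NSem (fobj sub_functor G)"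
    by (auto simp: sub_functor_def TAG_def NSem_def fun_eq_iff)
next
  fix G H :: "'a monoid" and f assume GH: "G \<in> obj TAG" "H \<in> obj TAG" and f: "f \<in> mor TAG G H"
  interpret G: comm_group G using GH by (simp add: TAG_def)
  interpret H: comm_group H using GH by (simp add: TAG_def)
  interpret f: group_hom G H f using f by unfold_locales (simp add: mor_TAG)
  define s where "s = (\<lambda>F\<in>carrier (sub_semigroup G). f ` F)"
  have "s \<in> carrier (sub_semigroup G) \<rightarrow>\<^sub>E carrier (sub_semigroup H)"
    using f.subgroup_img_is_subgroup by (auto simp: s_def)
  moreover have "s (sgmult (sub_semigroup G) F F') = sgmult (sub_semigroup H) (s F) (s F')"
    if "F \<in> carrier (sub_semigroup G)" "F' \<in> carrier (sub_semigroup G)" for F F'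
  proof -
    have "sgmult (sub_semigroup G) F F' \<in> carrier (sub_semigroup G)"
      using normed_semigroup_sub[OF G.comm_group_axioms] that by (simp add: is_normed_semigroup_def)
    moreover have "f ` (F <#>\<^bsub>G\<^esub> F') = (f ` F) <#>\<^bsub>H\<^esub> (f ` F')"
      using that f.homh by (intro set_mult_hom) (auto dest: subgroup.subset)
    ultimately show ?thesis using that by (simp add: s_def sub_semigroup_def)
  qed
  moreover have "sgnorm (sub_semigroup H) (s F) \<le> sgnorm (sub_semigroup G) F"
    if "F \<in> carrier (sub_semigroup G)" for F
  proof -
    have F: "subgroup F G" "finite F" using that by auto
    then have "F \<noteq> {}" using subgroup.one_closed by blast
    then have "card (f ` F) > 0" using F(2) by (simp add: card_gt_0_iff)
    then show ?thesis using that F card_image_le[OF F(2), of f] by (simp add: s_def sub_semigroup_def)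
  qed
  ultimately have "s \<in> mor NSem (sub_semigroup G) (sub_semigroup H)"
    by (simp add: NSem_def semigroup_hom_def)
  then show "farr sub_functor G H f \<in> mor NSem (fobj sub_functor G) (fobj sub_functor H)"
    by (simp add: sub_functor_def s_def)
next
  fix G H L :: "'a monoid" and f g
  assume GH: "G \<in> obj TAG" "H \<in> obj TAG" "L \<in> obj TAG" and f: "f \<in> mor TAG G H" and g: "g \<in> mor TAG H L"
  interpret G: comm_group G using GH by (simp add: TAG_def)
  interpret H: comm_group H using GH by (simp add: TAG_def)
  interpret f: group_hom G H f using f by unfold_locales (simp add: mor_TAG)
  have "compose (carrier G) g f ` F = g ` f ` F" if "subgroup F G" for F
    using subgroup.subset[OF that] by (auto simp: compose_def image_iff subset_iff)
  then show "farr sub_functor G L (cmp TAG G H L g f) =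
      cmp NSem (fobj sub_functor G) (fobj sub_functor H) (fobj sub_functor L)
        (farr sub_functor H L g) (farr sub_functor G H f)"
    using f.subgroup_img_is_subgroup
    by (auto simp: sub_functor_def TAG_def NSem_def compose_def fun_eq_iff)
qed

context td_compact_group
begin

lemma card_rcosets_pos: "subgroup V K \<Longrightarrow> openin (topo K) V \<Longrightarrow> card (rcosets V) > 0"
  using finite_rcosets[of V] subgroup.subgroup_in_rcosets[OF _ group_axioms]
  by (auto simp: card_gt_0_iff)

lemma normed_semigroup_sub_o: "is_normed_semigroup (sub_o_semigroup K)"
proof -
  have "0 \<le> ln (real (card (rcosets V)))" if "V \<lhd> K" "openin (topo K) V" for V
    using card_rcosets_pos[of V] that by (simp add: normal_imp_subgroup Suc_leI)
  moreover have "V \<inter> V' \<lhd> K" if "V \<lhd> K" "V' \<lhd> K" for V V'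
    using that by (rule normal_subgroup_intersect)
  ultimately show ?thesis by (auto simp: is_normed_semigroup_def sub_o_semigroup_def)
qed

end

text \<open>\<open>f\<close> induces an injection from the cosets of the preimage into those of
  \<open>V\<close>. This is what makes the maps of \<open>sub_o_functor\<close> contractive.\<close>

lemma card_rcosets_vimage_le:
  assumes "group_hom G H f" "subgroup V H" "finite (rcosets\<^bsub>H\<^esub> V)"
  shows "card (rcosets\<^bsub>G\<^esub> (f -` V \<inter> carrier G)) \<le> card (rcosets\<^bsub>H\<^esub> V)"
proof -
  interpret f: group_hom G H f by fact
  define W where "W = f -` V \<inter> carrier G"
  have W: "subgroup W G"
    using subgroup.m_closed[OF assms(2)] subgroup.m_inv_closed[OF assms(2)] subgroup.one_closed[OF assms(2)]
    by unfold_locales (auto simp: W_def)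
  have "W #>\<^bsub>G\<^esub> x = W #>\<^bsub>G\<^esub> y \<longleftrightarrow> V #>\<^bsub>H\<^esub> f x = V #>\<^bsub>H\<^esub> f y"
    if "x \<in> carrier G" "y \<in> carrier G" for x y
    using that W assms(2) by (simp add: f.G.rcoset_eq_iff f.H.rcoset_eq_iff) (simp add: W_def)
  then have "card ((\<lambda>x. W #>\<^bsub>G\<^esub> x) ` carrier G) = card ((\<lambda>x. V #>\<^bsub>H\<^esub> f x) ` carrier G)"
    by (rule card_image_eq_if_same_fibres)
  also have "\<dots> \<le> card (rcosets\<^bsub>H\<^esub> V)"
    using assms(3) subgroup.subset[OF assms(2)] by (intro card_mono) (auto intro!: f.H.rcosetsI)
  finally show ?thesis by (simp add: W_def RCOSETS_def UNION_singleton_eq_range)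
qed

lemma is_functor_sub_o: "is_functor (op_cat TdCAG) NSem sub_o_functor"
  unfolding is_functor_def op_cat_simps
proof (intro conjI ballI)
  fix K :: "'b top_group" assume K: "K \<in> obj TdCAG"
  interpret td_compact_group K by unfold_locales fact
  show "fobj sub_o_functor K \<in> obj NSem"
    by (simp add: sub_o_functor_def NSem_def normed_semigroup_sub_o)
  have "(\<lambda>x\<in>carrier K. x) -` V \<inter> carrier K = V" if "V \<lhd> K" for V
    using subgroup.subset[OF normal_imp_subgroup[OF that]] by auto
  then show "farr sub_o_functor K K (ident TdCAG K) = ident NSem (fobj sub_o_functor K)"
    by (auto simp: sub_o_functor_def TdCAG_def NSem_def fun_eq_iff)
next
  fix L K :: "'b top_group" and f assume LK: "L \<in> obj TdCAG" "K \<in> obj TdCAG" and f: "f \<in> mor TdCAG K L"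
  interpret L: td_compact_group L by unfold_locales fact
  interpret K: td_compact_group K by unfold_locales fact
  interpret f: group_hom K L f using f by unfold_locales (simp add: mor_TdCAG)
  define s where "s = (\<lambda>V\<in>carrier (sub_o_semigroup L). f -` V \<inter> carrier K)"
  have sub: "subgroup (f -` V \<inter> carrier K) K" if V: "subgroup V L" for V
    using subgroup.m_closed[OF V] subgroup.m_inv_closed[OF V] subgroup.one_closed[OF V]
    by unfold_locales auto
  have op: "openin (topo K) (f -` V \<inter> carrier K)" if "openin (topo L) V" for V
    using f that by (auto simp: mor_TdCAG continuous_map_alt)
  have "s \<in> carrier (sub_o_semigroup L) \<rightarrow>\<^sub>E carrier (sub_o_semigroup K)"
    using sub op by (auto simp: s_def K.normal_iff_subgroup L.normal_iff_subgroup)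
  moreover have "s (sgmult (sub_o_semigroup L) V V') = sgmult (sub_o_semigroup K) (s V) (s V')"
    if "V \<in> carrier (sub_o_semigroup L)" "V' \<in> carrier (sub_o_semigroup L)" for V V'
  proof -
    have "sgmult (sub_o_semigroup L) V V' \<in> carrier (sub_o_semigroup L)"
      using L.normed_semigroup_sub_o that by (simp add: is_normed_semigroup_def)
    then show ?thesis using that by (auto simp: s_def sub_o_semigroup_def)
  qed
  moreover have "sgnorm (sub_o_semigroup K) (s V) \<le> sgnorm (sub_o_semigroup L) V"
    if "V \<in> carrier (sub_o_semigroup L)" for V
  proof -
    have V: "subgroup V L" "openin (topo L) V" using that by (auto simp: L.normal_iff_subgroup)
    show ?thesis
      using that K.card_rcosets_pos[OF sub[OF V(1)] op[OF V(2)]]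
        card_rcosets_vimage_le[OF f.group_hom_axioms V(1) L.finite_rcosets[OF V]]
      by (simp add: s_def sub_o_semigroup_def)
  qed
  ultimately have "s \<in> mor NSem (sub_o_semigroup L) (sub_o_semigroup K)"
    by (simp add: NSem_def semigroup_hom_def)
  then show "farr sub_o_functor L K f \<in> mor NSem (fobj sub_o_functor L) (fobj sub_o_functor K)"
    by (simp add: sub_o_functor_def s_def)
next
  fix M L K :: "'b top_group" and g f
  assume K: "M \<in> obj TdCAG" "L \<in> obj TdCAG" "K \<in> obj TdCAG" and g: "g \<in> mor TdCAG L M" and f: "f \<in> mor TdCAG K L"
  interpret M: td_compact_group M by unfold_locales fact
  interpret L: td_compact_group L by unfold_locales fact
  interpret g: group_hom L M g using g by unfold_locales (simp add: mor_TdCAG)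
  have "g -` V \<inter> carrier L \<in> carrier (sub_o_semigroup L)" if V: "V \<in> carrier (sub_o_semigroup M)" for V
  proof -
    have V': "subgroup V M" "openin (topo M) V" using V by (auto simp: M.normal_iff_subgroup)
    have "subgroup (g -` V \<inter> carrier L) L"
      using subgroup.m_closed[OF V'(1)] subgroup.m_inv_closed[OF V'(1)] subgroup.one_closed[OF V'(1)]
      by unfold_locales auto
    moreover have "openin (topo L) (g -` V \<inter> carrier L)"
      using g V'(2) by (auto simp: mor_TdCAG continuous_map_alt)
    ultimately show ?thesis by (simp add: L.normal_iff_subgroup)
  qed
  moreover have "compose (carrier K) g f -` V \<inter> carrier K = f -` (g -` V \<inter> carrier L) \<inter> carrier K" for V
    using f by (auto simp: compose_def mor_TdCAG hom_def)
  ultimately show "farr sub_o_functor M K (cmp TdCAG K L M g f) =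
      cmp NSem (fobj sub_o_functor M) (fobj sub_o_functor L) (fobj sub_o_functor K)
        (farr sub_o_functor L K f) (farr sub_o_functor M L g)"
    by (auto simp: sub_o_functor_def TdCAG_def NSem_def compose_def fun_eq_iff)
qed

section \<open>The bridge theorems\<close>

lemma SBT_TAG:
  "SBT (TAG :: ('a monoid, 'a \<Rightarrow> 'a) category) (op_cat TdCAG) dual_TAG sub_functor sub_o_functor"
proof -
  define \<eta> :: "'a monoid \<Rightarrow> 'a set \<Rightarrow> ('a \<Rightarrow> complex) set" where
    "\<eta> G = (\<lambda>F\<in>carrier (sub_semigroup G). pairing.annih (dual (discrete_group G)) (\<lambda>x \<xi>. \<xi> x) F)" for G
  have iso: "\<eta> G \<in> normed_semigroup_iso (sub_semigroup G) (sub_o_semigroup (dual (discrete_group G)))"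
    if "G \<in> obj TAG" for G
  proof -
    interpret torsion_group G by unfold_locales fact
    show ?thesis unfolding \<eta>_def by (rule annih_iso)
  qed
  have "compose (carrier (sub_semigroup G)) (farr (functor_comp sub_o_functor dual_TAG) G H f) (\<eta> G) =
      compose (carrier (sub_semigroup G)) (\<eta> H) (farr sub_functor G H f)"
    if GH: "G \<in> obj TAG" "H \<in> obj TAG" and f: "f \<in> mor TAG G H" for G H :: "'a monoid" and f
  proof
    fix F
    interpret G: torsion_group G by unfold_locales fact
    interpret H: torsion_group H by unfold_locales fact
    interpret f: group_hom G H f using f by unfold_locales (simp add: mor_TAG)
    let ?D = "dual_map (discrete_group G) (discrete_group H) f"
    show "compose (carrier (sub_semigroup G)) (farr (functor_comp sub_o_functor dual_TAG) G H f) (\<eta> G) F =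
      compose (carrier (sub_semigroup G)) (\<eta> H) (farr sub_functor G H f) F"
    proof (cases "F \<in> carrier (sub_semigroup G)")
      case True
      have D: "?D \<xi> \<in> characters (discrete_group G)" if "\<xi> \<in> characters (discrete_group H)" for \<xi>
        using dual_map_mor_TdCAG[OF GH f] that by (auto simp: mor_TdCAG hom_def)
      have \<eta>F: "\<eta> G F \<in> carrier (sub_o_semigroup (dual (discrete_group G)))"
        using iso[OF GH(1)] True by (auto simp: normed_semigroup_iso_def semigroup_hom_def)
      have fF: "f ` F \<in> carrier (sub_semigroup H)"
        using True f.subgroup_img_is_subgroup by simp
      \<comment> \<open>Naturality: \<open>\<xi>\<close> is trivial on the image of \<open>F\<close>
        exactly when \<open>\<xi>\<close> composed with \<open>f\<close> is trivial on
        \<open>F\<close>.\<close>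
      have "?D -` \<eta> G F \<inter> characters (discrete_group H) = \<eta> H (f ` F)"
        using True fF D subgroup.mem_carrier[of F G]
        by (auto simp: \<eta>_def G.annih_def H.annih_def dual_map_apply)
      then show ?thesis
        using True \<eta>F fF
        by (simp add: compose_def functor_comp_def sub_o_functor_def sub_functor_def dual_TAG_def
            del: carrier_sub_semigroup carrier_sub_o_semigroup)
    qed (simp add: compose_def del: carrier_sub_semigroup carrier_sub_o_semigroup)
  qed
  then have "natural_transformation TAG sub_functor (functor_comp sub_o_functor dual_TAG) \<eta>"
    using iso by (auto simp: natural_transformation_def normed_semigroup_iso_def functor_comp_def
        sub_functor_def sub_o_functor_def dual_TAG_def)
  moreover have "\<forall>G\<in>obj TAG. \<eta> G \<in> normed_semigroup_iso (fobj sub_functor G) (fobj sub_o_functor (fobj dual_TAG G))"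
    using iso by (simp add: sub_functor_def sub_o_functor_def dual_TAG_def)
  ultimately show ?thesis
    unfolding SBT_def using is_functor_dual_TAG is_functor_sub is_functor_sub_o by blast
qed

lemma SBT_TdCAG:
  "SBT (op_cat (TdCAG :: ('b top_group, 'b \<Rightarrow> 'b) category)) TAG dual_TdCAG sub_o_functor sub_functor"
proof -
  define \<alpha> :: "'b top_group \<Rightarrow> ('b \<Rightarrow> complex) set \<Rightarrow> 'b set" where
    "\<alpha> K = (\<lambda>F\<in>carrier (sub_semigroup (monoid.truncate (dual K))). pairing.annih K (\<lambda>\<xi> x. \<xi> x) F)" for K
  define \<eta> :: "'b top_group \<Rightarrow> 'b set \<Rightarrow> ('b \<Rightarrow> complex) set" where
    "\<eta> K = (\<lambda>V\<in>carrier (sub_o_semigroup K).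
      inv_into (carrier (sub_semigroup (monoid.truncate (dual K)))) (\<alpha> K) V)" for K
  have \<alpha>: "\<alpha> K \<in> normed_semigroup_iso (sub_semigroup (monoid.truncate (dual K))) (sub_o_semigroup K)"
    if "K \<in> obj TdCAG" for K
  proof -
    interpret td_compact_group K by unfold_locales fact
    interpret duality character_group K "\<lambda>\<xi> x. \<xi> x" by (rule duality_character_group)
    show ?thesis unfolding \<alpha>_def by (rule annih_iso)
  qed
  have iso: "\<eta> K \<in> normed_semigroup_iso (sub_o_semigroup K) (sub_semigroup (monoid.truncate (dual K)))"
    if "K \<in> obj TdCAG" for K
  proof -
    interpret td_compact_group K by unfold_locales fact
    show ?thesis
      unfolding \<eta>_def
      by (rule normed_semigroup_iso_inverse[OF normed_semigroup_sub[OF comm_group_character_group] \<alpha>[OF that]])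
  qed
  have inj: "inj_on (\<alpha> K) (carrier (sub_semigroup (monoid.truncate (dual K))))"
    and surj: "\<alpha> K ` carrier (sub_semigroup (monoid.truncate (dual K))) = carrier (sub_o_semigroup K)"
    if "K \<in> obj TdCAG" for K
    using \<alpha>[OF that] by (auto simp: normed_semigroup_iso_def bij_betw_def)
  have "compose (carrier (sub_o_semigroup L)) (farr (functor_comp sub_functor dual_TdCAG) L K f) (\<eta> L) =
      compose (carrier (sub_o_semigroup L)) (\<eta> K) (farr sub_o_functor L K f)"
    if LK: "L \<in> obj TdCAG" "K \<in> obj TdCAG" and f: "f \<in> mor TdCAG K L" for L K :: "'b top_group" and f
  proof
    fix V
    interpret L: td_compact_group L by unfold_locales fact
    interpret K: td_compact_group K by unfold_locales fact
    interpret LD: duality L.character_group L "\<lambda>\<xi> x. \<xi> x" by (rule L.duality_character_group)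
    interpret KD: duality K.character_group K "\<lambda>\<xi> x. \<xi> x" by (rule K.duality_character_group)
    interpret D: group_hom L.character_group K.character_group "dual_map K L f"
      using dual_map_mor_TAG[OF LK(2,1) f] by unfold_locales (simp add: mor_TAG)
    show "compose (carrier (sub_o_semigroup L)) (farr (functor_comp sub_functor dual_TdCAG) L K f) (\<eta> L) V =
      compose (carrier (sub_o_semigroup L)) (\<eta> K) (farr sub_o_functor L K f) V"
    proof (cases "V \<in> carrier (sub_o_semigroup L)")
      case True
      define F where "F = \<eta> L V"
      have F: "F \<in> carrier (sub_semigroup L.character_group)" and \<alpha>F: "\<alpha> L F = V"
        using True surj[OF LK(1)] unfolding F_def \<eta>_def
        by (auto simp del: carrier_sub_semigroup carrier_sub_o_semigroup simp: inv_into_into f_inv_into_f)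
      have DF: "dual_map K L f ` F \<in> carrier (sub_semigroup K.character_group)"
        using F D.subgroup_img_is_subgroup by simp
      have "f x \<in> carrier L" if "x \<in> carrier K" for x using f that by (auto simp: mor_TdCAG hom_def)
      \<comment> \<open>Naturality is verified for the annihilator map \<open>\<alpha>\<close>,
        where it is a computation with characters, and then carried over to its inverse
        \<open>\<eta>\<close> by injectivity.\<close>
      then have "\<alpha> K (dual_map K L f ` F) = f -` V \<inter> carrier K"
        using F DF \<alpha>F[symmetric] subgroup.subset[of F L.character_group]
        by (auto simp: \<alpha>_def KD.annih_def LD.annih_def dual_map_apply subset_iff)
      moreover from this have "f -` V \<inter> carrier K \<in> carrier (sub_o_semigroup K)"
        using DF surj[OF LK(2)] by blast
      ultimately have "\<eta> K (f -` V \<inter> carrier K) = dual_map K L f ` F"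
        using inv_into_f_f[OF inj[OF LK(2)] DF]
        by (simp add: \<eta>_def del: carrier_sub_semigroup carrier_sub_o_semigroup)
      then show ?thesis
        using True F
        by (simp add: compose_def functor_comp_def sub_o_functor_def sub_functor_def dual_TdCAG_def
            F_def[symmetric] del: carrier_sub_semigroup carrier_sub_o_semigroup)
    qed (simp add: compose_def del: carrier_sub_semigroup carrier_sub_o_semigroup)
  qed
  then have "natural_transformation (op_cat TdCAG) sub_o_functor (functor_comp sub_functor dual_TdCAG) \<eta>"
    using iso by (auto simp: natural_transformation_def normed_semigroup_iso_def functor_comp_def
        sub_functor_def sub_o_functor_def dual_TdCAG_def)
  moreover have "\<forall>K\<in>obj (op_cat TdCAG). \<eta> K \<in>
      normed_semigroup_iso (fobj sub_o_functor K) (fobj sub_functor (fobj dual_TdCAG K))"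
    using iso by (simp add: sub_functor_def sub_o_functor_def dual_TdCAG_def)
  ultimately show ?thesis
    unfolding SBT_def using is_functor_dual_TdCAG is_functor_sub is_functor_sub_o by blast
qed

lemma BT_TAG: "BT TAG dual_TAG ent (\<lambda>K. h_top (topo K))"
  unfolding BT_def
proof (intro ballI)
  fix G :: "'a monoid" and \<phi> assume G: "G \<in> obj TAG" and \<phi>: "\<phi> \<in> mor TAG G G"
  interpret torsion_group G by unfold_locales fact
  interpret dual_endomorphisms G "dual D" "\<lambda>x \<xi>. \<xi> x" \<phi> "dual_map D D \<phi>"
    using \<phi> dual_map_mor_TdCAG[OF G G \<phi>]
    by unfold_locales (auto simp: mor_TAG mor_TdCAG dual_map_apply)
  show "h_top (topo (fobj dual_TAG G)) (farr dual_TAG G G \<phi>) = ent G \<phi>"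
    using h_top_eq_ent by (simp add: dual_TAG_def)
qed

lemma BT_TdCAG: "BT (op_cat TdCAG) dual_TdCAG (\<lambda>K. h_top (topo K)) ent"
  unfolding BT_def op_cat_simps
proof (intro ballI)
  fix K :: "'b top_group" and \<phi> assume K: "K \<in> obj TdCAG" and \<phi>: "\<phi> \<in> mor TdCAG K K"
  interpret td_compact_group K by unfold_locales fact
  interpret duality character_group K "\<lambda>\<xi> x. \<xi> x" by (rule duality_character_group)
  interpret dual_endomorphisms character_group K "\<lambda>\<xi> x. \<xi> x" "dual_map K K \<phi>" \<phi>
    using \<phi> dual_map_mor_TAG[OF K K \<phi>]
    by unfold_locales (auto simp: mor_TAG mor_TdCAG dual_map_apply)
  show "ent (fobj dual_TdCAG K) (farr dual_TdCAG K K \<phi>) = h_top (topo K) \<phi>"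
    using h_top_eq_ent by (simp add: dual_TdCAG_def)
qed

theorem theorem6p27:
  shows
    "(SBT (TAG :: ('a monoid, 'a \<Rightarrow> 'a) category) (op_cat TdCAG) dual_TAG sub_functor sub_o_functor
      \<and> BT (TAG :: ('a monoid, 'a \<Rightarrow> 'a) category) dual_TAG ent (\<lambda>K. h_top (topo K)))
   \<and> (SBT (op_cat (TdCAG :: ('b top_group, 'b \<Rightarrow> 'b) category)) TAG dual_TdCAG sub_o_functor sub_functor
      \<and> BT (op_cat (TdCAG :: ('b top_group, 'b \<Rightarrow> 'b) category)) dual_TdCAG (\<lambda>K. h_top (topo K)) ent)"
  using SBT_TAG BT_TAG SBT_TdCAG BT_TdCAG by blast

end
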